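(* Let $G$ be a subgraph of $K_{n,d}$ with no isolated vertex in $[n]$. There is a bijection between mixed subdivisions of the generalized permutohedron $P_G$ and $G$-tropical oriented matroids, under which types correspond to the faces of the mixed subdivision. That is, the map sending a mixed subdivision $\mathcal{C}$ of $P_G$ to the collection $\mathcal{O}(\mathcal{C})$ of all types of faces of $\mathcal{C}$ is a bijection from the set of mixed subdivisions of $P_G$ onto the set of $G$-tropical oriented matroids. Consequently (composing with the Cayley trick bijection between polyhedral subdivisions of the root polytope $Q_G$ and mixed subdivisions of $P_G$) there is likewise a bijection between polyhedral subdivisions of $Q_G$ and $G$-tropical oriented matroids.
   Context: Let $n,d$ be positive integers, $[n]=\{1,\dots,n\}$, $[\bar d]=\{\bar 1,\dots,\bar d\}$. $K_{n,d}$ is the complete bipartite graph with left vertex set $[n]$ and right vertex set $[\bar d]$. Subgraphs of $K_{n,d}$ are taken on the full vertex set $[n]\sqcup[\bar d]$. For a subgraph $G$ and $i\in[n]$, $G_i\subseteq[\bar d]$ is the set of neighbors of $i$. Polytopes. $e_1,\dots,e_n,e_{\bar 1},\dots,e_{\bar d}$ are the standard basis vectors of $\mathbb{R}^{n+d}$; $e_{\bar j}$ also denotes the corresponding basis vector of $\mathbb{R}^d$. For $\varnothing\ne\bar J\subseteq[\bar d]$, $\Delta_{\bar J}=\mathrm{conv}\{e_{\bar j}:\bar j\in\bar J\}\subset\mathbb{R}^d$. The root polytope is $Q_G=\mathrm{conv}\{e_i+e_{\bar j}:(i,\bar j)\in E(G)\}\subset\mathbb{R}^{n+d}$. The generalized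 permutohedron is the Minkowski sum $P_G=\sum_{i=1}^n\Delta_{G_i}\subset\mathbb{R}^d$. Subdivisions. A cell of a polytope $Q$ is a polytope of the same dimension as $Q$ whose vertices form a subset of the vertices of $Q$. A polyhedral subdivision of $Q$ is a collection of cells covering $Q$ such that for any two cells $C,C'$ the intersection $C\cap C'$ is a common (possibly empty) face of both. For a Minkowski sum $P=\sum_{i=1}^nP_i$, a Minkowski cell is a polytope $C=\sum_{i=1}^nC_i$ of the same dimension as $P$, together with its summands $C_1,\dots,C_n$, where the vertices of $C_i$ form a nonempty subset of the vertices of $P_i$. A mixed subdivision of $P$ is a polyhedral subdivision of $P$ into Minkowski cells (a collection of Minkowski cells covering $P$ and pairwise meeting in common faces) such that for any two cells $C=\sum C_i$, $C'=\sum C'_i$ we have $C\cap C'=\sum_i(C_i\cap C'_i)$, and each $C_i\cap C_i'$ is a common face of $C_i$ and $C'_i$. A face of a mixed subdivision of $P_G$ is a nonempty face $F$ of one of its cells $C=\sum C_i$ (including $C$ itself); it is written uniquely as $F=\sum_iF_i$ with $F_i$ a nonempty face of $C_i$, and $F_i=\Delta_{A_i}$ for a unique nonempty $A_i\subseteq G_i$. The tuple $(A_1,\dots,A_n)$ is called the type of the face $F$. Cayley trick (known): polyhedral subdivisions of $Q_G$ are in bijection with mixed subdivisions of $P_G$, obtained by intersecting with the affine subspace $\{\frac1n\mathbf 1_{[n]}\}\times\mathbb{R}^d$ and dilating by $n$; the cell $Q_{G'}$ ($G'\subseteq G$) corresponds to the Minkowski cell $P_{G'}=\sum_i\Delta_{G'_i}$.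 Types. An $(n,d)$-type is a tuple $A=(A_1,\dots,A_n)$ of nonempty subsets of $[\bar d]$; it is identified with the subgraph of $K_{n,d}$ having edges $(i,\bar j)$ for $\bar j\in A_i$. The refinement of a type $A$ with respect to an ordered partition $P=(P_1,\dots,P_r)$ of $[\bar d]$ is the type obtained by replacing each $A_i$ by $A_i\cap P_m$, where $m$ is the smallest index with $A_i\cap P_m\neq\varnothing$. It is total if $r=d$ (all parts are singletons). Two subgraphs $A,B$ of $K_{n,d}$ are compatible if whenever there is a cycle in $A\cup B$ (vertices may repeat) whose edges alternate between edges of $A$ and edges of $B$, all edges of the cycle lie in both $A$ and $B$. A $G$-tropical oriented matroid is a collection $\mathcal{O}$ of $(n,d)$-types such that: (Subgraph) each type is a subgraph of $G$; (Generalized Boundary) every total refinement of $G$ is in $\mathcal{O}$; (Surrounding) $\mathcal{O}$ is closed under refinements; (Comparability) the types in $\mathcal{O}$ are pairwise compatible; (Elimination) for any $A,B\in\mathcal{O}$ and $i\in[n]$ there is $C\in\mathcal{O}$ with $C_i=A_i\cup B_i$ and $C_{i'}\in\{A_{i'},B_{i'},A_{i'}\cup B_{i'}\}$ for all $i'\in[n]$. *)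

theory Defs
  imports "HOL-Analysis.Analysis"
begin

text \<open>
  The vertex sets \<open>[n]\<close> and \<open>[d]\<close> of the complete bipartite graph are two finite types \<open>'n\<close> and
  \<open>'d\<close> (so \<open>n, d \<ge> 1\<close>).  A subgraph on the full vertex set is its edge set, of type
  \<open>('n \<times> 'd) set\<close>; the space of dimension \<open>n + d\<close> is \<open>(real ^ 'n) \<times> (real ^ 'd)\<close>.
\<close>

definition nbrs :: "('n \<times> 'd) set \<Rightarrow> 'n \<Rightarrow> 'd set" where
  "nbrs G i = {j. (i, j) \<in> G}"

definition edges :: "('n \<Rightarrow> 'd set) \<Rightarrow> ('n \<times> 'd) set" where
  "edges A = {(i, j). j \<in> A i}"

definition no_isolated_left :: "('n \<times> 'd) set \<Rightarrow> bool" where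
  "no_isolated_left G \<longleftrightarrow> (\<forall>i. nbrs G i \<noteq> {})"


section \<open>Polytopes and subdivisions\<close>

definition simplex_on :: "'d::finite set \<Rightarrow> (real ^ 'd) set" where
  "simplex_on J = convex hull ((\<lambda>j. axis j 1) ` J)"

definition root_polytope :: "('n::finite \<times> 'd::finite) set \<Rightarrow> ((real ^ 'n) \<times> (real ^ 'd)) set" where
  "root_polytope G = convex hull ((\<lambda>(i, j). (axis i 1, axis j 1)) ` G)"

text \<open>Sums of sets are Minkowski sums, as in \<open>HOL-Library.Set_Algebras\<close>.\<close>

definition minkowski :: "('n::finite \<Rightarrow> 'a::euclidean_space set) \<Rightarrow> 'a set" where
  "minkowski C = (\<Sum>i\<in>UNIV. C i)"

definition perm_summands :: "('n \<times> 'd::finite) set \<Rightarrow> 'n \<Rightarrow> (real ^ 'd) set" where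
  "perm_summands G i = simplex_on (nbrs G i)"

definition gen_permutohedron :: "('n::finite \<times> 'd::finite) set \<Rightarrow> (real ^ 'd) set" where
  "gen_permutohedron G = minkowski (perm_summands G)"

definition vertices :: "'a::euclidean_space set \<Rightarrow> 'a set" where
  "vertices P = {v. v extreme_point_of P}"

text \<open>The empty set and the whole polytope count as faces for \<open>face_of\<close>.\<close>

definition common_face :: "'a::euclidean_space set \<Rightarrow> 'a set \<Rightarrow> 'a set \<Rightarrow> bool" where
  "common_face F C C' \<longleftrightarrow> F face_of C \<and> F face_of C'"

definition is_cell :: "'a::euclidean_space set \<Rightarrow> 'a set \<Rightarrow> bool" where
  "is_cell Q C \<longleftrightarrow> polytope C \<and> aff_dim C = aff_dim Q \<and> vertices C \<subseteq> vertices Q"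

definition polyhedral_subdivision :: "'a::euclidean_space set \<Rightarrow> 'a set set \<Rightarrow> bool" where
  "polyhedral_subdivision Q \<C> \<longleftrightarrow>
     (\<forall>C\<in>\<C>. is_cell Q C) \<and>
     \<Union>\<C> = Q \<and>
     (\<forall>C\<in>\<C>. \<forall>C'\<in>\<C>. common_face (C \<inter> C') C C')"

text \<open>A Minkowski cell comes together with its summands, so it is represented by the family of
  summands; the underlying polytope is \<^term>\<open>minkowski C\<close>.\<close>

definition is_minkowski_cell ::
    "('n::finite \<Rightarrow> 'a::euclidean_space set) \<Rightarrow> ('n \<Rightarrow> 'a set) \<Rightarrow> bool" where
  "is_minkowski_cell P C \<longleftrightarrow>
     aff_dim (minkowski C) = aff_dim (minkowski P) \<and>
     (\<forall>i. polytope (C i) \<and> vertices (C i) \<noteq> {} \<and> vertices (C i) \<subseteq> vertices (P i))"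

definition mixed_subdivision ::
    "('n::finite \<Rightarrow> 'a::euclidean_space set) \<Rightarrow> ('n \<Rightarrow> 'a set) set \<Rightarrow> bool" where
  "mixed_subdivision P \<C> \<longleftrightarrow>
     (\<forall>C\<in>\<C>. is_minkowski_cell P C) \<and>
     (\<Union>C\<in>\<C>. minkowski C) = minkowski P \<and>
     (\<forall>C\<in>\<C>. \<forall>C'\<in>\<C>.
        common_face (minkowski C \<inter> minkowski C') (minkowski C) (minkowski C') \<and>
        minkowski C \<inter> minkowski C' = minkowski (\<lambda>i. C i \<inter> C' i) \<and>
        (\<forall>i. common_face (C i \<inter> C' i) (C i) (C' i)))"

definition mixed_faces :: "('n::finite \<Rightarrow> 'a::euclidean_space set) set \<Rightarrow> 'a set set" where
  "mixed_faces \<C> = {F. F \<noteq> {} \<and> (\<exists>C\<in>\<C>. F face_of minkowski C)}"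

text \<open>In a mixed subdivision of a generalized permutohedron the family \<open>A\<close> below exists and is
  unique for each face, and does not depend on the cell \<open>C\<close> containing the face.\<close>

definition face_type ::
    "('n::finite \<Rightarrow> (real ^ 'd::finite) set) set \<Rightarrow> (real ^ 'd) set \<Rightarrow> 'n \<Rightarrow> 'd set" where
  "face_type \<C> F =
     (THE A. \<exists>C\<in>\<C>. F face_of minkowski C \<and>
        F = minkowski (\<lambda>i. simplex_on (A i)) \<and>
        (\<forall>i. A i \<noteq> {} \<and> simplex_on (A i) face_of C i))"

definition types_of_faces ::
    "('n::finite \<Rightarrow> (real ^ 'd::finite) set) set \<Rightarrow> ('n \<Rightarrow> 'd set) set" where
  "types_of_faces \<C> = face_type \<C> ` mixed_faces \<C>"


section \<open>The Cayley trick\<close>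

definition cayley ::
    "((real ^ 'n::finite) \<times> (real ^ 'd::finite)) set set \<Rightarrow> ('n \<Rightarrow> (real ^ 'd) set) set" where
  "cayley \<S> = {perm_summands H |H. root_polytope H \<in> \<S>}"

text \<open>Geometrically, \<open>cayley\<close> sends a cell to its section by the affine subspace
  \<open>{(1/n, \<dots>, 1/n)} \<times> \<real>\<^sup>d\<close>, dilated by \<open>n\<close>.\<close>

lemma root_polytope_section:
  fixes H :: "('n::finite \<times> 'd::finite) set"
  assumes "no_isolated_left H"
  shows "gen_permutohedron H =
    {real CARD('n) *\<^sub>R y |y. ((\<chi> i. 1 / real CARD('n)), y) \<in> root_polytope H}"
proof -
  let ?D = "\<lambda>i. simplex_on (nbrs H i)"
  let ?S = "\<lambda>i::'n. {axis i (1::real)} \<times> ?D i"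
  let ?n = "real CARD('n)"
  have npos: "?n > 0" by simp
  have ne: "?D i \<noteq> {}" for i
    using assms by (simp add: simplex_on_def no_isolated_left_def)
  have hullS: "?S i = convex hull (Pair (axis i 1) ` (\<lambda>j. axis j (1::real)) ` nbrs H i)" for i
  proof -
    have "Pair (axis i (1::real)) ` (\<lambda>j::'d. axis j (1::real)) ` nbrs H i
        = {axis i 1} \<times> ((\<lambda>j. axis j 1) ` nbrs H i)" by auto
    then show ?thesis by (simp add: simplex_on_def convex_hull_Times)
  qed
  have cvxS: "convex (?S i)" for i
    by (simp add: hullS)
  have un: "(\<lambda>(i, j). (axis i (1::real), axis j (1::real))) ` H
      = (\<Union>i. Pair (axis i 1) ` (\<lambda>j. axis j 1) ` nbrs H i)"
    by (force simp: nbrs_def)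
  have hull_eq: "root_polytope H = convex hull (\<Union>i\<in>UNIV. ?S i)"
  proof
    show "root_polytope H \<subseteq> convex hull (\<Union>i\<in>UNIV. ?S i)"
      unfolding root_polytope_def un hullS
      by (intro hull_mono UN_mono subset_refl hull_subset)
    show "convex hull (\<Union>i\<in>UNIV. ?S i) \<subseteq> root_polytope H"
      unfolding root_polytope_def un hullS
      by (intro hull_minimal UN_least hull_mono convex_convex_hull) auto
  qed
  have chu: "root_polytope H = {\<Sum>i\<in>UNIV. c i *\<^sub>R s i |c s.
      (\<forall>i\<in>UNIV. 0 \<le> c i) \<and> sum c UNIV = (1::real) \<and> (\<forall>i\<in>UNIV. s i \<in> ?S i)}"
    unfolding hull_eq by (rule convex_hull_finite_union) (use cvxS ne in auto)
  have mk: "gen_permutohedron H = {sum s UNIV |s. \<forall>i\<in>UNIV. s i \<in> ?D i}"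
    by (simp add: gen_permutohedron_def minkowski_def perm_summands_def set_sum_alt)
  have axis_sum: "(\<Sum>i\<in>UNIV. c i *\<^sub>R axis i (1::real)) = (\<chi> i. c i)" for c :: "'n \<Rightarrow> real"
    by (simp add: vec_eq_iff axis_def if_distrib sum.delta cong: if_cong)
  show ?thesis
  proof (intro equalityI subsetI)
    fix y assume "y \<in> gen_permutohedron H"
    then obtain s where s: "y = sum s UNIV" "\<And>i. s i \<in> ?D i" by (auto simp: mk)
    have eq: "(\<Sum>i\<in>UNIV. (1 / ?n) *\<^sub>R (axis i (1::real), s i)) = ((\<chi> i. 1 / ?n), (1 / ?n) *\<^sub>R y)"
      using axis_sum[of "\<lambda>_. 1 / ?n"]
      by (simp add: prod_eq_iff fst_sum snd_sum s(1) scaleR_sum_right)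
    have "((\<chi> i. 1 / ?n), (1 / ?n) *\<^sub>R y) \<in> root_polytope H"
      unfolding chu eq[symmetric] using s(2)
      by (auto intro!: exI[of _ "\<lambda>_. 1 / ?n"] exI[of _ "\<lambda>i. (axis i 1, s i)"])
    then show "y \<in> {?n *\<^sub>R y |y. ((\<chi> i. 1 / ?n), y) \<in> root_polytope H}"
      using npos by (auto intro!: exI[of _ "(1 / ?n) *\<^sub>R y"])
  next
    fix x assume "x \<in> {?n *\<^sub>R y |y. ((\<chi> i. 1 / ?n), y) \<in> root_polytope H}"
    then obtain y where x: "x = ?n *\<^sub>R y" and "((\<chi> i. 1 / ?n), y) \<in> root_polytope H" by auto
    then obtain c s where cs: "((\<chi> i. 1 / ?n), y) = (\<Sum>i\<in>UNIV. c i *\<^sub>R s i)" 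
      "\<And>i. s i \<in> ?S i" unfolding chu by auto
    have "fst (s i) = axis i 1" "snd (s i) \<in> ?D i" for i using cs(2)[of i] by auto
    note s = this
    have "(\<chi> i. 1 / ?n) = fst (\<Sum>i\<in>UNIV. c i *\<^sub>R s i)" by (simp flip: cs(1))
    also have "\<dots> = (\<chi> i. c i)" by (simp add: fst_sum s axis_sum)
    finally have c: "c i = 1 / ?n" for i by (simp add: vec_eq_iff)
    have "y = snd (\<Sum>i\<in>UNIV. c i *\<^sub>R s i)" by (simp flip: cs(1))
    also have "\<dots> = (\<Sum>i\<in>UNIV. (1 / ?n) *\<^sub>R snd (s i))" by (simp add: snd_sum c)
    finally have "x = (\<Sum>i\<in>UNIV. snd (s i))"
      using npos by (simp add: x scaleR_sum_right)
    then show "x \<in> gen_permutohedron H" unfolding mk using s(2) by auto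
  qed
qed


section \<open>Types and tropical oriented matroids\<close>

definition is_type :: "('n \<Rightarrow> 'd set) \<Rightarrow> bool" where
  "is_type A \<longleftrightarrow> (\<forall>i. A i \<noteq> {})"

definition ordered_partition :: "'d set list \<Rightarrow> bool" where
  "ordered_partition P \<longleftrightarrow> distinct P \<and> partition_on UNIV (set P)"

definition refinement :: "('n \<Rightarrow> 'd set) \<Rightarrow> 'd set list \<Rightarrow> 'n \<Rightarrow> 'd set" where
  "refinement A P i = A i \<inter> P ! (LEAST m. m < length P \<and> A i \<inter> P ! m \<noteq> {})"

definition total_partition :: "'d::finite set list \<Rightarrow> bool" where
  "total_partition P \<longleftrightarrow> ordered_partition P \<and> length P = CARD('d)"

text \<open>A closed walk alternating between \<open>A\<close> and \<open>B\<close> in a bipartite graph has even length \<open>2 m\<close> and,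
  after choosing its direction and starting point, traverses its edges in \<open>A\<close> from left to right
  and those in \<open>B\<close> from right to left: it visits \<open>l 0, r 0, l 1, r 1, \<dots>, l (m - 1), r (m - 1), l 0\<close>.
  Vertices and edges may repeat.\<close>

definition alternating_cycle ::
    "('n \<times> 'd) set \<Rightarrow> ('n \<times> 'd) set \<Rightarrow> nat \<Rightarrow> (nat \<Rightarrow> 'n) \<Rightarrow> (nat \<Rightarrow> 'd) \<Rightarrow> bool" where
  "alternating_cycle A B m l r \<longleftrightarrow>
     m > 0 \<and> (\<forall>k<m. (l k, r k) \<in> A \<and> (l (Suc k mod m), r k) \<in> B)"

definition compatible :: "('n \<times> 'd) set \<Rightarrow> ('n \<times> 'd) set \<Rightarrow> bool" where
  "compatible A B \<longleftrightarrow>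
     (\<forall>m l r. alternating_cycle A B m l r \<longrightarrow>
        (\<forall>k<m. (l k, r k) \<in> A \<inter> B \<and> (l (Suc k mod m), r k) \<in> A \<inter> B))"

definition tropical_oriented_matroid ::
    "('n::finite \<times> 'd::finite) set \<Rightarrow> ('n \<Rightarrow> 'd set) set \<Rightarrow> bool" where
  "tropical_oriented_matroid G \<O> \<longleftrightarrow>
     (\<forall>A\<in>\<O>. is_type A) \<and>
     \<comment> \<open>Subgraph\<close>
     (\<forall>A\<in>\<O>. edges A \<subseteq> G) \<and>
     \<comment> \<open>Generalized Boundary\<close>
     (\<forall>P. total_partition P \<longrightarrow> refinement (nbrs G) P \<in> \<O>) \<and>
     \<comment> \<open>Surrounding\<close>
     (\<forall>A\<in>\<O>. \<forall>P. ordered_partition P \<longrightarrow> refinement A P \<in> \<O>) \<and>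
     \<comment> \<open>Comparability\<close>
     (\<forall>A\<in>\<O>. \<forall>B\<in>\<O>. compatible (edges A) (edges B)) \<and>
     \<comment> \<open>Elimination\<close>
     (\<forall>A\<in>\<O>. \<forall>B\<in>\<O>. \<forall>i. \<exists>C\<in>\<O>. C i = A i \<union> B i \<and>
        (\<forall>i'. C i' \<in> {A i', B i', A i' \<union> B i'}))"

end

theory Submission
  imports Defs
begin

text \<open>
  A point of the root polytope is the pair of marginals of a nonnegative matrix (a flow) supported
  on \<open>G\<close>, and the generalized permutohedron is the section where all row sums are 1.  Two cells
  \<open>H\<close>, \<open>H'\<close> meet in a common face iff any two flows on \<open>H\<close> and \<open>H'\<close> with the same marginals are both
  supported on \<open>H \<inter> H'\<close>; this is compatibility, and it does not depend on the section.  Refining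
  \<open>H\<close> by a potential on \<open>[d]\<close> means passing to the face maximizing that potential.  So mixed
  subdivisions, subdivisions of the root polytope and the sets of maximal types of a matroid are the
  same families of subgraphs, provided that

  (1) the cells of a tropical oriented matroid cover: if \<open>y\<close> is the point of the union closest to an
  uncovered \<open>x\<close>, then elimination in the direction \<open>x - y\<close> against a type of a facet (known by
  induction on the number of edges) yields a larger type at \<open>y\<close> that leads closer to \<open>x\<close>;

  (2) the faces of a subdivision satisfy elimination: take relative interior points \<open>a\<close>, \<open>b\<close> of the
  faces \<open>A\<close>, \<open>B\<close> as flows and mix row \<open>k\<close> with weight \<open>s\<^sub>k\<close>, where \<open>s\<^sub>i = 1/2\<close>.  A Brouwer fixed point
  argument finds \<open>s\<close> such that the mixed flow is supported on the face containing its marginals in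
  its relative interior, and this face has the required type.
\<close>

section \<open>Flows and their marginals\<close>

text \<open>Only unit row sums are given, yet other row sums are needed: in (1) a type of the facet
  must contain prescribed rows of \<open>A\<close> and is free in the others, which amounts to a
  flow with empty rows, and the full dimension of a maximal type is tested by adding a single edge
  to a flow. The obstacle in (2) is that the face of the mixed flow may use edges outside both types
  or, in a row of weight 0 or 1, a part of the other type. Potentials separating \<open>A\<close>
  and \<open>B\<close> from a cell detect this, but they jump where cells meet. They are therefore
  averaged over the cells at the point, which makes the choice of the weights a fixed point problem
  of Kakutani type. Averaging needs a uniform gap: the potentials count predecessors in a preorder,
  so they jump by at least 1 and leave 1/2 on either side of a row level. The flow compared with the
  mixture must depend continuously on the point and show its whole face, so a strictly concave
  function selects it.\<close>

definition flows :: "('n::finite \<times> 'd::finite) set \<Rightarrow> (real^'d^'n) set" where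
  "flows H = {f. \<forall>i j. 0 \<le> f$i$j \<and> ((i, j) \<notin> H \<longrightarrow> f$i$j = 0)}"

definition marg :: "real^'d^'n \<Rightarrow> (real^'n::finite) \<times> (real^'d::finite)" where
  "marg f = ((\<chi> i. \<Sum>j\<in>UNIV. f$i$j), (\<Sum>i\<in>UNIV. f$i))"

definition unit_flow :: "'n::finite \<Rightarrow> 'd::finite \<Rightarrow> real^'d^'n" where
  "unit_flow i j = axis i (axis j 1)"

definition supp :: "real^'d^'n \<Rightarrow> ('n::finite \<times> 'd::finite) set" where
  "supp f = {(i, j). f$i$j \<noteq> 0}"

definition mcone :: "('n::finite \<times> 'd::finite) set \<Rightarrow> ((real^'n) \<times> (real^'d)) set" where
  "mcone H = marg ` flows H"

lemma marg_fst [simp]: "fst (marg f) $ i = (\<Sum>j\<in>UNIV. f$i$j)"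
  by (simp add: marg_def)

lemma marg_snd [simp]: "snd (marg f) $ j = (\<Sum>i\<in>UNIV. f$i$j)"
  by (simp add: marg_def)

lemma marg_eq_iff:
  "marg f = marg g \<longleftrightarrow>
     (\<forall>i. (\<Sum>j\<in>UNIV. f$i$j) = (\<Sum>j\<in>UNIV. g$i$j)) \<and> (\<forall>j. (\<Sum>i\<in>UNIV. f$i$j) = (\<Sum>i\<in>UNIV. g$i$j))"
  by (simp add: prod_eq_iff vec_eq_iff)

lemma marg_eqD:
  assumes "marg f = marg g"
  shows "(\<Sum>j\<in>UNIV. f$i$j) = (\<Sum>j\<in>UNIV. g$i$j)" "(\<Sum>i\<in>UNIV. f$i$j) = (\<Sum>i\<in>UNIV. g$i$j)"
  using assms by (simp_all add: marg_eq_iff)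

lemma marg_add: "marg (f + g) = marg f + marg g"
  and marg_scaleR: "marg (c *\<^sub>R f) = c *\<^sub>R marg f"
  and marg_diff: "marg (f - g) = marg f - marg g"
  and marg_0: "marg 0 = 0"
  by (simp_all add: prod_eq_iff vec_eq_iff sum.distrib sum_subtractf sum_distrib_left)

lemma linear_marg: "linear marg"
  by (rule linearI) (auto simp: marg_add marg_scaleR)

lemma marg_sum: "marg (\<Sum>x\<in>S. f x) = (\<Sum>x\<in>S. marg (f x))"
  by (rule linear_sum[OF linear_marg])

lemma unit_flow_nth [simp]: "unit_flow i j $ a $ b = (if a = i \<and> b = j then 1 else 0)"
  by (simp add: unit_flow_def axis_def)

lemma marg_unit_flow: "marg (unit_flow i j) = (axis i 1, axis j 1)"
  by (auto simp: prod_eq_iff vec_eq_iff axis_def if_distrib[of "\<lambda>x. x $ _"] cong: if_cong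
      intro!: sum.neutral)

lemma flow_decomp: "f = (\<Sum>i\<in>UNIV. \<Sum>j\<in>UNIV. f$i$j *\<^sub>R unit_flow i j)"
proof -
  have "(\<Sum>i\<in>UNIV. \<Sum>j\<in>UNIV. f$i$j * (if a = i \<and> b = j then 1 else 0)) = f$a$b" for a b
  proof -
    have "(\<Sum>j\<in>UNIV. f$i$j * (if a = i \<and> b = j then 1 else 0)) = (if a = i then f$i$b else 0)" for i
      by (simp add: if_distrib sum.delta cong: if_cong)
    then show ?thesis by (simp add: sum.delta)
  qed
  then show ?thesis by (simp add: vec_eq_iff)
qed

lemma marg_decomp: "marg f = (\<Sum>i\<in>UNIV. \<Sum>j\<in>UNIV. f$i$j *\<^sub>R (axis i 1, axis j 1))"
  by (subst flow_decomp[of f]) (simp only: marg_sum marg_scaleR marg_unit_flow)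

lemma flowsD: "f \<in> flows H \<Longrightarrow> 0 \<le> f$i$j" "f \<in> flows H \<Longrightarrow> (i, j) \<notin> H \<Longrightarrow> f$i$j = 0"
  by (auto simp: flows_def)

lemma flows_0 [simp]: "0 \<in> flows H"
  by (simp add: flows_def)

lemma flows_add: "f \<in> flows H \<Longrightarrow> g \<in> flows H \<Longrightarrow> f + g \<in> flows H"
  by (simp add: flows_def)

lemma flows_scaleR: "f \<in> flows H \<Longrightarrow> 0 \<le> c \<Longrightarrow> c *\<^sub>R f \<in> flows H"
  by (simp add: flows_def)

lemma flows_sum: "(\<And>x. x \<in> S \<Longrightarrow> f x \<in> flows H) \<Longrightarrow> (\<Sum>x\<in>S. f x) \<in> flows H"
  by (induction S rule: infinite_finite_induct) (auto simp: flows_add)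

lemma flows_mono: "f \<in> flows H \<Longrightarrow> H \<subseteq> K \<Longrightarrow> f \<in> flows K"
  by (auto simp: flows_def)

lemma flows_Int: "f \<in> flows H \<Longrightarrow> f \<in> flows K \<Longrightarrow> f \<in> flows (H \<inter> K)"
  by (auto simp: flows_def)

lemma unit_flow_flows: "(i, j) \<in> H \<Longrightarrow> unit_flow i j \<in> flows H"
  by (auto simp: flows_def)

lemma flows_supp_iff: "f \<in> flows H \<Longrightarrow> f \<in> flows K \<longleftrightarrow> supp f \<subseteq> K"
  by (auto simp: flows_def supp_def)

lemma flows_supp: "f \<in> flows H \<Longrightarrow> supp f \<subseteq> H"
  by (auto simp: flows_def supp_def)

lemma convex_cone_flows: "convex_cone (flows H)"
  by (auto simp: convex_cone_iff flows_add flows_scaleR)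

lemma convex_flows: "convex (flows H)"
  using convex_cone_flows by (auto simp: convex_cone_def)

lemma closed_flows: "closed (flows H)"
proof -
  have "flows H = (\<Inter>i j. {f. 0 \<le> f$i$j}) \<inter> (\<Inter>p\<in>-H. {f. f$fst p$snd p = 0})"
    by (auto simp: flows_def) (metis ComplI fst_conv snd_conv)
  then show ?thesis
    by (auto intro!: closed_INT closed_Collect_le closed_Collect_eq continuous_intros)
qed

lemma convex_cone_mcone: "convex_cone (mcone H)"
  unfolding mcone_def using convex_cone_linear_image[OF conjI[OF convex_cone_flows linear_marg]] by blast

lemma convex_mcone: "convex (mcone H)"
  using convex_cone_mcone by (auto simp: convex_cone_def)

lemma convex_cone_sum:
  assumes "convex_cone K" "\<And>x. x \<in> S \<Longrightarrow> f x \<in> K"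
  shows "(\<Sum>x\<in>S. f x) \<in> K"
  using assms(2) by (induction S rule: infinite_finite_induct)
    (auto simp: convex_cone_contains_0[OF assms(1)] convex_cone_add[OF assms(1)])

lemma mcone_mono: "H \<subseteq> K \<Longrightarrow> mcone H \<subseteq> mcone K"
  by (auto simp: mcone_def intro: flows_mono)

lemma mcone_eq_hull: "mcone H = convex_cone hull ((\<lambda>(i, j). (axis i 1, axis j 1)) ` H)"
proof
  have "(\<lambda>(i, j). (axis i 1, axis j 1)) ` H \<subseteq> mcone H"
    unfolding mcone_def by (auto simp flip: marg_unit_flow intro: unit_flow_flows)
  then show "convex_cone hull ((\<lambda>(i, j). (axis i 1, axis j 1)) ` H) \<subseteq> mcone H"
    by (rule hull_minimal) (rule convex_cone_mcone)
  let ?K = "convex_cone hull ((\<lambda>(i, j). (axis i 1, axis j 1)) ` H)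
     :: ((real^'a) \<times> (real^'b)) set"
  have cK: "convex_cone ?K" by (rule convex_cone_convex_cone_hull)
  show "mcone H \<subseteq> ?K"
  proof
    fix x assume "x \<in> mcone H"
    then obtain f where f: "f \<in> flows H" "x = marg f" by (auto simp: mcone_def)
    have "f$i$j *\<^sub>R (axis i 1, axis j 1) \<in> ?K" for i j
    proof (cases "(i, j) \<in> H")
      case True
      then have "(axis i 1, axis j 1) \<in> ?K" by (intro hull_inc) force
      then show ?thesis using f(1) by (intro convex_cone_scaleR[OF cK]) (auto simp: flowsD)
    next
      case False
      then show ?thesis using f(1) by (auto simp: flowsD scaleR_Pair zero_prod_def[symmetric] convex_cone_contains_0[OF cK])
    qed
    then show "x \<in> ?K"
      unfolding f(2) marg_decomp by (intro convex_cone_sum cK)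
  qed
qed

lemma closed_mcone: "closed (mcone H)"
  unfolding mcone_eq_hull by (rule closed_convex_cone_hull) simp

lemma mconeI: "f \<in> flows H \<Longrightarrow> marg f \<in> mcone H"
  by (simp add: mcone_def)

lemma mconeE: assumes "x \<in> mcone H" obtains f where "f \<in> flows H" "x = marg f"
  using assms by (auto simp: mcone_def)

section \<open>Compatibility and complementary slackness\<close>

definition good :: "('n::finite \<times> 'd::finite) set \<Rightarrow> ('n \<times> 'd) set \<Rightarrow> bool" where
  "good A B \<longleftrightarrow> (\<forall>f\<in>flows A. \<forall>g\<in>flows B. marg f = marg g \<longrightarrow> f \<in> flows B \<and> g \<in> flows A)"

lemma good_sym: "good A B \<Longrightarrow> good B A"
  unfolding good_def by metis

lemma goodD:
  assumes "good A B" "f \<in> flows A" "g \<in> flows B" "marg f = marg g"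
  shows "f \<in> flows B" "g \<in> flows A"
  using assms unfolding good_def by blast+

text \<open>Dual potentials certifying that no flow exchange between \<open>A\<close> and \<open>C\<close> leaves \<open>A \<inter> C\<close>.
  The gap \<open>1 / 2\<close> survives averaging over several \<open>C\<close>.\<close>

definition adapted :: "('n \<times> 'd) set \<Rightarrow> ('n \<times> 'd) set \<Rightarrow> ('d \<Rightarrow> real) \<Rightarrow> ('n \<Rightarrow> real) \<Rightarrow> bool" where
  "adapted A C \<phi> \<kappa> \<longleftrightarrow>
     (\<forall>(i, j)\<in>A \<inter> C. \<phi> j = \<kappa> i) \<and> (\<forall>(i, j)\<in>C - A. \<kappa> i + 1/2 \<le> \<phi> j) \<and> (\<forall>(i, j)\<in>A - C. \<phi> j \<le> \<kappa> i - 1/2)"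

lemma adaptedD:
  assumes "adapted A C \<phi> \<kappa>"
  shows "(i, j) \<in> A \<Longrightarrow> (i, j) \<in> C \<Longrightarrow> \<phi> j = \<kappa> i"
    and "(i, j) \<in> C \<Longrightarrow> (i, j) \<notin> A \<Longrightarrow> \<kappa> i + 1/2 \<le> \<phi> j"
    and "(i, j) \<in> A \<Longrightarrow> (i, j) \<notin> C \<Longrightarrow> \<phi> j \<le> \<kappa> i - 1/2"
  using assms by (auto simp: adapted_def)

text \<open>A weight of the form column potential minus row potential sees only the marginals. The
  support arguments choose the potentials so that no term, or no row, can contribute a positive
  amount.\<close>

lemma marg_eq_potential:
  assumes "marg f = marg g"
  shows "(\<Sum>i\<in>UNIV. \<Sum>j\<in>UNIV. (f$i$j - g$i$j) * (\<phi> j - \<kappa> i)) = (0::real)"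
proof -
  have "(\<Sum>i\<in>UNIV. \<Sum>j\<in>UNIV. (f$i$j - g$i$j) * (\<phi> j - \<kappa> i))
      = (\<Sum>i\<in>UNIV. \<Sum>j\<in>UNIV. (f$i$j - g$i$j) * \<phi> j) - (\<Sum>i\<in>UNIV. \<Sum>j\<in>UNIV. (f$i$j - g$i$j) * \<kappa> i)"
    by (simp add: right_diff_distrib sum_subtractf)
  also have "(\<Sum>i\<in>UNIV. \<Sum>j\<in>UNIV. (f$i$j - g$i$j) * \<phi> j) = (\<Sum>j\<in>UNIV. (\<Sum>i\<in>UNIV. f$i$j - g$i$j) * \<phi> j)"
    by (subst sum.swap) (simp add: sum_distrib_right)
  also have "\<dots> = 0" using marg_eqD(2)[OF assms] by (simp add: sum_subtractf)
  also have "(\<Sum>i\<in>UNIV. \<Sum>j\<in>UNIV. (f$i$j - g$i$j) * \<kappa> i) = (\<Sum>i\<in>UNIV. (\<Sum>j\<in>UNIV. f$i$j - g$i$j) * \<kappa> i)"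
    by (simp add: sum_distrib_right)
  also have "\<dots> = 0" using marg_eqD(1)[OF assms] by (simp add: sum_subtractf)
  finally show ?thesis by simp
qed

lemma double_sum_zero_nonpos:
  fixes F :: "'a::finite \<Rightarrow> 'b::finite \<Rightarrow> real"
  assumes "(\<Sum>i\<in>UNIV. \<Sum>j\<in>UNIV. F i j) = 0" "\<And>i j. F i j \<le> 0"
  shows "F i j = 0"
proof -
  have "(\<Sum>p\<in>UNIV. - F (fst p) (snd p)) = 0"
    using assms(1) by (simp add: sum_negf sum.cartesian_product case_prod_unfold)
  then have "\<forall>p\<in>UNIV. - F (fst p) (snd p) = 0"
    by (subst (asm) sum_nonneg_eq_0_iff) (auto simp: assms(2))
  then show ?thesis by (auto dest: bspec[of _ _ "(i, j)"])
qed

text \<open>Complementary slackness: each term \<open>(f - g) * (\<phi> - \<kappa>)\<close> is at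
  most 0 and they sum to 0, so each vanishes; on an edge of only one of the two graphs the second
  factor is nonzero.\<close>

lemma adapted_imp_good:
  assumes "adapted A C \<phi> \<kappa>"
  shows "good A C"
  unfolding good_def
proof (intro ballI impI)
  fix f g assume f: "f \<in> flows A" and g: "g \<in> flows C" and eq: "marg f = marg g"
  let ?F = "\<lambda>i j. (f$i$j - g$i$j) * (\<phi> j - \<kappa> i)"
  have cases: "?F i j \<le> 0 \<and> (?F i j = 0 \<longrightarrow> ((i, j) \<notin> C \<longrightarrow> f$i$j = 0) \<and> ((i, j) \<notin> A \<longrightarrow> g$i$j = 0))" for i j
  proof (cases "(i, j) \<in> A"; cases "(i, j) \<in> C")
    assume "(i, j) \<in> A" "(i, j) \<in> C"
    then show ?thesis using adaptedD(1)[OF assms] by simp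
  next
    assume *: "(i, j) \<in> A" "(i, j) \<notin> C"
    then have "\<phi> j - \<kappa> i < 0" "g$i$j = 0" "0 \<le> f$i$j"
      using adaptedD(3)[OF assms, of i j] f g by (auto simp: flowsD)
    then show ?thesis using * by (auto simp: mult_le_0_iff)
  next
    assume *: "(i, j) \<notin> A" "(i, j) \<in> C"
    then have "\<phi> j - \<kappa> i > 0" "f$i$j = 0" "0 \<le> g$i$j"
      using adaptedD(2)[OF assms, of i j] f g by (auto simp: flowsD)
    then show ?thesis using * by (auto simp: mult_le_0_iff)
  next
    assume *: "(i, j) \<notin> A" "(i, j) \<notin> C"
    then show ?thesis using f g by (auto simp: flowsD)
  qed
  have "?F i j = 0" for i j
    using double_sum_zero_nonpos[of ?F, OF marg_eq_potential[OF eq]] cases by blast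
  then show "f \<in> flows C \<and> g \<in> flows A"
    using cases f g by (auto simp: flows_def)
qed

text \<open>The relation leads from \<open>p\<close> to \<open>q\<close> through a row with
  \<open>p\<close> in \<open>A\<close> and \<open>q\<close> in \<open>C\<close>. A path from
  \<open>c\<close> back to \<open>a\<close> closes up through row \<open>k\<close> to an alternating
  cycle, and compatibility puts both edges of row \<open>k\<close> into both graphs.\<close>

lemma compatible_path:
  assumes comp: "compatible A C"
    and path: "(c, a) \<in> {(p, q). \<exists>k. (k, p) \<in> A \<and> (k, q) \<in> C}\<^sup>*"
    and a: "(k, a) \<in> A" and c: "(k, c) \<in> C"
  shows "(k, a) \<in> C \<and> (k, c) \<in> A"
proof -
  let ?R = "{(p, q). \<exists>k. (k, p) \<in> A \<and> (k, q) \<in> C}"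
  have "(a, c) \<in> (?R\<inverse>)\<^sup>*" using path by (simp add: rtrancl_converse)
  then obtain m f where f: "f 0 = a" "f m = c" "\<And>t. t < m \<Longrightarrow> (f t, f (Suc t)) \<in> ?R\<inverse>"
    by (auto dest!: rtrancl_imp_relpow simp: relpow_fun_conv)
  have "\<forall>t. \<exists>k. t < m \<longrightarrow> (k, f (Suc t)) \<in> A \<and> (k, f t) \<in> C"
    using f(3) by auto
  then obtain u where u: "\<And>t. t < m \<Longrightarrow> (u t, f (Suc t)) \<in> A \<and> (u t, f t) \<in> C"
    by metis
  \<comment> \<open>Row \<open>k\<close> is visited between the last and the first column, so a path
    of \<open>m\<close> steps gives a cycle with \<open>Suc m\<close> rows.\<close>
  define l where "l = (\<lambda>t. case t of 0 \<Rightarrow> k | Suc s \<Rightarrow> u s)"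
  have "alternating_cycle A C (Suc m) l f"
    unfolding alternating_cycle_def
  proof (intro conjI allI impI)
    fix t assume t: "t < Suc m"
    show "(l t, f t) \<in> A" using t a f(1) u by (auto simp: l_def split: nat.split)
    show "(l (Suc t mod Suc m), f t) \<in> C"
    proof (cases "t = m")
      case True then show ?thesis using c f(2) by (simp add: l_def)
    next
      case False then have "t < m" using t by simp
      then show ?thesis using u by (simp add: l_def)
    qed
  qed simp
  from comp[unfolded compatible_def, rule_format, OF this]
  have "\<And>t. t < Suc m \<Longrightarrow> (l t, f t) \<in> A \<inter> C \<and> (l (Suc t mod Suc m), f t) \<in> A \<inter> C"
    by blast
  from this[of 0] this[of m] show ?thesis by (simp add: l_def f(1,2))
qed

text \<open>The potential has to increase along \<open>R\<close>, strictly unless the step can be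
  reversed. By compatibility a step is reversible only if both of its edges lie in both
  graphs.\<close>

lemma compatible_adapted:
  fixes A C :: "('n::finite \<times> 'd::finite) set"
  assumes comp: "compatible A C" and ne: "no_isolated_left C"
  obtains \<phi> \<kappa> where "adapted A C \<phi> \<kappa>"
proof -
  define R where "R = {(p, q). \<exists>k. (k, p) \<in> A \<and> (k, q) \<in> C}"
  \<comment> \<open>Counting predecessors is monotone along the preorder and integer valued, so an
    irreversible step raises it by at least 1.\<close>
  define \<phi> where "\<phi> = (\<lambda>j. real (card {p. (p, j) \<in> R\<^sup>*}))"
  \<comment> \<open>A common edge of \<open>A\<close> and \<open>C\<close> fixes the level of its
    row and attains the minimum over \<open>C\<close>. Without one, the values on \<open>A\<close>
    stay at least 1 below that minimum, and the level is placed 1/2 below it.\<close>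
  define \<kappa> where "\<kappa> = (\<lambda>k. Min (\<phi> ` nbrs C k) - (if nbrs C k \<inter> nbrs A k = {} then 1/2 else 0))"
  have le: "\<phi> a \<le> \<phi> c" if "(k, a) \<in> A" "(k, c) \<in> C" for k a c
  proof -
    have "(a, c) \<in> R\<^sup>*" using that by (auto simp: R_def)
    then have "{p. (p, a) \<in> R\<^sup>*} \<subseteq> {p. (p, c) \<in> R\<^sup>*}" by (auto intro: rtrancl_trans)
    then show ?thesis by (simp add: \<phi>_def card_mono)
  qed
  have lt: "\<phi> a + 1 \<le> \<phi> c" if "(k, a) \<in> A" "(k, c) \<in> C" "\<not> ((k, a) \<in> C \<and> (k, c) \<in> A)" for k a c
  proof -
    have *: "(a, c) \<in> R\<^sup>*" using that by (auto simp: R_def)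
    have "(c, a) \<notin> R\<^sup>*" using compatible_path[OF comp _ that(1,2)] that(3) by (auto simp: R_def)
    then have "{p. (p, a) \<in> R\<^sup>*} \<subset> {p. (p, c) \<in> R\<^sup>*}" using * by (auto intro: rtrancl_trans)
    then have "card {p. (p, a) \<in> R\<^sup>*} < card {p. (p, c) \<in> R\<^sup>*}" by (intro psubset_card_mono) auto
    then show ?thesis by (simp add: \<phi>_def)
  qed
  have mn: "Min (\<phi> ` nbrs C k) \<le> \<phi> c" if "(k, c) \<in> C" for k c
    using that by (intro Min_le) (auto simp: nbrs_def)
  obtain mj where mj: "\<And>k. (k, mj k) \<in> C" "\<And>k. \<phi> (mj k) = Min (\<phi> ` nbrs C k)"
  proof -
    have "\<forall>k. \<exists>j. (k, j) \<in> C \<and> \<phi> j = Min (\<phi> ` nbrs C k)"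
    proof
      fix k
      have "Min (\<phi> ` nbrs C k) \<in> \<phi> ` nbrs C k"
        using ne by (intro Min_in) (auto simp: no_isolated_left_def)
      then show "\<exists>j. (k, j) \<in> C \<and> \<phi> j = Min (\<phi> ` nbrs C k)" by (auto simp: nbrs_def)
    qed
    then show ?thesis using that by metis
  qed
  have 1: "\<phi> j = \<kappa> k" if "(k, j) \<in> A" "(k, j) \<in> C" for k j
  proof -
    have "nbrs C k \<inter> nbrs A k \<noteq> {}" using that by (auto simp: nbrs_def)
    moreover have "\<phi> j \<le> \<phi> (mj k)" by (rule le[OF that(1) mj(1)])
    ultimately show ?thesis using mn[OF that(2)] mj(2)[of k] by (simp add: \<kappa>_def)
  qed
  have 2: "\<kappa> k + 1/2 \<le> \<phi> j" if "(k, j) \<in> C" "(k, j) \<notin> A" for k j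
  proof (cases "nbrs C k \<inter> nbrs A k = {}")
    case True then show ?thesis using mn[OF that(1)] by (simp add: \<kappa>_def)
  next
    case False
    then obtain c where c: "(k, c) \<in> C" "(k, c) \<in> A" by (auto simp: nbrs_def)
    have "\<phi> c + 1 \<le> \<phi> j" using lt[OF c(2) that(1)] that(2) by simp
    then show ?thesis using 1[OF c(2,1)] by simp
  qed
  have 3: "\<phi> j \<le> \<kappa> k - 1/2" if "(k, j) \<in> A" "(k, j) \<notin> C" for k j
  proof -
    have "\<phi> j + 1 \<le> \<phi> (mj k)" using lt[OF that(1) mj(1)] that(2) by simp
    then show ?thesis using mj(2)[of k] by (auto simp: \<kappa>_def)
  qed
  have "adapted A C \<phi> \<kappa>" using 1 2 3 by (auto simp: adapted_def)
  then show ?thesis by (rule that)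
qed

lemma compatible_imp_good: "compatible A C \<Longrightarrow> no_isolated_left C \<Longrightarrow> good A C"
  by (metis compatible_adapted adapted_imp_good)

text \<open>Unit flows along the \<open>A\<close>-edges and along the \<open>B\<close>-edges of an
  alternating cycle have the same marginals, and each edge of the cycle carries mass in one of
  them.\<close>

lemma good_imp_compatible:
  assumes "good A B" shows "compatible A B"
  unfolding compatible_def
proof (intro allI impI)
  fix m l r k assume alt: "alternating_cycle A B m l r" and k: "k < m"
  let ?s = "\<lambda>t. Suc t mod m"
  define f where "f = (\<Sum>t<m. unit_flow (l t) (r t))"
  define g where "g = (\<Sum>t<m. unit_flow (l (?s t)) (r t))"
  have m: "m > 0" using k by simp
  have edges: "(l t, r t) \<in> A" "(l (?s t), r t) \<in> B" if "t < m" for t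
    using alt that by (auto simp: alternating_cycle_def)
  \<comment> \<open>The cyclic shift permutes the positions, so the row marginals of
    \<open>f\<close> and \<open>g\<close> agree; the column marginals agree term by term.\<close>
  have "bij_betw ?s {..<m} {..<m}"
  proof -
    have "inj_on ?s {..<m}"
    proof (rule inj_onI)
      fix x y assume *: "x \<in> {..<m}" "y \<in> {..<m}" "?s x = ?s y"
      show "x = y" using * by (auto simp: mod_Suc split: if_splits)
    qed
    moreover have "?s ` {..<m} \<subseteq> {..<m}" using m by auto
    ultimately show ?thesis by (metis bij_betw_imageI endo_inj_surj finite_lessThan)
  qed
  then have re: "(\<Sum>t<m. axis (l (?s t)) (1::real)) = (\<Sum>t<m. axis (l t) 1)"
    by (rule sum.reindex_bij_betw)
  have "marg f = marg g"
    using re by (simp add: f_def g_def marg_sum marg_unit_flow sum_prod)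
  moreover have f: "f \<in> flows A" "g \<in> flows B"
    unfolding f_def g_def by (intro flows_sum unit_flow_flows; use edges in auto)+
  ultimately have "f \<in> flows B" "g \<in> flows A" using goodD[OF assms] by blast+
  moreover have "f $ l k $ r k > 0"
  proof -
    have "unit_flow (l k) (r k) $ l k $ r k \<le> (\<Sum>t<m. unit_flow (l t) (r t) $ l k $ r k)"
      using k by (intro member_le_sum) auto
    then show ?thesis by (simp add: f_def)
  qed
  moreover have "g $ l (?s k) $ r k > 0"
  proof -
    have "unit_flow (l (?s k)) (r k) $ l (?s k) $ r k \<le> (\<Sum>t<m. unit_flow (l (?s t)) (r t) $ l (?s k) $ r k)"
      using k by (intro member_le_sum) auto
    then show ?thesis by (simp add: g_def)
  qed
  ultimately show "(l k, r k) \<in> A \<inter> B \<and> (l (?s k), r k) \<in> A \<inter> B"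
    using edges[OF k] by (auto simp: flows_def) (metis less_irrefl)+
qed

section \<open>Refinements of subgraphs\<close>

definition ref :: "('d \<Rightarrow> real) \<Rightarrow> ('n \<times> 'd) set \<Rightarrow> ('n \<times> 'd) set" where
  "ref \<phi> H = {(i, j) \<in> H. \<forall>j'. (i, j') \<in> H \<longrightarrow> \<phi> j' \<le> \<phi> j}"

definition row_max :: "('d::finite \<Rightarrow> real) \<Rightarrow> ('n \<times> 'd) set \<Rightarrow> 'n \<Rightarrow> real" where
  "row_max \<phi> H i = Max (\<phi> ` nbrs H i)"

lemma ref_subset: "ref \<phi> H \<subseteq> H"
  by (auto simp: ref_def)

lemma no_isolated_leftD: "no_isolated_left H \<Longrightarrow> \<exists>j. (i, j) \<in> H"
  by (auto simp: no_isolated_left_def nbrs_def)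

lemma no_isolated_leftI: "(\<And>i. \<exists>j. (i, j) \<in> H) \<Longrightarrow> no_isolated_left H"
  by (auto simp: no_isolated_left_def nbrs_def)

lemma no_isolated_left_mono: "no_isolated_left A \<Longrightarrow> A \<subseteq> B \<Longrightarrow> no_isolated_left B"
  by (meson no_isolated_leftD no_isolated_leftI subsetD)

lemma le_row_max: "(i, j) \<in> H \<Longrightarrow> \<phi> j \<le> row_max \<phi> H (i::'n) " for j :: "'d::finite"
  unfolding row_max_def by (intro Max_ge) (auto simp: nbrs_def)

lemma row_max_attained:
  fixes H :: "('n \<times> 'd::finite) set"
  assumes "no_isolated_left H" obtains j where "(i, j) \<in> H" "\<phi> j = row_max \<phi> H i"
proof -
  have "row_max \<phi> H i \<in> \<phi> ` nbrs H i"
    unfolding row_max_def using assms by (intro Max_in) (auto simp: no_isolated_left_def)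
  then show ?thesis using that by (auto simp: nbrs_def)
qed

lemma ref_iff:
  fixes H :: "('n \<times> 'd::finite) set"
  assumes "no_isolated_left H"
  shows "(i, j) \<in> ref \<phi> H \<longleftrightarrow> (i, j) \<in> H \<and> \<phi> j = row_max \<phi> H i"
proof
  assume *: "(i, j) \<in> ref \<phi> H"
  obtain j' where "(i, j') \<in> H" "\<phi> j' = row_max \<phi> H i" using row_max_attained[OF assms] .
  with * show "(i, j) \<in> H \<and> \<phi> j = row_max \<phi> H i"
    by (auto simp: ref_def intro!: antisym le_row_max)
qed (auto simp: ref_def le_row_max)

lemma no_isolated_left_ref:
  fixes H :: "('n \<times> 'd::finite) set"
  assumes "no_isolated_left H" shows "no_isolated_left (ref \<phi> H)"
  by (rule no_isolated_leftI) (metis ref_iff[OF assms] row_max_attained[OF assms])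

text \<open>For large \<open>M\<close> the potential \<open>M * \<phi> + \<psi>\<close> is
  lexicographic: \<phi> decides and \<psi> only breaks ties. Finitely many pairs bound
  \<open>M\<close> from below. This makes an iterated refinement a single one.\<close>

lemma combine_potentials:
  fixes \<phi> \<psi> :: "'d::finite \<Rightarrow> real"
  obtains M where "M > 0" "\<And>j j'. \<phi> j < \<phi> j' \<Longrightarrow> M * \<phi> j + \<psi> j < M * \<phi> j' + \<psi> j'"
proof -
  have "\<forall>\<^sub>F M in at_top. M > 0 \<and> (\<forall>p\<in>{p. \<phi> (fst p) < \<phi> (snd p)}. (\<psi> (fst p) - \<psi> (snd p)) / (\<phi> (snd p) - \<phi> (fst p)) < M)"
    by (intro eventually_conj eventually_gt_at_top eventually_ball_finite) (auto intro: eventually_gt_at_top)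
  then obtain M where M: "M > 0" "\<forall>p\<in>{p. \<phi> (fst p) < \<phi> (snd p)}. (\<psi> (fst p) - \<psi> (snd p)) / (\<phi> (snd p) - \<phi> (fst p)) < M"
    using eventually_happens'[OF trivial_limit_at_top_linorder] by blast
  show ?thesis
  proof (rule that[OF M(1)])
    fix j j' assume *: "\<phi> j < \<phi> j'"
    then have "(\<psi> j - \<psi> j') / (\<phi> j' - \<phi> j) < M" using M(2)[rule_format, of "(j, j')"] by auto
    then show "M * \<phi> j + \<psi> j < M * \<phi> j' + \<psi> j'" using * by (simp add: field_simps)
  qed
qed

lemma ref_ref:
  fixes \<phi> \<psi> :: "'d::finite \<Rightarrow> real" and H :: "('n \<times> 'd) set"
  assumes "M > 0" "\<And>j j'. \<phi> j < \<phi> j' \<Longrightarrow> M * \<phi> j + \<psi> j < M * \<phi> j' + \<psi> j'"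
  shows "ref \<psi> (ref \<phi> H) = ref (\<lambda>j. M * \<phi> j + \<psi> j) H"
proof (intro subset_antisym subsetI; clarify)
  fix i j assume *: "(i, j) \<in> ref \<psi> (ref \<phi> H)"
  show "(i, j) \<in> ref (\<lambda>j. M * \<phi> j + \<psi> j) H"
    unfolding ref_def
  proof (clarsimp, intro conjI allI impI)
    show ij: "(i, j) \<in> H" using * by (auto simp: ref_def)
    fix j' assume j': "(i, j') \<in> H"
    then have le: "\<phi> j' \<le> \<phi> j" using * by (auto simp: ref_def)
    show "M * \<phi> j' + \<psi> j' \<le> M * \<phi> j + \<psi> j"
    proof (cases "\<phi> j' < \<phi> j")
      case True then show ?thesis using assms(2)[OF True] by simp
    next
      case False
      then have eq: "\<phi> j' = \<phi> j" using le by simp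
      then have "(i, j') \<in> ref \<phi> H" using * j' by (auto simp: ref_def)
      then show ?thesis using * eq by (auto simp: ref_def)
    qed
  qed
next
  fix i j assume *: "(i, j) \<in> ref (\<lambda>j. M * \<phi> j + \<psi> j) H"
  then have ij: "(i, j) \<in> H" and mx: "\<And>j'. (i, j') \<in> H \<Longrightarrow> M * \<phi> j' + \<psi> j' \<le> M * \<phi> j + \<psi> j"
    by (auto simp: ref_def)
  have r: "(i, j) \<in> ref \<phi> H"
    using ij mx assms(2) by (force simp: ref_def not_le[symmetric])
  have "\<psi> j' \<le> \<psi> j" if "(i, j') \<in> ref \<phi> H" for j'
  proof -
    have "\<phi> j' = \<phi> j" "(i, j') \<in> H" using that r by (auto simp: ref_def intro!: antisym)
    then show ?thesis using mx[of j'] by simp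
  qed
  then show "(i, j) \<in> ref \<psi> (ref \<phi> H)" using r by (auto simp: ref_def[of \<psi>])
qed

lemma ref_refE:
  fixes \<phi> \<psi> :: "'d::finite \<Rightarrow> real"
  obtains \<omega> where "\<And>H :: ('n \<times> 'd) set. ref \<psi> (ref \<phi> H) = ref \<omega> H"
  using combine_potentials[of \<phi> \<psi>] ref_ref[of _ \<phi> \<psi>] by metis

text \<open>Equal marginals give equal total \<phi>, and \<open>g\<close> attains the largest total
  possible on \<open>H\<close> with its row sums. So \<open>f\<close> attains it too and can only
  use the maximal edges of each row.\<close>

lemma ref_flow:
  assumes ne: "no_isolated_left H" and f: "f \<in> flows H" and g: "g \<in> flows (ref \<phi> H)"
    and eq: "marg f = marg g"
  shows "f \<in> flows (ref \<phi> H)"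
proof -
  let ?F = "\<lambda>i j. (f$i$j - g$i$j) * (\<phi> j - row_max \<phi> H i)"
  have cases: "?F i j \<le> 0 \<and> (?F i j = 0 \<longrightarrow> (i, j) \<notin> ref \<phi> H \<longrightarrow> f$i$j = 0)" for i j
  proof (cases "(i, j) \<in> ref \<phi> H")
    case True
    then show ?thesis by (simp add: ref_iff[OF ne])
  next
    case False
    then have g0: "g$i$j = 0" using g by (simp add: flowsD)
    show ?thesis
    proof (cases "(i, j) \<in> H")
      case True
      then have "\<phi> j < row_max \<phi> H i" using False le_row_max[OF True, of \<phi>] by (auto simp: ref_iff[OF ne])
      then show ?thesis using g0 flowsD(1)[OF f, of i j] by (auto simp: mult_le_0_iff)
    next
      case False then show ?thesis using f g0 by (simp add: flowsD)
    qed
  qed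
  have "?F i j = 0" for i j
    using double_sum_zero_nonpos[of ?F, OF marg_eq_potential[OF eq]] cases by blast
  then show ?thesis using cases f by (auto simp: flows_def)
qed

lemma good_ref:
  assumes "good H K" "no_isolated_left H" "no_isolated_left K"
  shows "good (ref \<phi> H) (ref \<psi> K)"
  unfolding good_def
proof (intro ballI impI)
  fix f g assume *: "f \<in> flows (ref \<phi> H)" "g \<in> flows (ref \<psi> K)" "marg f = marg g"
  have f: "f \<in> flows H" and g: "g \<in> flows K" using * flows_mono[OF _ ref_subset] by blast+
  have "f \<in> flows K" "g \<in> flows H" using goodD[OF assms(1) f g *(3)] .
  then show "f \<in> flows (ref \<psi> K) \<and> g \<in> flows (ref \<phi> H)"
    using ref_flow[OF assms(3) _ *(2,3)] ref_flow[OF assms(2) _ *(1) *(3)[symmetric]] by blast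
qed

text \<open>For \<open>A \<subseteq> C\<close> the row level is the minimum of the potential over
  \<open>C\<close>, attained exactly on \<open>A\<close>; the sign turns it into the maximum taken
  by \<open>ref\<close>.\<close>

lemma adapted_face:
  assumes "adapted A C \<phi> \<kappa>" "A \<subseteq> C" "no_isolated_left A"
  shows "A = ref (\<lambda>j. - \<phi> j) C"
proof (intro subset_antisym subsetI; clarify)
  fix i j assume *: "(i, j) \<in> A"
  have "\<phi> j \<le> \<phi> j'" if "(i, j') \<in> C" for j'
    using that adaptedD[OF assms(1), of i j'] adaptedD(1)[OF assms(1) *] assms(2) * by (cases "(i, j') \<in> A") auto
  then show "(i, j) \<in> ref (\<lambda>j. - \<phi> j) C" using * assms(2) by (auto simp: ref_def)
next
  fix i j assume *: "(i, j) \<in> ref (\<lambda>j. - \<phi> j) C"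
  obtain j' where j': "(i, j') \<in> A" using no_isolated_leftD[OF assms(3)] by blast
  then have "\<phi> j \<le> \<phi> j'" "(i, j) \<in> C" using * assms(2) by (auto simp: ref_def)
  then show "(i, j) \<in> A"
    using adaptedD(1)[OF assms(1), of i j'] adaptedD(2)[OF assms(1), of i j] j' assms(2) by force
qed

lemma compatible_face:
  fixes A C :: "('n::finite \<times> 'd::finite) set"
  assumes "compatible A C" "A \<subseteq> C" "no_isolated_left A"
  obtains \<phi> where "A = ref \<phi> C"
  using compatible_adapted[OF assms(1) no_isolated_left_mono[OF assms(3,2)]] adapted_face[OF _ assms(2,3)] that by metis

section \<open>Coverings by cones of flows\<close>

text \<open>Serves as a point in the relative interior of the cone of \<open>H\<close>: the support
  is all of \<open>H\<close>, and nonempty rows have sum 1.\<close>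

definition uniform :: "('n::finite \<times> 'd::finite) set \<Rightarrow> real^'d^'n" where
  "uniform H = (\<chi> i j. if (i, j) \<in> H then 1 / real (card (nbrs H i)) else 0)"

lemma uniform_nth: "uniform H $ i $ j = (if (i, j) \<in> H then 1 / real (card (nbrs H i)) else 0)"
  by (simp add: uniform_def)

lemma uniform_flows: "uniform H \<in> flows H"
  by (simp add: uniform_nth flows_def)

lemma uniform_pos: "(i, j) \<in> H \<Longrightarrow> uniform H $ i $ j > 0"
  by (auto simp: uniform_nth card_gt_0_iff nbrs_def)

lemma uniform_row: assumes "(i, j) \<in> H" shows "(\<Sum>j\<in>UNIV. uniform H $ i $ j) = 1"
proof -
  have "nbrs H i \<noteq> {}" using assms by (auto simp: nbrs_def)
  then have "card (nbrs H i) \<noteq> 0" by simp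
  moreover have "(\<Sum>j\<in>UNIV. uniform H $ i $ j) = real (card (nbrs H i)) * (1 / real (card (nbrs H i)))"
    by (simp add: uniform_nth sum.If_cases nbrs_def)
  ultimately show ?thesis by simp
qed

lemma uniform_rows: "no_isolated_left H \<Longrightarrow> (\<Sum>j\<in>UNIV. uniform H $ i $ j) = 1"
  using no_isolated_leftD uniform_row by metis

lemma supp_uniform: "supp (uniform H) = H"
  using uniform_pos by (force simp: supp_def uniform_nth)

text \<open>The cones are closed and finite in number, so those that miss \<open>p\<close> stay at a
  positive distance from it.\<close>

lemma nearby_cells:
  fixes TT :: "('n::finite \<times> 'd::finite) set set" and p :: "(real^'n) \<times> (real^'d)"
  obtains \<epsilon> where "\<epsilon> > 0" "\<And>C x. C \<in> TT \<Longrightarrow> dist x p < \<epsilon> \<Longrightarrow> x \<in> mcone C \<Longrightarrow> p \<in> mcone C"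
proof -
  let ?U = "\<Union>C\<in>{C\<in>TT. p \<notin> mcone C}. mcone C"
  have "closed ?U" by (intro closed_UN) (auto simp: closed_mcone)
  then have "open (- ?U)" by (rule open_Compl)
  moreover have "p \<in> - ?U" by simp
  ultimately obtain \<epsilon> where "\<epsilon> > 0" "ball p \<epsilon> \<subseteq> - ?U"
    by (rule openE)
  moreover have "p \<in> mcone C" if "C \<in> TT" "dist x p < \<epsilon>" "x \<in> mcone C" for C x
    using that \<open>ball p \<epsilon> \<subseteq> - ?U\<close> by (auto simp: dist_commute)
  ultimately show ?thesis using that[of \<epsilon>] \<open>\<epsilon> > 0\<close> by blast
qed

text \<open>The step is so short that only cells through \<open>p\<close> can be met; whatever cell
  covers its end point contains \<open>p\<close> as well.\<close>

lemma approach: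
  fixes p q :: "(real^'n::finite) \<times> (real^'d::finite)"
  assumes "\<eta>\<^sub>0 > 0" "\<And>\<eta>. 0 < \<eta> \<Longrightarrow> \<eta> \<le> \<eta>\<^sub>0 \<Longrightarrow> \<exists>C\<in>TT. p + \<eta> *\<^sub>R q \<in> mcone C"
  obtains C \<eta> where "C \<in> TT" "p \<in> mcone C" "0 < \<eta>" "\<eta> \<le> \<eta>\<^sub>0" "p + \<eta> *\<^sub>R q \<in> mcone C"
proof -
  obtain \<epsilon> where \<epsilon>: "\<epsilon> > 0" "\<And>C x. C \<in> TT \<Longrightarrow> dist x p < \<epsilon> \<Longrightarrow> x \<in> mcone C \<Longrightarrow> p \<in> mcone C"
    using nearby_cells[of TT p] by blast
  define \<eta> where "\<eta> = min \<eta>\<^sub>0 (\<epsilon> / (1 + norm q))"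
  have \<eta>: "0 < \<eta>" "\<eta> \<le> \<eta>\<^sub>0" using \<epsilon>(1) assms(1) by (auto simp: \<eta>_def add_pos_nonneg)
  have "\<eta> * norm q < \<eta> * (1 + norm q)" using \<eta>(1) by simp
  also have "\<dots> \<le> \<epsilon> / (1 + norm q) * (1 + norm q)" by (intro mult_right_mono) (auto simp: \<eta>_def)
  also have "\<dots> = \<epsilon>" using add_pos_nonneg[of 1 "norm q"] by (simp add: field_simps)
  finally have "dist (p + \<eta> *\<^sub>R q) p < \<epsilon>" using \<eta>(1) by (simp add: dist_norm)
  moreover obtain C where "C \<in> TT" "p + \<eta> *\<^sub>R q \<in> mcone C" using assms(2)[OF \<eta>] by blast
  ultimately show ?thesis using that \<eta> \<epsilon>(2) by blast
qed

text \<open>The Cayley trick from the section with unit row sums to all row sums: adjacency of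
  cells is a combinatorial condition, so both covering and proper intersection propagate along
  segments of row sums.\<close>

locale section_cover =
  fixes G :: "('n::finite \<times> 'd::finite) set" and TT :: "('n \<times> 'd) set set"
  assumes sub: "C \<in> TT \<Longrightarrow> C \<subseteq> G"
    and ne: "C \<in> TT \<Longrightarrow> no_isolated_left C"
    and neG: "no_isolated_left G"
    and cover1: "f \<in> flows G \<Longrightarrow> (\<And>i. (\<Sum>j\<in>UNIV. f$i$j) = 1) \<Longrightarrow> \<exists>C\<in>TT. marg f \<in> mcone C"
    and good1: "C \<in> TT \<Longrightarrow> C' \<in> TT \<Longrightarrow> f \<in> flows C \<Longrightarrow> g \<in> flows C' \<Longrightarrow> marg f = marg g \<Longrightarrow>
        (\<And>i. (\<Sum>j\<in>UNIV. f$i$j) = 1) \<Longrightarrow> f \<in> flows C'"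
begin

text \<open>The rows of \<open>f\<close> are rescaled to sum 1, the given covering is used there,
  and the resulting exchange of flows is transported back to \<open>f\<close>. Positive row sums
  make the rescaling possible. The cell found still carries \<open>f\<close>.\<close>

lemma persist:
  assumes T: "T \<in> TT" and f: "f \<in> flows T" and pos: "\<And>i. 0 < (\<Sum>j\<in>UNIV. f$i$j)" and h: "h \<in> flows G"
  obtains C \<tau> where "C \<in> TT" "supp f \<subseteq> C" "0 < \<tau>" "\<tau> \<le> 1" "(1 - \<tau>) *\<^sub>R marg f + \<tau> *\<^sub>R marg h \<in> mcone C"
proof -
  define r where "r = (\<lambda>i. \<Sum>j\<in>UNIV. f$i$j)"
  define w where "w = (\<lambda>i. \<Sum>j\<in>UNIV. h$i$j)"
  define e :: "real^'d^'n" where "e = (\<chi> i j. f$i$j / r i)"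
  \<comment> \<open>\<open>ew\<close> has the row sums of \<open>h\<close>, so \<open>h - ew\<close>
    has row sums 0 and a step in this direction stays in the unit section.\<close>
  define ew :: "real^'d^'n" where "ew = (\<chi> i j. e$i$j * w i)"
  have r: "r i > 0" for i using pos by (simp add: r_def)
  have w: "w i \<ge> 0" for i using flowsD(1)[OF h] by (simp add: w_def sum_nonneg)
  have e0: "e$i$j \<ge> 0" for i j using flowsD(1)[OF f] r[of i] by (simp add: e_def)
  have er: "e$i$j * r i = f$i$j" for i j using r[of i] by (simp add: e_def)
  have eT: "e \<in> flows T" using f r e0 by (auto simp: flows_def e_def)
  have erow: "(\<Sum>j\<in>UNIV. e$i$j) = 1" for i
    using r[of i] by (simp add: e_def r_def flip: sum_divide_distrib)
  have ewrow: "(\<Sum>j\<in>UNIV. ew$i$j) = w i" for i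
    using erow by (simp add: ew_def flip: sum_distrib_right)
  \<comment> \<open>This bound gives \<open>\<eta> * w i \<le> 1\<close>, so the entries
    \<open>e * (1 - \<eta> * w) + \<eta> * h\<close> stay nonnegative.\<close>
  define \<eta>\<^sub>0 where "\<eta>\<^sub>0 = 1 / (1 + (\<Sum>i\<in>UNIV. w i))"
  have W: "0 \<le> (\<Sum>i\<in>UNIV. w i)" by (simp add: sum_nonneg w)
  have \<eta>\<^sub>0: "\<eta>\<^sub>0 > 0" using W by (simp add: \<eta>\<^sub>0_def)
  have TG: "T \<subseteq> G" by (rule sub[OF T])
  have "\<exists>C\<in>TT. marg e + \<eta> *\<^sub>R marg (h - ew) \<in> mcone C" if \<eta>: "0 < \<eta>" "\<eta> \<le> \<eta>\<^sub>0" for \<eta>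
  proof -
    have "\<eta> * w i \<le> 1" for i
    proof -
      have "w i \<le> (\<Sum>i\<in>UNIV. w i)" by (rule member_le_sum) (auto simp: w)
      then have "\<eta> * w i \<le> \<eta>\<^sub>0 * (1 + (\<Sum>i\<in>UNIV. w i))" using \<eta> w W by (intro mult_mono) auto
      also have "\<dots> = 1" using W by (simp add: \<eta>\<^sub>0_def)
      finally show ?thesis .
    qed
    then have "0 \<le> e$i$j * (1 - \<eta> * w i) + \<eta> * h$i$j" for i j
      using e0 \<eta>(1) flowsD(1)[OF h] by simp
    then have "0 \<le> e$i$j + \<eta> * (h$i$j - ew$i$j)" for i j by (simp add: ew_def algebra_simps)
    then have "e + \<eta> *\<^sub>R (h - ew) \<in> flows G"
      using flows_mono[OF eT TG] h by (auto simp: flows_def ew_def)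
    moreover have "(\<Sum>j\<in>UNIV. (e + \<eta> *\<^sub>R (h - ew))$i$j) = 1" for i
      using ewrow[of i] erow[of i] by (simp add: sum.distrib sum_subtractf w_def flip: sum_distrib_left)
    ultimately have "\<exists>C\<in>TT. marg (e + \<eta> *\<^sub>R (h - ew)) \<in> mcone C" by (rule cover1)
    then show ?thesis by (simp only: marg_add marg_scaleR)
  qed
  then obtain C \<eta> where C: "C \<in> TT" "marg e \<in> mcone C" and \<eta>: "0 < \<eta>" "\<eta> \<le> \<eta>\<^sub>0"
    and g': "marg e + \<eta> *\<^sub>R marg (h - ew) \<in> mcone C"
    using approach[OF \<eta>\<^sub>0, of TT "marg e" "marg (h - ew)"] by metis
  obtain g where g: "g \<in> flows C" "marg e + \<eta> *\<^sub>R marg (h - ew) = marg g" using g' by (rule mconeE)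
  obtain e' where e': "e' \<in> flows C" "marg e = marg e'" using C(2) by (rule mconeE)
  have eC: "e \<in> flows C" using good1[OF T C(1) eT e' erow] .
  then have fC: "supp f \<subseteq> C" using flows_supp[OF eC] er by (auto simp: supp_def) (metis (mono_tags, lifting) CollectI case_prodI mult_zero_left subsetD)
  define m where "m = Min (range r)"
  have m: "m > 0" "m \<le> r i" for i using r by (auto simp: m_def)
  \<comment> \<open>Chosen with \<open>\<tau> / \<eta> = m * (1 - \<tau>)\<close>: the multiple of
    \<open>e\<close> that is subtracted is then covered by what remains of \<open>f\<close>.\<close>
  define \<tau> where "\<tau> = m / (1 / \<eta> + m)"
  have \<tau>: "0 < \<tau>" "\<tau> \<le> 1" and m\<tau>: "\<tau> * (1 / \<eta> + m) = m"
  proof -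
    have "1 / \<eta> + m > 0" using m(1) \<eta> by (simp add: add_pos_pos)
    then show "0 < \<tau>" "\<tau> \<le> 1" "\<tau> * (1 / \<eta> + m) = m" using m(1) \<eta> by (auto simp: \<tau>_def divide_simps)
  qed
  let ?k = "f + \<tau> *\<^sub>R ((1 / \<eta>) *\<^sub>R (g - e) + ew - f)"
  have "?k \<in> flows C"
  proof -
    have "0 \<le> ?k$i$j" for i j
    proof -
      have "m * (1 - \<tau>) \<le> r i * (1 - \<tau>)" using m \<tau> by (intro mult_right_mono) auto
      then have "0 \<le> r i * (1 - \<tau>) - \<tau> / \<eta>" using m\<tau> by (simp add: algebra_simps)
      then have "0 \<le> e$i$j * (r i * (1 - \<tau>) - \<tau> / \<eta>) + \<tau> * g$i$j / \<eta> + \<tau> * (e$i$j * w i)"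
        using e0 \<tau> \<eta> flowsD(1)[OF g(1)] w by simp
      also have "\<dots> = ?k$i$j"
        using er[of i j] \<eta>(1) by (simp add: ew_def field_simps)
      finally show ?thesis .
    qed
    moreover have "?k$i$j = 0" if "(i, j) \<notin> C" for i j
    proof -
      have "f$i$j = 0" using that fC by (auto simp: supp_def)
      then show ?thesis using flowsD(2)[OF g(1) that] flowsD(2)[OF eC that] by (simp add: ew_def)
    qed
    ultimately show ?thesis by (auto simp: flows_def)
  qed
  moreover have "marg ?k = (1 - \<tau>) *\<^sub>R marg f + \<tau> *\<^sub>R marg h"
  proof -
    have "marg g - marg e = \<eta> *\<^sub>R marg (h - ew)" using g(2) by (metis add_diff_cancel_left')
    then have "(1 / \<eta>) *\<^sub>R (marg g - marg e) = marg h - marg ew" using \<eta>(1) by (simp add: marg_diff)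
    then have "marg ((1 / \<eta>) *\<^sub>R (g - e) + ew - f) = marg h - marg f"
      by (simp add: marg_add marg_diff marg_scaleR)
    then show ?thesis
      by (simp only: marg_add[of f] marg_scaleR[of \<tau>]) (simp add: algebra_simps)
  qed
  ultimately have "(1 - \<tau>) *\<^sub>R marg f + \<tau> *\<^sub>R marg h \<in> mcone C" by (metis mconeI)
  then show ?thesis using that[OF C(1) fC \<tau>] by blast
qed

text \<open>The last covered point of the segment from a flow with unit rows to \<open>h\<close> is
  its end, since \<open>persist\<close> extends the covering beyond any earlier point; before the
  end all row sums are positive.\<close>

lemma cover:
  assumes h: "h \<in> flows G"
  shows "\<exists>C\<in>TT. marg h \<in> mcone C"
proof -
  define f\<^sub>0 where "f\<^sub>0 = uniform G"
  define x where "x = (\<lambda>t::real. (1 - t) *\<^sub>R marg f\<^sub>0 + t *\<^sub>R marg h)"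
  define S where "S = (\<Union>C\<in>TT. {0..1} \<inter> x -` mcone C)"
  have f\<^sub>0: "f\<^sub>0 \<in> flows G" "\<And>i. (\<Sum>j\<in>UNIV. f\<^sub>0$i$j) = 1"
    unfolding f\<^sub>0_def by (auto intro: uniform_flows uniform_rows neG)
  have contx: "continuous_on A x" for A unfolding x_def by (intro continuous_intros)
  have "compact S"
    unfolding S_def
    by (intro compact_UN finite compact_Int_closed compact_Icc closed_vimage closed_mcone contx)
  moreover have "0 \<in> S" using cover1[OF f\<^sub>0] by (auto simp: S_def x_def)
  ultimately obtain t where t: "t \<in> S" "\<And>s. s \<in> S \<Longrightarrow> s \<le> t"
    by (metis compact_attains_sup empty_iff)
  then obtain T where T: "T \<in> TT" "x t \<in> mcone T" "0 \<le> t" "t \<le> 1" by (auto simp: S_def)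
  show ?thesis
  proof (cases "t = 1")
    case True then show ?thesis using T by (auto simp: x_def)
  next
    case False
    obtain f where f: "f \<in> flows T" "x t = marg f" using T(2) by (rule mconeE)
    have "0 < (\<Sum>j\<in>UNIV. f$i$j)" for i
    proof -
      have "(\<Sum>j\<in>UNIV. f$i$j) = fst (x t) $ i" by (simp add: f(2))
      also have "\<dots> = (1 - t) + t * (\<Sum>j\<in>UNIV. h$i$j)" by (simp add: x_def f\<^sub>0(2))
      also have "\<dots> > 0" using False T(3,4) flowsD(1)[OF h] by (intro add_pos_nonneg) (auto intro!: mult_nonneg_nonneg sum_nonneg)
      finally show ?thesis .
    qed
    then obtain C \<tau> where C: "C \<in> TT" "0 < \<tau>" "\<tau> \<le> 1" "(1 - \<tau>) *\<^sub>R marg f + \<tau> *\<^sub>R marg h \<in> mcone C"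
      using persist[OF T(1) f(1) _ h] by metis
    have "(1 - \<tau>) *\<^sub>R marg f + \<tau> *\<^sub>R marg h = x (t + \<tau> * (1 - t))"
      by (simp add: f(2)[symmetric] x_def algebra_simps)
    moreover have "t + \<tau> * (1 - t) \<le> 1" using C(2,3) T(3,4) mult_right_mono[of \<tau> 1 "1 - t"] by simp
    moreover have "0 \<le> t + \<tau> * (1 - t)" using C(2) T(3,4) by simp
    ultimately have "t + \<tau> * (1 - t) \<in> S" using C by (auto simp: S_def)
    then show ?thesis using t(2)[of "t + \<tau> * (1 - t)"] False T(4) C(2) by (auto simp: mult_le_0_iff)
  qed
qed

text \<open>With a common edge in every row, both flows can be scaled down and topped up by the same
  flow on \<open>C \<inter> C'\<close> until all row sums are 1, where \<open>good1\<close>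
  applies.\<close>

lemma adjacent_good:
  assumes "C \<in> TT" "C' \<in> TT" "no_isolated_left (C \<inter> C')"
  shows "good C C'"
proof -
  have *: "f \<in> flows D'" if D: "D \<in> TT" "D' \<in> TT" "no_isolated_left (D \<inter> D')"
    and f: "f \<in> flows D" and g: "g \<in> flows D'" and eq: "marg f = marg g" for D D' f g
  proof -
    define e where "e = uniform (D \<inter> D')"
    define r where "r = (\<lambda>i. \<Sum>j\<in>UNIV. f$i$j)"
    define W where "W = 1 / (1 + (\<Sum>i\<in>UNIV. r i))"
    define mk :: "real^'d^'n \<Rightarrow> real^'d^'n" where "mk = (\<lambda>f. (\<chi> i j. e$i$j * (1 - W * r i)) + W *\<^sub>R f)"
    have e: "e \<in> flows D" "e \<in> flows D'" "\<And>i. (\<Sum>j\<in>UNIV. e$i$j) = 1"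
      using uniform_flows[of "D \<inter> D'"] uniform_rows[OF D(3)] by (auto simp: e_def intro: flows_mono)
    have r: "r i \<ge> 0" for i using flowsD(1)[OF f] by (simp add: r_def sum_nonneg)
    have W: "W > 0" using r by (simp add: W_def add_pos_nonneg sum_nonneg)
    have Wr: "0 \<le> 1 - W * r i" for i
    proof -
      have "r i \<le> (\<Sum>i\<in>UNIV. r i)" by (rule member_le_sum) (auto simp: r)
      then show ?thesis using sum_nonneg[of UNIV r] r by (simp add: W_def divide_simps)
    qed
    have mkf: "mk f \<in> flows D" "mk g \<in> flows D'"
      using e f g W Wr by (auto simp: flows_def mk_def)
    have row: "(\<Sum>j\<in>UNIV. mk f$i$j) = 1" for i
      using e(3)[of i] by (simp add: mk_def sum.distrib r_def flip: sum_distrib_right sum_distrib_left)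
    have "marg (mk f) = marg (mk g)" by (simp add: mk_def marg_add marg_scaleR eq)
    then have "mk f \<in> flows D'" using good1[OF D(1,2) mkf _ row] by blast
    then have "f$i$j = 0" if "(i, j) \<notin> D'" for i j
      using that flowsD(2)[of "mk f" D' i j] flowsD(2)[OF e(2) that] W by (simp add: mk_def)
    then show ?thesis using f by (auto simp: flows_def)
  qed
  have "no_isolated_left (C' \<inter> C)" using assms(3) by (simp add: Int_commute)
  then show ?thesis unfolding good_def using *[OF assms] *[OF assms(2,1)] by metis
qed

text \<open>Otherwise there is a first point, on the way from the unit section to \<open>x\<close>,
  at which two cells \<open>D\<close>, \<open>D'\<close> without a common edge in some row meet.
  Moving back with \<open>persist\<close> gives two cells that carry \<open>f\<close> and
  \<open>g\<close> and meet earlier, hence are adjacent; passing through them shows that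
  \<open>D'\<close> carries \<open>f\<close>, so \<open>D\<close> and \<open>D'\<close> are adjacent
  after all.\<close>

lemma adjacent_of_meet:
  assumes C: "C \<in> TT" "C' \<in> TT" and x: "x \<in> mcone C" "x \<in> mcone C'" and pos: "\<And>i. 0 < fst x $ i"
  shows "no_isolated_left (C \<inter> C')"
proof (rule ccontr)
  assume nadj: "\<not> ?thesis"
  define f\<^sub>0 where "f\<^sub>0 = uniform G"
  have f\<^sub>0: "f\<^sub>0 \<in> flows G" "\<And>i. (\<Sum>j\<in>UNIV. f\<^sub>0$i$j) = 1"
    unfolding f\<^sub>0_def by (auto intro: uniform_flows uniform_rows neG)
  define y where "y = (\<lambda>t::real. (1 - t) *\<^sub>R marg f\<^sub>0 + t *\<^sub>R x)"
  define N where "N = {(D, D') \<in> TT \<times> TT. \<not> no_isolated_left (D \<inter> D')}"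
  define S where "S = (\<Union>p\<in>N. {0..1} \<inter> y -` (mcone (fst p) \<inter> mcone (snd p)))"
  have conty: "continuous_on A y" for A unfolding y_def by (intro continuous_intros)
  have "compact S"
    unfolding S_def
    by (intro compact_UN finite compact_Int_closed compact_Icc closed_vimage closed_Int closed_mcone conty)
  moreover have "1 \<in> S" using C x nadj by (auto simp: S_def N_def y_def)
  ultimately obtain t where t: "t \<in> S" "\<And>s. s \<in> S \<Longrightarrow> t \<le> s"
    by (metis compact_attains_inf empty_iff)
  then obtain D D' where D: "D \<in> TT" "D' \<in> TT" "\<not> no_isolated_left (D \<inter> D')"
      "y t \<in> mcone D" "y t \<in> mcone D'" "0 \<le> t" "t \<le> 1" by (auto simp: S_def N_def)
  obtain f where f: "f \<in> flows D" "y t = marg f" using D(4) by (rule mconeE)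
  obtain g where g: "g \<in> flows D'" "y t = marg g" using D(5) by (rule mconeE)
  have rowpos: "0 < fst (y t) $ i" for i
  proof (cases "t = 0")
    case False then show ?thesis using pos[of i] D(6,7) f\<^sub>0(2)[of i] by (simp add: y_def add_nonneg_pos)
  qed (simp add: y_def f\<^sub>0(2))
  have adjI: "no_isolated_left (A \<inter> B)" if "h \<in> flows A" "supp h \<subseteq> B" "y t = marg h" for A B h
  proof (rule no_isolated_leftI)
    fix i
    have "(\<Sum>j\<in>UNIV. h$i$j) \<noteq> 0" using rowpos[of i] that(3) by simp
    then obtain j where "h$i$j \<noteq> 0" by (meson sum.not_neutral_contains_not_neutral)
    then show "\<exists>j. (i, j) \<in> A \<inter> B" using that flowsD(2)[of h A i j] by (auto simp: supp_def)
  qed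
  show False
  proof (cases "t = 0")
    case True
    then have "(\<Sum>j\<in>UNIV. f$i$j) = 1" for i
      using arg_cong[OF f(2), of "\<lambda>z. fst z $ i"] by (simp add: y_def f\<^sub>0(2))
    then have "f \<in> flows D'" using good1[OF D(1,2) f(1) g(1)] f(2) g(2) by simp
    then show False using adjI[OF f(1) _ f(2)] D(3) flows_supp by blast
  next
    case False
    have pf: "0 < (\<Sum>j\<in>UNIV. f$i$j)" "0 < (\<Sum>j\<in>UNIV. g$i$j)" for i using rowpos[of i] f(2) g(2) by (metis marg_fst)+
    obtain E \<tau> where E: "E \<in> TT" "supp f \<subseteq> E" "0 < \<tau>" "\<tau> \<le> 1" "(1 - \<tau>) *\<^sub>R marg f + \<tau> *\<^sub>R marg f\<^sub>0 \<in> mcone E"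
      using persist[OF D(1) f(1) pf(1) f\<^sub>0(1)] by metis
    obtain E' \<tau>' where E': "E' \<in> TT" "supp g \<subseteq> E'" "0 < \<tau>'" "\<tau>' \<le> 1" "(1 - \<tau>') *\<^sub>R marg g + \<tau>' *\<^sub>R marg f\<^sub>0 \<in> mcone E'"
      using persist[OF D(2) g(1) pf(2) f\<^sub>0(1)] by metis
    \<comment> \<open>A common step length makes the two cells meet in the same earlier point;
      \<open>mem\<close> shortens the individual steps by convexity.\<close>
    define \<sigma> where "\<sigma> = min \<tau> \<tau>'"
    have \<sigma>: "0 < \<sigma>" "\<sigma> \<le> \<tau>" "\<sigma> \<le> \<tau>'" "\<sigma> \<le> 1" using E E' by (auto simp: \<sigma>_def)
    have fE: "f \<in> flows E" "g \<in> flows E'" using f g E E' by (auto simp: flows_supp_iff)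
    have mem: "(1 - \<sigma>) *\<^sub>R p + \<sigma> *\<^sub>R q \<in> mcone F"
      if "p \<in> mcone F" "(1 - \<upsilon>) *\<^sub>R p + \<upsilon> *\<^sub>R q \<in> mcone F" "\<sigma> \<le> \<upsilon>" "0 < \<upsilon>" for p q \<upsilon> and F :: "('n \<times> 'd) set"
    proof -
      have "(1 - \<sigma> / \<upsilon>) *\<^sub>R p + (\<sigma> / \<upsilon>) *\<^sub>R ((1 - \<upsilon>) *\<^sub>R p + \<upsilon> *\<^sub>R q) \<in> mcone F"
        by (rule convexD[OF convex_mcone that(1,2)]) (use that(3,4) \<sigma>(1) in \<open>auto simp: field_simps\<close>)
      moreover have "(1 - \<sigma> / \<upsilon>) *\<^sub>R p + (\<sigma> / \<upsilon>) *\<^sub>R ((1 - \<upsilon>) *\<^sub>R p + \<upsilon> *\<^sub>R q) = (1 - \<sigma>) *\<^sub>R p + \<sigma> *\<^sub>R q"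
      proof -
        have "(\<sigma> / \<upsilon>) * \<upsilon> = \<sigma>" using that(4) by simp
        then have "(\<sigma> / \<upsilon>) *\<^sub>R (\<upsilon> *\<^sub>R q) = \<sigma> *\<^sub>R q" "(\<sigma> / \<upsilon>) *\<^sub>R ((1 - \<upsilon>) *\<^sub>R p) = (\<sigma> / \<upsilon> - \<sigma>) *\<^sub>R p"
          by (simp_all add: right_diff_distrib)
        then show ?thesis using that(4) by (simp add: scaleR_add_right algebra_simps)
      qed
      ultimately show ?thesis by simp
    qed
    have mm: "(1 - \<sigma>) *\<^sub>R y t + \<sigma> *\<^sub>R marg f\<^sub>0 = y ((1 - \<sigma>) * t)"
      by (simp add: y_def algebra_simps)
    have yE: "y ((1 - \<sigma>) * t) \<in> mcone E"
      using mem[OF _ E(5)] \<sigma> E(3) mconeI[OF fE(1)] by (simp add: f(2)[symmetric] mm[symmetric])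
    have yE': "y ((1 - \<sigma>) * t) \<in> mcone E'"
      using mem[OF _ E'(5)] \<sigma> E'(3) mconeI[OF fE(2)] by (simp add: g(2)[symmetric] mm[symmetric])
    have "\<not> no_isolated_left (E \<inter> E')"
    proof
      assume "no_isolated_left (E \<inter> E')"
      then have "f \<in> flows E'"
        using goodD(1)[OF adjacent_good[OF E(1) E'(1)] fE] f(2) g(2) by simp
      moreover have "no_isolated_left (D' \<inter> E')" using adjI[OF g(1) E'(2) g(2)] .
      ultimately have "f \<in> flows D'"
        using goodD(2)[OF adjacent_good[OF D(2) E'(1)] g(1)] f(2) g(2) by simp
      then show False using adjI[OF f(1) _ f(2)] D(3) flows_supp by blast
    qed
    moreover have "(1 - \<sigma>) * t \<in> {0..1}" using \<sigma> D(6,7) by (auto simp: mult_le_one)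
    ultimately have "(1 - \<sigma>) * t \<in> S"
      using yE yE' E(1) E'(1) by (auto simp: S_def N_def)
    then have "t \<le> (1 - \<sigma>) * t" by (rule t(2))
    then show False using False D(6) \<sigma>(1) by (simp add: algebra_simps mult_le_0_iff)
  qed
qed

text \<open>Empty rows at \<open>p\<close> are avoided by pushing \<open>p\<close> slightly into
  \<open>D\<close> and into \<open>D'\<close>. The segment between the two points is covered by
  cells through \<open>p\<close>. By connectedness a cell carrying \<open>f\<close> meets one that
  does not; these are adjacent, so the second carries \<open>f\<close> too, a contradiction.\<close>

lemma good_cells:
  assumes C: "C \<in> TT" "C' \<in> TT"
  shows "good C C'"
proof -
  have *: "f \<in> flows D'" if D: "D \<in> TT" "D' \<in> TT"
    and f: "f \<in> flows D" and g: "g \<in> flows D'" and eq: "marg f = marg g" for D D' f g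
  proof (rule ccontr)
    assume nf: "f \<notin> flows D'"
    define p where "p = marg f"
    obtain \<epsilon> where \<epsilon>: "\<epsilon> > 0" "\<And>C x. C \<in> TT \<Longrightarrow> dist x p < \<epsilon> \<Longrightarrow> x \<in> mcone C \<Longrightarrow> p \<in> mcone C"
      using nearby_cells[of TT p] by blast
    define e e' where "e = uniform D" and "e' = uniform D'"
    have e: "e \<in> flows D" "\<And>i. (\<Sum>j\<in>UNIV. e$i$j) = 1" and e': "e' \<in> flows D'" "\<And>i. (\<Sum>j\<in>UNIV. e'$i$j) = 1"
      using uniform_flows uniform_rows[OF ne] D by (auto simp: e_def e'_def)
    define N where "N = 1 + norm (marg e) + norm (marg e')"
    have N: "N > 0" by (simp add: N_def add_pos_nonneg)
    define \<delta> where "\<delta> = \<epsilon> / N"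
    have \<delta>: "\<delta> > 0" using \<epsilon>(1) N by (simp add: \<delta>_def)
    define a b where "a = p + \<delta> *\<^sub>R marg e" and "b = p + \<delta> *\<^sub>R marg e'"
    have near: "dist a p < \<epsilon>" "dist b p < \<epsilon>"
    proof -
      have "\<delta> * norm (marg e) < \<delta> * N" "\<delta> * norm (marg e') < \<delta> * N"
        using \<delta> by (auto simp: N_def add_pos_nonneg)
      moreover have "\<delta> * N = \<epsilon>" using N by (simp add: \<delta>_def)
      ultimately show "dist a p < \<epsilon>" "dist b p < \<epsilon>" using \<delta> by (auto simp: a_def b_def dist_norm)
    qed
    have aD: "a \<in> mcone D" "b \<in> mcone D'"
      using mconeI[OF flows_add[OF f flows_scaleR[OF e(1), of \<delta>]]] \<delta>
        mconeI[OF flows_add[OF g flows_scaleR[OF e'(1), of \<delta>]]]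
      by (auto simp: a_def b_def p_def marg_add marg_scaleR eq)
    define I where "I = closed_segment a b"
    have Inear: "dist z p < \<epsilon>" if "z \<in> I" for z
    proof -
      have "a \<in> ball p \<epsilon>" "b \<in> ball p \<epsilon>" using near by (simp_all add: dist_commute)
      then have "I \<subseteq> ball p \<epsilon>" unfolding I_def by (intro closed_segment_subset convex_ball)
      then show ?thesis using that by (metis mem_ball dist_commute subsetD)
    qed
    have Ipos: "0 < fst z $ i" if "z \<in> I" for z i
    proof -
      have "fst p $ i \<ge> 0" using flowsD(1)[OF f] by (simp add: p_def sum_nonneg)
      then have pos: "fst a $ i > 0" "fst b $ i > 0" using \<delta> e(2) e'(2) by (auto simp: a_def b_def)
      obtain u where u: "z = (1 - u) *\<^sub>R a + u *\<^sub>R b" "0 \<le> u" "u \<le> 1"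
        using \<open>z \<in> I\<close> unfolding I_def in_segment by blast
      show ?thesis using pos u by (cases "u = 0") (auto intro!: add_nonneg_pos)
    qed
    have aG: "a \<in> mcone G" "b \<in> mcone G" using aD mcone_mono[OF sub] D by blast+
    have Icov: "\<exists>E\<in>TT. z \<in> mcone E" if "z \<in> I" for z
    proof -
      have "I \<subseteq> mcone G" unfolding I_def by (intro closed_segment_subset aG convex_mcone)
      then have "z \<in> mcone G" using that by blast
      then show ?thesis using cover by (auto simp: mcone_def[of G])
    qed
    define A B where "A = (\<Union>E\<in>{E\<in>TT. f \<in> flows E}. mcone E)" and "B = (\<Union>E\<in>{E\<in>TT. f \<notin> flows E}. mcone E)"
    have "closed A" "closed B" unfolding A_def B_def by (auto intro!: closed_UN closed_mcone)
    moreover have "I \<subseteq> A \<union> B" using Icov unfolding A_def B_def by blast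
    moreover have "a \<in> A \<inter> I" "b \<in> B \<inter> I" using aD D f nf by (auto simp: A_def B_def I_def)
    moreover have "connected I" by (simp add: I_def)
    ultimately have "A \<inter> B \<inter> I \<noteq> {}" unfolding connected_closed by blast
    then obtain z E E' where z: "z \<in> I" and E: "E \<in> TT" "f \<in> flows E" "z \<in> mcone E"
      and E': "E' \<in> TT" "f \<notin> flows E'" "z \<in> mcone E'" by (auto simp: A_def B_def)
    have "no_isolated_left (E \<inter> E')" using adjacent_of_meet[OF E(1) E'(1) E(3) E'(3) Ipos[OF z]] .
    then have gd: "good E E'" using adjacent_good E(1) E'(1) by blast
    have "p \<in> mcone E'" using \<epsilon>(2)[OF E'(1) Inear[OF z] E'(3)] .
    then obtain k where "k \<in> flows E'" "p = marg k" by (rule mconeE)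
    then show False using goodD(1)[OF gd E(2)] E'(2) by (auto simp: p_def)
  qed
  show ?thesis unfolding good_def using *[OF assms] *[OF assms(2,1)] by metis
qed

end

section \<open>Carriers\<close>

lemma scale_below:
  fixes f k :: "real^'d::finite^'n::finite"
  assumes "k \<in> flows T" "supp f \<subseteq> supp k"
  obtains \<epsilon> where "\<epsilon> > 0" "\<And>i j. \<epsilon> * \<bar>f$i$j\<bar> \<le> k$i$j"
proof -
  \<comment> \<open>The entry 1 keeps the set nonempty when \<open>k\<close> is 0.\<close>
  define m where "m = Min (insert 1 ((\<lambda>(i, j). k$i$j) ` supp k))"
  define M where "M = 1 + (\<Sum>i\<in>UNIV. \<Sum>j\<in>UNIV. \<bar>f$i$j\<bar>)"
  have k0: "0 \<le> k$i$j" for i j using assms(1) by (rule flowsD)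
  have m: "m > 0" unfolding m_def
    by (subst Min_gr_iff) (use k0 in \<open>auto simp: supp_def less_le\<close>)
  have mk: "m \<le> k$i$j" if "k$i$j \<noteq> 0" for i j
    unfolding m_def using that by (intro Min_le) (auto simp: supp_def)
  have M: "\<bar>f$i$j\<bar> \<le> M" "M > 0" for i j
  proof -
    have "\<bar>f$i$j\<bar> \<le> (\<Sum>j\<in>UNIV. \<bar>f$i$j\<bar>)" by (rule member_le_sum) auto
    also have "\<dots> \<le> (\<Sum>i\<in>UNIV. \<Sum>j\<in>UNIV. \<bar>f$i$j\<bar>)"
      by (rule member_le_sum[of i UNIV "\<lambda>i. \<Sum>j\<in>UNIV. \<bar>f$i$j\<bar>"]) (auto intro: sum_nonneg)
    finally show "\<bar>f$i$j\<bar> \<le> M" by (simp add: M_def)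
    show "M > 0" unfolding M_def by (intro add_pos_nonneg sum_nonneg) auto
  qed
  show ?thesis
  proof (rule that)
    show "m / M > 0" using m M(2) by simp
    fix i j
    show "m / M * \<bar>f$i$j\<bar> \<le> k$i$j"
    proof (cases "f$i$j = 0")
      case True then show ?thesis using k0 by simp
    next
      case False
      then have "k$i$j \<noteq> 0" using assms(2) by (auto simp: supp_def)
      have "m / M * \<bar>f$i$j\<bar> \<le> m / M * M" using m M by (intro mult_left_mono) auto
      also have "\<dots> = m" using M(2) by simp
      also have "\<dots> \<le> k$i$j" by (rule mk) fact
      finally show ?thesis .
    qed
  qed
qed

text \<open>The average of one witness for each edge that occurs in some flow with these
  marginals.\<close>

lemma full_support_flow:
  fixes f :: "real^'d::finite^'n::finite"
  assumes "f \<in> flows T"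
  obtains k where "k \<in> flows T" "marg k = marg f" "\<And>g. g \<in> flows T \<Longrightarrow> marg g = marg f \<Longrightarrow> supp g \<subseteq> supp k"
proof -
  define F where "F = {g \<in> flows T. marg g = marg f}"
  define E where "E = (\<Union>g\<in>F. supp g)"
  have "\<forall>e. \<exists>g\<in>F. e \<in> E \<longrightarrow> e \<in> supp g" using assms by (auto simp: E_def F_def)
  then obtain c where c: "\<And>e. c e \<in> F" "\<And>e. e \<in> E \<Longrightarrow> e \<in> supp (c e)" by metis
  define N where "N = real (card (UNIV :: ('n \<times> 'd) set))"
  have N: "N > 0" unfolding N_def by (simp add: card_gt_0_iff)
  define k where "k = (1 / N) *\<^sub>R (\<Sum>e\<in>UNIV. c e)"
  have c0: "c e \<in> flows T" "marg (c e) = marg f" for e using c(1)[of e] by (auto simp: F_def)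
  have "k \<in> flows T" unfolding k_def using N by (intro flows_scaleR flows_sum) (auto simp: c0)
  moreover have "marg k = marg f"
    using N by (simp add: k_def marg_scaleR marg_sum c0 sum_constant_scaleR N_def del: card_prod)
  moreover have "supp g \<subseteq> supp k" if "g \<in> flows T" "marg g = marg f" for g
  proof clarify
    fix i j assume "(i, j) \<in> supp g"
    then have "(i, j) \<in> E" using that by (auto simp: E_def F_def)
    then have "c (i, j) $ i $ j > 0" using c(2) flowsD(1)[OF c0(1)] by (force simp: supp_def less_le)
    also have "c (i, j) $ i $ j \<le> (\<Sum>e\<in>UNIV. c e $ i $ j)"
      by (rule member_le_sum) (auto intro: flowsD(1)[OF c0(1)])
    finally show "(i, j) \<in> supp k" using N by (simp add: supp_def k_def)
  qed
  ultimately show ?thesis by (rule that)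
qed

text \<open>A flow of full support can be shifted by a small multiple of \<open>g - f\<close>
  without becoming negative or changing its marginals, so \<open>g\<close> cannot leave the support
  of \<open>k\<close>.\<close>

lemma carrier_face:
  fixes k :: "real^'d::finite^'n::finite"
  assumes k: "k \<in> flows T" and full: "\<And>g. g \<in> flows T \<Longrightarrow> marg g = marg k \<Longrightarrow> supp g \<subseteq> supp k"
    and ne: "no_isolated_left (supp k)"
  obtains \<phi> where "supp k = ref \<phi> T"
proof -
  have sub: "supp k \<subseteq> T" using k by (rule flows_supp)
  have "good (supp k) T"
    unfolding good_def
  proof (intro ballI impI conjI)
    fix f g assume f: "f \<in> flows (supp k)" and g: "g \<in> flows T" and eq: "marg f = marg g"
    show fT: "f \<in> flows T" using f sub by (rule flows_mono)
    obtain \<epsilon> where \<epsilon>: "\<epsilon> > 0" "\<And>i j. \<epsilon> * \<bar>f$i$j\<bar> \<le> k$i$j"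
      using scale_below[OF k flows_supp[OF f]] by blast
    have "k + \<epsilon> *\<^sub>R (g - f) \<in> flows T"
    proof -
      have "0 \<le> k$i$j + \<epsilon> * (g$i$j - f$i$j)" for i j
      proof -
        have "0 \<le> \<epsilon> * g$i$j" using flowsD(1)[OF g] \<epsilon>(1) by simp
        moreover have "\<epsilon> * f$i$j \<le> k$i$j" using \<epsilon>(2)[of i j] flowsD(1)[OF fT, of i j] by simp
        ultimately show ?thesis by (simp only: right_diff_distrib)
      qed
      then show ?thesis using flowsD(2)[OF k] flowsD(2)[OF g] flowsD(2)[OF fT] by (simp add: flows_def)
    qed
    moreover have "marg (k + \<epsilon> *\<^sub>R (g - f)) = marg k"
      by (simp add: marg_add marg_scaleR marg_diff eq)
    ultimately have *: "supp (k + \<epsilon> *\<^sub>R (g - f)) \<subseteq> supp k" by (rule full)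
    have "g$i$j = 0" if "(i, j) \<notin> supp k" for i j
    proof -
      have "(k + \<epsilon> *\<^sub>R (g - f)) $ i $ j = 0"
        using subsetD[OF *, of "(i, j)"] that by (auto simp: supp_def)
      moreover have "k$i$j = 0" "f$i$j = 0" using that flowsD(2)[OF f that] by (auto simp: supp_def)
      ultimately show ?thesis using \<epsilon>(1) by simp
    qed
    then show "g \<in> flows (supp k)" using g by (auto simp: flows_def)
  qed
  then show ?thesis using compatible_face[OF good_imp_compatible sub ne] that by blast
qed

lemma no_isolated_left_supp:
  assumes "\<And>i. (\<Sum>j\<in>UNIV. k$i$j) \<noteq> (0::real)"
  shows "no_isolated_left (supp k)"
  by (rule no_isolated_leftI) (metis (mono_tags, lifting) CollectI case_prodI sum.neutral supp_def assms)

section \<open>The types of a tropical oriented matroid cover the permutohedron\<close>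

text \<open>The axioms in terms of edge sets and potentials. Boundary is required for every
  potential, ties included, but only as the existence of a type inside the refinement; in this form
  the axioms pass to \<open>ref \<psi> G\<close>, as the induction on the number of edges
  requires.\<close>

definition weak_tom :: "('n::finite \<times> 'd::finite) set \<Rightarrow> ('n \<times> 'd) set set \<Rightarrow> bool" where
  "weak_tom G \<O> \<longleftrightarrow>
     (\<forall>A\<in>\<O>. A \<subseteq> G \<and> no_isolated_left A) \<and>
     (\<forall>\<phi>. \<exists>C\<in>\<O>. C \<subseteq> ref \<phi> G) \<and>
     (\<forall>A\<in>\<O>. \<forall>\<phi>. ref \<phi> A \<in> \<O>) \<and>
     (\<forall>A\<in>\<O>. \<forall>B\<in>\<O>. good A B) \<and>
     (\<forall>A\<in>\<O>. \<forall>B\<in>\<O>. \<forall>i. \<exists>C\<in>\<O>. nbrs C i = nbrs A i \<union> nbrs B i \<and>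
        (\<forall>k. nbrs C k \<in> {nbrs A k, nbrs B k, nbrs A k \<union> nbrs B k}))"

lemma weak_tomD:
  assumes "weak_tom G \<O>"
  shows "A \<in> \<O> \<Longrightarrow> A \<subseteq> G" "A \<in> \<O> \<Longrightarrow> no_isolated_left A" "\<exists>C\<in>\<O>. C \<subseteq> ref \<phi> G"
    "A \<in> \<O> \<Longrightarrow> ref \<phi> A \<in> \<O>" "A \<in> \<O> \<Longrightarrow> B \<in> \<O> \<Longrightarrow> good A B"
  using assms unfolding weak_tom_def by blast+

lemma weak_tom_elim:
  assumes "weak_tom G \<O>" "A \<in> \<O>" "B \<in> \<O>"
  obtains C where "C \<in> \<O>" "nbrs C i = nbrs A i \<union> nbrs B i"
    "\<And>k. nbrs C k = nbrs A k \<or> nbrs C k = nbrs B k \<or> nbrs C k = nbrs A k \<union> nbrs B k"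
proof -
  have "\<exists>C\<in>\<O>. nbrs C i = nbrs A i \<union> nbrs B i \<and> (\<forall>k. nbrs C k \<in> {nbrs A k, nbrs B k, nbrs A k \<union> nbrs B k})"
    using assms unfolding weak_tom_def by simp
  then show ?thesis using that by auto
qed

lemma subset_nbrs_iff: "A \<subseteq> B \<longleftrightarrow> (\<forall>i. nbrs A i \<subseteq> nbrs B i)"
  by (auto simp: nbrs_def)

lemma nbrs_mono: "A \<subseteq> B \<Longrightarrow> nbrs A i \<subseteq> nbrs B i"
  by (auto simp: nbrs_def)

lemma weak_tom_no_isolated: "weak_tom G \<O> \<Longrightarrow> no_isolated_left G"
proof -
  assume tom: "weak_tom G \<O>"
  obtain C where C: "C \<in> \<O>" using weak_tomD(3)[OF tom] by blast
  show ?thesis using weak_tomD(1,2)[OF tom C] by (rule no_isolated_left_mono[rotated])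
qed

text \<open>Elimination stays inside the face because each row of the new type is a row of
  \<open>A\<close>, a row of \<open>B\<close> or their union.\<close>

lemma weak_tom_ref:
  assumes "weak_tom G \<O>"
  shows "weak_tom (ref \<psi> G) {C \<in> \<O>. C \<subseteq> ref \<psi> G}"
  unfolding weak_tom_def
proof (intro conjI ballI allI)
  fix A assume A: "A \<in> {C \<in> \<O>. C \<subseteq> ref \<psi> G}"
  show "A \<subseteq> ref \<psi> G" "no_isolated_left A" using A weak_tomD(2)[OF assms] by blast+
  show "ref \<phi> A \<in> {C \<in> \<O>. C \<subseteq> ref \<psi> G}" for \<phi>
    using A weak_tomD(4)[OF assms, of A \<phi>] ref_subset[of \<phi> A] by blast
  fix B assume B: "B \<in> {C \<in> \<O>. C \<subseteq> ref \<psi> G}"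
  show "good A B" using A B weak_tomD(5)[OF assms] by blast
  fix i
  obtain C where C: "C \<in> \<O>" "nbrs C i = nbrs A i \<union> nbrs B i"
    "\<And>k. nbrs C k = nbrs A k \<or> nbrs C k = nbrs B k \<or> nbrs C k = nbrs A k \<union> nbrs B k"
    using weak_tom_elim[OF assms, of A B i] A B by blast
  have "C \<subseteq> ref \<psi> G" unfolding subset_nbrs_iff
  proof
    fix k
    have "nbrs A k \<subseteq> nbrs (ref \<psi> G) k" "nbrs B k \<subseteq> nbrs (ref \<psi> G) k"
      using A B by (auto intro!: nbrs_mono)
    then show "nbrs C k \<subseteq> nbrs (ref \<psi> G) k" using C(3)[of k] by blast
  qed
  then show "\<exists>C\<in>{C \<in> \<O>. C \<subseteq> ref \<psi> G}. nbrs C i = nbrs A i \<union> nbrs B i \<and>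
      (\<forall>k. nbrs C k \<in> {nbrs A k, nbrs B k, nbrs A k \<union> nbrs B k})"
    using C by blast
next
  fix \<phi>
  obtain \<omega> where \<omega>: "ref \<phi> (ref \<psi> G) = ref \<omega> G" using ref_refE[of \<phi> \<psi>] by metis
  obtain C where "C \<in> \<O>" "C \<subseteq> ref \<omega> G" using weak_tomD(3)[OF assms] by blast
  then show "\<exists>C\<in>{C \<in> \<O>. C \<subseteq> ref \<psi> G}. C \<subseteq> ref \<phi> (ref \<psi> G)"
    using \<omega> ref_subset[of \<phi> "ref \<psi> G"] by auto
qed

lemma nbrs_ref_indicator:
  "nbrs (ref (\<lambda>j. if j \<in> S then 1 else 0) G) k = (if nbrs G k \<inter> S = {} then nbrs G k else nbrs G k \<inter> S)"
  by (auto simp: ref_def nbrs_def)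

text \<open>Moving away from a type \<open>A\<close> in direction \<open>S\<close>: a type of the facet of \<open>G\<close> in direction
  \<open>S\<close> that contains all rows of \<open>A\<close> lying in this facet is eliminated against \<open>A\<close>.\<close>

lemma weak_tom_neighbour:
  fixes G :: "('n::finite \<times> 'd::finite) set" and S :: "'d set"
  defines "H \<equiv> ref (\<lambda>j. if j \<in> S then 1 else 0 :: real) G"
  assumes tom: "weak_tom G \<O>"
    and IH: "\<And>f. f \<in> flows H \<Longrightarrow> (\<And>i. (\<Sum>j\<in>UNIV. f$i$j) = 1) \<Longrightarrow> \<exists>C\<in>{C \<in> \<O>. C \<subseteq> H}. marg f \<in> mcone C"
    and A: "A \<in> \<O>" and split: "\<And>k. nbrs A k \<subseteq> S \<or> nbrs A k \<inter> S = {}"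
    and i: "nbrs A i \<inter> S = {}" "nbrs G i \<inter> S \<noteq> {}"
  obtains C k where "C \<in> \<O>" "A \<subseteq> C" "nbrs A k \<inter> S = {}" "nbrs C k \<inter> S \<noteq> {}"
proof -
  let ?OH = "{C \<in> \<O>. C \<subseteq> H}"
  have tomH: "weak_tom H ?OH" unfolding H_def by (rule weak_tom_ref[OF tom])
  interpret sc: section_cover H ?OH
  proof
    show "C \<subseteq> H" if "C \<in> ?OH" for C using that by auto
    show "no_isolated_left C" if "C \<in> ?OH" for C using that weak_tomD(2)[OF tom] by auto
    show "no_isolated_left H" by (rule weak_tom_no_isolated[OF tomH])
    show "\<exists>C\<in>?OH. marg f \<in> mcone C" if "f \<in> flows H" "\<And>i. (\<Sum>j\<in>UNIV. f$i$j) = 1" for f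
      using that by (rule IH)
    show "f \<in> flows C'" if "C \<in> ?OH" "C' \<in> ?OH" "f \<in> flows C" "g \<in> flows C'" "marg f = marg g" for C C' f g
      using goodD(1)[OF weak_tomD(5)[OF tom], of C C' f g] that by auto
  qed
  have neA: "nbrs A k \<noteq> {}" for k using weak_tomD(2)[OF tom A] by (auto simp: no_isolated_left_def)
  have AG: "nbrs A k \<subseteq> nbrs G k" for k using weak_tomD(1)[OF tom A] by (rule nbrs_mono)
  have nH: "nbrs H k = (if nbrs G k \<inter> S = {} then nbrs G k else nbrs G k \<inter> S)" for k
    unfolding H_def by (rule nbrs_ref_indicator)
  \<comment> \<open>The rows of \<open>A\<close> that already lie in the facet; every other row of
    \<open>A\<close> misses \<open>S\<close>.\<close>
  define N where "N = {k. nbrs A k \<subseteq> nbrs H k}"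
  have nN: "nbrs A k \<inter> S = {} \<and> nbrs H k \<subseteq> S" if "k \<notin> N" for k
    using that split[of k] AG[of k] nH[of k] by (auto simp: N_def split: if_splits)
  \<comment> \<open>Rows outside \<open>N\<close> get no mass. The type obtained from the covering
    for arbitrary row sums therefore contains \<open>A\<close> on \<open>N\<close> and is
    unconstrained elsewhere within the facet.\<close>
  define a :: "real^'d^'n" where "a = (\<chi> k j. if k \<in> N then uniform A $ k $ j else 0)"
  have aA: "a \<in> flows A" using uniform_flows[of A] by (auto simp: flows_def a_def)
  have aH: "a \<in> flows H"
  proof -
    have "a$k$j = 0" if "(k, j) \<notin> H" for k j
    proof (cases "k \<in> N")
      case True
      then have "(k, j) \<notin> A" using that by (auto simp: N_def nbrs_def)
      then show ?thesis using flowsD(2)[OF aA] by simp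
    qed (simp add: a_def)
    then show ?thesis using flowsD(1)[OF aA] by (simp add: flows_def)
  qed
  obtain B where B: "B \<in> \<O>" "B \<subseteq> H" "marg a \<in> mcone B" using sc.cover[OF aH] by auto
  obtain g where g: "g \<in> flows B" "marg a = marg g" using B(3) by (rule mconeE)
  have aB: "a \<in> flows B" using goodD(1)[OF weak_tomD(5)[OF tom A B(1)] aA g] .
  have NB: "nbrs A k \<subseteq> nbrs B k" if "k \<in> N" for k
  proof
    fix j assume "j \<in> nbrs A k"
    then have "a$k$j > 0" using that uniform_pos[of k j A] by (simp add: a_def nbrs_def)
    then show "j \<in> nbrs B k" using flowsD(2)[OF aB, of k j] by (auto simp: nbrs_def)
  qed
  have neB: "nbrs B k \<noteq> {}" for k using weak_tomD(2)[OF tom B(1)] by (auto simp: no_isolated_left_def)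
  have BS: "nbrs B k \<subseteq> S" if "k \<notin> N" for k using nN[OF that] nbrs_mono[OF B(2), of k] by blast
  have disj: "nbrs A k \<inter> nbrs B k = {}" if "k \<notin> N" for k using nN[OF that] BS[OF that] by blast
  have iN: "i \<notin> N" using i neA[of i] nH[of i] by (auto simp: N_def)
  \<comment> \<open>One elimination may replace \<open>A k\<close> by \<open>B k\<close>. Such bad
    rows are repaired by eliminating against \<open>A\<close> again; the last clause of
    \<open>P\<close> keeps the result from falling back to \<open>A\<close> outside
    \<open>N\<close>.\<close>
  define P where "P = (\<lambda>C. C \<in> \<O> \<and> (\<forall>k\<in>N. nbrs A k \<subseteq> nbrs C k) \<and>
    (\<forall>k. k \<notin> N \<longrightarrow> nbrs C k = nbrs A k \<or> nbrs C k = nbrs B k \<or> nbrs C k = nbrs A k \<union> nbrs B k) \<and>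
    (\<exists>k. k \<notin> N \<and> nbrs C k \<noteq> nbrs A k))"
  define bad where "bad = (\<lambda>C. {k. k \<notin> N \<and> nbrs C k = nbrs B k})"
  obtain C\<^sub>0 where C\<^sub>0: "C\<^sub>0 \<in> \<O>" "nbrs C\<^sub>0 i = nbrs A i \<union> nbrs B i"
    "\<And>k. nbrs C\<^sub>0 k = nbrs A k \<or> nbrs C\<^sub>0 k = nbrs B k \<or> nbrs C\<^sub>0 k = nbrs A k \<union> nbrs B k"
    using weak_tom_elim[OF tom A B(1), of i] by blast
  have "P C\<^sub>0"
    unfolding P_def
  proof (intro conjI)
    show "\<forall>k\<in>N. nbrs A k \<subseteq> nbrs C\<^sub>0 k" using C\<^sub>0(3) NB by blast
    show "\<exists>k. k \<notin> N \<and> nbrs C\<^sub>0 k \<noteq> nbrs A k" using iN C\<^sub>0(2) disj[OF iN] neB[of i] by blast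
  qed (use C\<^sub>0 in auto)
  then obtain C where C: "P C" and least: "\<And>D. P D \<Longrightarrow> card (bad C) \<le> card (bad D)"
    using ex_has_least_nat[of P C\<^sub>0 "\<lambda>C. card (bad C)"] by blast
  have "bad C = {}"
  proof (rule ccontr)
    assume "bad C \<noteq> {}"
    then obtain k where k: "k \<notin> N" "nbrs C k = nbrs B k" by (auto simp: bad_def)
    have CO: "C \<in> \<O>" using C by (simp add: P_def)
    obtain D where D: "D \<in> \<O>" "nbrs D k = nbrs A k \<union> nbrs C k"
      "\<And>l. nbrs D l = nbrs A l \<or> nbrs D l = nbrs C l \<or> nbrs D l = nbrs A l \<union> nbrs C l"
      using weak_tom_elim[OF tom A CO, of k] by blast
    have CN: "nbrs A l \<subseteq> nbrs C l" if "l \<in> N" for l using C that by (simp add: P_def)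
    have Cn: "nbrs C l = nbrs A l \<or> nbrs C l = nbrs B l \<or> nbrs C l = nbrs A l \<union> nbrs B l" if "l \<notin> N" for l
      using C that by (simp add: P_def)
    have "P D"
      unfolding P_def
    proof (intro conjI)
      show "\<forall>l\<in>N. nbrs A l \<subseteq> nbrs D l" using D(3) CN by blast
      show "\<exists>l. l \<notin> N \<and> nbrs D l \<noteq> nbrs A l" using k D(2) disj[OF k(1)] neB[of k] by blast
      show "\<forall>l. l \<notin> N \<longrightarrow> nbrs D l = nbrs A l \<or> nbrs D l = nbrs B l \<or> nbrs D l = nbrs A l \<union> nbrs B l"
        using D(3) Cn by blast
    qed (rule D(1))
    have "bad D \<subset> bad C"
    proof
      show "bad D \<subseteq> bad C"
        using D(3) Cn disj neA neB unfolding bad_def by blast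
      have "k \<in> bad C" "k \<notin> bad D" using k D(2) disj[OF k(1)] neA[of k] by (auto simp: bad_def)
      then show "bad D \<noteq> bad C" by blast
    qed
    then have "card (bad D) < card (bad C)" by (intro psubset_card_mono) auto
    then show False using least[OF \<open>P D\<close>] by simp
  qed
  then have Cn: "nbrs C k = nbrs A k \<or> nbrs C k = nbrs A k \<union> nbrs B k" if "k \<notin> N" for k
    using C that by (auto simp: P_def bad_def)
  have "A \<subseteq> C"
    unfolding subset_nbrs_iff
  proof
    fix k show "nbrs A k \<subseteq> nbrs C k" using C Cn[of k] by (cases "k \<in> N") (auto simp: P_def)
  qed
  moreover obtain k where k: "k \<notin> N" "nbrs C k \<noteq> nbrs A k" using C by (auto simp: P_def)
  ultimately show ?thesis using that[of C k] C nN[OF k(1)] Cn[OF k(1)] BS[OF k(1)] neB[of k]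
    by (auto simp: P_def)
qed

text \<open>At the closest point \<open>y\<close>, with \<open>v = x - y\<close>, no type above the
  carrier \<open>A\<close> has in any row a larger value of \<open>v\<close> than \<open>A\<close>
  has there. Some row of \<open>G\<close> does have a larger value, and the neighbouring type for
  the corresponding level set contradicts the optimality of \<open>y\<close>.\<close>

lemma weak_tom_cover:
  fixes G :: "('n::finite \<times> 'd::finite) set"
  assumes "weak_tom G \<O>" "f \<in> flows G" "\<And>i. (\<Sum>j\<in>UNIV. f$i$j) = 1"
  shows "\<exists>C\<in>\<O>. marg f \<in> mcone C"
  using assms
proof (induction "card G" arbitrary: G \<O> f rule: less_induct)
  case less
  note tom = less.prems(1)
  define one :: "real^'n" where "one = (\<chi> i. 1)"
  define P where "P = (\<lambda>C :: ('n \<times> 'd) set. Pair one -` mcone C)"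
  have PI: "y \<in> P C \<longleftrightarrow> (one, y) \<in> mcone C" for y C by (simp add: P_def)
  have closedP: "closed (P C)" for C
    unfolding P_def by (intro closed_vimage closed_mcone continuous_intros)
  have convexP: "convex (P C)" for C
  proof (rule convexI)
    fix y z and u v :: real assume *: "y \<in> P C" "z \<in> P C" "0 \<le> u" "0 \<le> v" "u + v = 1"
    then have "u *\<^sub>R (one, y) + v *\<^sub>R (one, z) \<in> mcone C"
      by (intro convexD[OF convex_mcone]) (auto simp: PI)
    then show "u *\<^sub>R y + v *\<^sub>R z \<in> P C" using *(5) by (simp add: PI flip: scaleR_left_distrib)
  qed
  have margP: "marg g = (one, snd (marg g))" if "\<And>i. (\<Sum>j\<in>UNIV. g$i$j) = 1" for g :: "real^'d^'n"
    using that by (simp add: marg_def one_def)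
  define U where "U = (\<Union>C\<in>\<O>. P C)"
  have "closed U" unfolding U_def by (intro closed_UN finite ballI closedP)
  moreover have "U \<noteq> {}"
  proof -
    obtain C where C: "C \<in> \<O>" using weak_tomD(3)[OF tom] by blast
    have "marg (uniform C) \<in> mcone C" by (intro mconeI uniform_flows)
    then have "snd (marg (uniform C)) \<in> P C"
      using margP[of "uniform C"] uniform_rows[OF weak_tomD(2)[OF tom C]] by (simp add: PI)
    then show ?thesis using C by (auto simp: U_def)
  qed
  moreover define x where "x = snd (marg f)"
  ultimately obtain y where y: "y \<in> U" "\<And>z. z \<in> U \<Longrightarrow> dist x y \<le> dist x z"
    using distance_attains_inf by blast
  have mf: "marg f = (one, x)" unfolding x_def by (rule margP) (rule less.prems(3))
  show ?case
  proof (cases "x = y")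
    case True
    then show ?thesis using y(1) mf by (auto simp: U_def PI)
  next
    case False
    obtain T where T: "T \<in> \<O>" "(one, y) \<in> mcone T" using y(1) by (auto simp: U_def PI)
    obtain k' where k': "k' \<in> flows T" "(one, y) = marg k'" using T(2) by (rule mconeE)
    obtain k where k: "k \<in> flows T" "marg k = marg k'" "\<And>g. g \<in> flows T \<Longrightarrow> marg g = marg k' \<Longrightarrow> supp g \<subseteq> supp k"
      using full_support_flow[OF k'(1)] by metis
    have mk: "marg k = (one, y)" using k k' by simp
    have krow: "(\<Sum>j\<in>UNIV. k$i$j) = 1" for i
      using arg_cong[OF mk, of "\<lambda>z. fst z $ i"] by (simp add: one_def)
    define A where "A = supp k"
    have "no_isolated_left A" unfolding A_def by (rule no_isolated_left_supp) (simp add: krow)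
    then obtain \<phi> where "A = ref \<phi> T" unfolding A_def using carrier_face[OF k(1)] k(2,3) by metis
    then have A: "A \<in> \<O>" using weak_tomD(4)[OF tom T(1)] by simp
    have kA: "k \<in> flows A" using flows_supp_iff[OF k(1), of A] by (simp add: A_def)
    define v where "v = x - y"
    \<comment> \<open>Moving mass from \<open>j\<close> to \<open>j'\<close> in row \<open>l\<close>
      leads from \<open>y\<close> to another point of the convex set \<open>P C\<close>, and no such
      move from a closest point can make an acute angle with \<open>v\<close>.\<close>
    have dir: "v$j' \<le> v$j" if C: "C \<in> \<O>" "A \<subseteq> C" and j: "(l, j) \<in> A" "(l, j') \<in> C" for C l j j'
    proof -
      define \<epsilon> where "\<epsilon> = k$l$j"
      have \<epsilon>: "\<epsilon> > 0" using j(1) flowsD(1)[OF k(1), of l j] by (auto simp: A_def supp_def \<epsilon>_def)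
      define g where "g = k + \<epsilon> *\<^sub>R (unit_flow l j' - unit_flow l j)"
      have gC: "g \<in> flows C"
      proof -
        have "0 \<le> g$a$b" for a b
          using \<epsilon> flowsD(1)[OF k(1), of a b] by (auto simp: g_def \<epsilon>_def)
        moreover have "g$a$b = 0" if "(a, b) \<notin> C" for a b
          using that C(2) j flowsD(2)[OF kA, of a b] by (auto simp: g_def)
        ultimately show ?thesis by (auto simp: flows_def)
      qed
      have mg: "marg g = (one, y + \<epsilon> *\<^sub>R (axis j' 1 - axis j 1))"
        by (simp add: g_def marg_add marg_scaleR marg_diff marg_unit_flow mk)
      have z: "y + \<epsilon> *\<^sub>R (axis j' 1 - axis j 1) \<in> P C"
        using mconeI[OF gC] unfolding mg PI .
      have yC: "y \<in> P C" using mconeI[OF flows_mono[OF kA C(2)]] unfolding PI mk .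
      have "inner (x - y) (y + \<epsilon> *\<^sub>R (axis j' 1 - axis j 1) - y) \<le> 0"
        using C(1) y(2) by (intro any_closest_point_dot[OF convexP closedP yC z]) (auto simp: U_def)
      then have "\<epsilon> * (v$j' - v$j) \<le> 0" by (simp add: v_def inner_diff_right inner_axis)
      then show ?thesis using \<epsilon> by (simp add: mult_le_0_iff)
    qed
    \<comment> \<open>If every row maximum of \<open>v\<close> over \<open>G\<close> were attained
      on \<open>A\<close>, then \<open>k\<close> would maximize \<open>v\<close> among the flows on
      \<open>G\<close> with unit rows, contrary to \<open>inner v (x - y) > 0\<close>.\<close>
    have "\<exists>l j. (l, j) \<in> G \<and> (\<forall>a\<in>nbrs A l. v$a < v$j)"
    proof (rule ccontr)
      assume no: "\<nexists>l j. (l, j) \<in> G \<and> (\<forall>a\<in>nbrs A l. v$a < v$j)"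
      have "\<forall>l. \<exists>a. (l, a) \<in> A" using no_isolated_leftD[OF weak_tomD(2)[OF tom A]] by blast
      then obtain c where c: "\<And>l. (l, c l) \<in> A" by metis
      have Gc: "v$j \<le> v$c l" if "(l, j) \<in> G" for l j
      proof -
        obtain a where "(l, a) \<in> A" "v$j \<le> v$a" using no \<open>(l, j) \<in> G\<close> by (force simp: nbrs_def not_less)
        then show ?thesis using dir[OF A subset_refl c[of l], of a] by simp
      qed
      have Ac: "v$j = v$c l" if "(l, j) \<in> A" for l j
        using dir[OF A subset_refl c that] dir[OF A subset_refl that c] by simp
      have "inner v x = (\<Sum>j\<in>UNIV. \<Sum>l\<in>UNIV. f$l$j * v$j)"
        by (simp add: inner_vec_def x_def sum_distrib_left mult.commute)
      also have "\<dots> = (\<Sum>l\<in>UNIV. \<Sum>j\<in>UNIV. f$l$j * v$j)" by (rule sum.swap)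
      also have "\<dots> \<le> (\<Sum>l\<in>UNIV. \<Sum>j\<in>UNIV. f$l$j * v$c l)"
      proof (intro sum_mono)
        fix l j show "f$l$j * v$j \<le> f$l$j * v$c l"
          using Gc[of l j] flowsD[OF less.prems(2), of l j] by (cases "(l, j) \<in> G") (auto intro: mult_left_mono)
      qed
      also have "\<dots> = (\<Sum>l\<in>UNIV. \<Sum>j\<in>UNIV. k$l$j * v$c l)"
        by (simp add: krow less.prems(3) flip: sum_distrib_right)
      also have "\<dots> = (\<Sum>l\<in>UNIV. \<Sum>j\<in>UNIV. k$l$j * v$j)"
      proof (intro sum.cong refl)
        fix l j show "k$l$j * v$c l = k$l$j * v$j"
          using Ac[of l j] flowsD(2)[OF kA, of l j] by (cases "(l, j) \<in> A") auto
      qed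
      also have "\<dots> = (\<Sum>j\<in>UNIV. \<Sum>l\<in>UNIV. k$l$j * v$j)" by (rule sum.swap)
      also have "\<dots> = inner v y"
        using arg_cong[OF mk, of "\<lambda>z. snd z $ _"]
        by (simp add: inner_vec_def mult.commute flip: sum_distrib_left)
      finally have "inner v v \<le> 0" by (simp add: v_def inner_diff_right)
      moreover have "inner v v > 0" using False by (simp add: v_def)
      ultimately show False by simp
    qed
    then obtain l j where lj: "(l, j) \<in> G" "\<And>a. (l, a) \<in> A \<Longrightarrow> v$a < v$j" by (auto simp: nbrs_def)
    \<comment> \<open>An upper level set of \<open>v\<close>. As \<open>v\<close> is constant on
      each row of \<open>A\<close>, every row lies inside or outside; row \<open>l\<close> lies
      outside although \<open>G\<close> reaches \<open>S\<close> there.\<close>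
    define S where "S = {b. v$j \<le> v$b}"
    define H where "H = ref (\<lambda>b. if b \<in> S then 1 else 0 :: real) G"
    obtain a where a: "(l, a) \<in> A" using no_isolated_leftD[OF weak_tomD(2)[OF tom A]] by blast
    have lA: "nbrs A l \<inter> S = {}" using lj(2) by (force simp: nbrs_def S_def)
    have lG: "nbrs G l \<inter> S \<noteq> {}" using lj(1) by (auto simp: nbrs_def S_def)
    have "(l, a) \<in> G" using a weak_tomD(1)[OF tom A] by blast
    moreover have "(l, a) \<notin> H" using a lA lG nbrs_ref_indicator[of S G l] unfolding H_def by (auto simp: nbrs_def)
    ultimately have "H \<subset> G" using ref_subset unfolding H_def by blast
    then have "card H < card G" by (intro psubset_card_mono) auto
    then have IH: "\<exists>C\<in>{C \<in> \<O>. C \<subseteq> H}. marg f \<in> mcone C" if "f \<in> flows H" "\<And>i. (\<Sum>j\<in>UNIV. f$i$j) = 1" for f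
      using less.hyps[OF _ weak_tom_ref[OF tom] that(1)[unfolded H_def] that(2)] unfolding H_def by blast
    have split: "nbrs A m \<subseteq> S \<or> nbrs A m \<inter> S = {}" for m
      using dir[OF A subset_refl] by (force simp: S_def nbrs_def)
    obtain C m where C: "C \<in> \<O>" "A \<subseteq> C" "nbrs A m \<inter> S = {}" "nbrs C m \<inter> S \<noteq> {}"
      using weak_tom_neighbour[OF tom IH[unfolded H_def] A split lA lG] by metis
    obtain s where s: "(m, s) \<in> C" "s \<in> S" using C(4) by (auto simp: nbrs_def)
    obtain b where b: "(m, b) \<in> A" using no_isolated_leftD[OF weak_tomD(2)[OF tom A]] by blast
    have "v$s \<le> v$b" by (rule dir[OF C(1,2) b s(1)])
    then have "b \<in> S" using s(2) by (simp add: S_def)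
    then show ?thesis using b C(3) by (auto simp: nbrs_def)
  qed
qed

section \<open>A fixed point theorem for finite closed covers\<close>

text \<open>A form of Kakutani's theorem for the map sending \<open>s\<close> to the convex hull of
  all \<open>p c\<close> with \<open>s \<in> X c\<close>. Brouwer's theorem is applied with a
  partition of unity on the \<delta>-neighbourhoods of the \<open>X c\<close>; letting \<delta> tend
  to 0 leaves weight only on sets containing \<open>s\<close>.\<close>

lemma fixed_point_cover:
  fixes K :: "'a::euclidean_space set" and X :: "'c::finite \<Rightarrow> 'a set" and p :: "'c \<Rightarrow> 'b::euclidean_space"
    and \<Phi> :: "'a \<times> 'b \<Rightarrow> 'a"
  assumes K: "compact K" "convex K" "K \<noteq> {}" and closedX: "\<And>c. closed (X c)" and cov: "K \<subseteq> (\<Union>c. X c)"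
    and cont: "continuous_on (K \<times> UNIV) \<Phi>" and maps: "\<And>s t. s \<in> K \<Longrightarrow> \<Phi> (s, t) \<in> K"
  obtains s w where "s \<in> K" "\<And>c. 0 \<le> w c" "sum w UNIV = (1::real)" "\<And>c. w c > 0 \<Longrightarrow> s \<in> X c"
    "\<Phi> (s, \<Sum>c\<in>UNIV. w c *\<^sub>R p c) = s"
proof -
  have approx: "\<exists>s (w :: real^'c). s \<in> K \<and> w \<in> cbox 0 1 \<and> (\<Sum>c\<in>UNIV. w$c) = 1 \<and>
      (\<forall>c. w$c > 0 \<longrightarrow> X c \<noteq> {} \<and> infdist s (X c) < \<delta>) \<and> \<Phi> (s, \<Sum>c\<in>UNIV. w$c *\<^sub>R p c) = s"
    if \<delta>: "\<delta> > 0" for \<delta>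
  proof -
    \<comment> \<open>The distance to the empty set is 0 by convention, so an empty
      \<open>X c\<close> must be given weight 0 explicitly.\<close>
    define u where "u = (\<lambda>c s. if X c = {} then 0 else max 0 (\<delta> - infdist s (X c)))"
    define U where "U = (\<lambda>s. \<Sum>c\<in>UNIV. u c s)"
    have u0: "0 \<le> u c s" for c s by (simp add: u_def)
    have U: "U s > 0" if "s \<in> K" for s
    proof -
      obtain c where c: "s \<in> X c" using cov \<open>s \<in> K\<close> by blast
      then have "u c s > 0" using \<delta> by (auto simp: u_def)
      then show ?thesis unfolding U_def by (intro sum_pos2[of _ c]) (auto simp: u0)
    qed
    have contu: "continuous_on K (u c)" for c
      by (cases "X c = {}") (auto simp: u_def[abs_def] intro!: continuous_intros)
    have contW: "continuous_on K (\<lambda>s. u c s / U s)" for c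
      unfolding U_def by (intro continuous_intros contu) (use U in \<open>force simp: U_def\<close>)
    have "continuous_on K (\<lambda>s. \<Phi> (s, \<Sum>c\<in>UNIV. (u c s / U s) *\<^sub>R p c))"
      by (rule continuous_on_compose2[OF cont]) (auto intro!: continuous_intros contW)
    then obtain s where s: "s \<in> K" "\<Phi> (s, \<Sum>c\<in>UNIV. (u c s / U s) *\<^sub>R p c) = s"
      using brouwer[OF K, of "\<lambda>s. \<Phi> (s, \<Sum>c\<in>UNIV. (u c s / U s) *\<^sub>R p c)"] maps by blast
    define w :: "real^'c" where "w = (\<chi> c. u c s / U s)"
    have "u c s \<le> U s" for c unfolding U_def by (rule member_le_sum) (auto simp: u0)
    then have "w \<in> cbox 0 1" using U[OF s(1)] u0 by (auto simp: mem_box_cart w_def divide_le_eq_1)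
    moreover have "(\<Sum>c\<in>UNIV. w$c) = 1"
      using U[OF s(1)] by (simp add: w_def U_def flip: sum_divide_distrib)
    moreover have "X c \<noteq> {} \<and> infdist s (X c) < \<delta>" if "w$c > 0" for c
      using that U[OF s(1)] by (auto simp: w_def u_def zero_less_divide_iff split: if_splits)
    ultimately show ?thesis using s by (intro exI[of _ s] exI[of _ w]) (auto simp: w_def)
  qed
  obtain S W where SW: "\<And>m. S m \<in> K" "\<And>m. (W m :: real^'c) \<in> cbox 0 1" "\<And>m. (\<Sum>c\<in>UNIV. W m$c) = 1"
      "\<And>m c. W m$c > 0 \<Longrightarrow> X c \<noteq> {} \<and> infdist (S m) (X c) < inverse (real (Suc m))"
      "\<And>m. \<Phi> (S m, \<Sum>c\<in>UNIV. W m$c *\<^sub>R p c) = S m"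
  proof -
    define Q where "Q = (\<lambda>m z. fst z \<in> K \<and> (snd z :: real^'c) \<in> cbox 0 1 \<and> (\<Sum>c\<in>UNIV. snd z$c) = 1 \<and>
      (\<forall>c. snd z$c > 0 \<longrightarrow> X c \<noteq> {} \<and> infdist (fst z) (X c) < inverse (real (Suc m))) \<and> \<Phi> (fst z, \<Sum>c\<in>UNIV. snd z$c *\<^sub>R p c) = fst z)"
    have "\<forall>m. \<exists>z. Q m z"
    proof
      fix m
      obtain s and w :: "real^'c" where *: "s \<in> K \<and> w \<in> cbox 0 1 \<and> (\<Sum>c\<in>UNIV. w$c) = 1 \<and>
        (\<forall>c. w$c > 0 \<longrightarrow> X c \<noteq> {} \<and> infdist s (X c) < inverse (real (Suc m))) \<and> \<Phi> (s, \<Sum>c\<in>UNIV. w$c *\<^sub>R p c) = s"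
        using approx[of "inverse (real (Suc m))"] by auto
      show "\<exists>z. Q m z"
        unfolding Q_def using * by (intro exI[of _ "(s, w)"]) simp
    qed
    from choice[OF this] obtain z where z: "\<And>m. Q m (z m)" by blast
    show ?thesis
    proof (rule that[of "\<lambda>m. fst (z m)" "\<lambda>m. snd (z m)"])
      fix m c
      from z[of m] show "fst (z m) \<in> K" "snd (z m) \<in> cbox 0 1" "(\<Sum>c\<in>UNIV. snd (z m)$c) = 1"
        "\<Phi> (fst (z m), \<Sum>c\<in>UNIV. snd (z m)$c *\<^sub>R p c) = fst (z m)"
        unfolding Q_def by simp_all
      assume "snd (z m)$c > 0"
      with z[of m] show "X c \<noteq> {} \<and> infdist (fst (z m)) (X c) < inverse (real (Suc m))"
        unfolding Q_def by simp
    qed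
  qed
  \<comment> \<open>Fixed points and weight vectors both range over compact sets, so they converge
    along a common subsequence.\<close>
  have cKb: "compact (K \<times> cbox (0 :: real^'c) 1)" by (intro compact_Times K compact_cbox)
  have inKb: "\<forall>m. (S m, W m) \<in> K \<times> cbox 0 1" using SW(1,2) by auto
  have "\<exists>l\<in>K \<times> cbox (0 :: real^'c) 1. \<exists>r. strict_mono r \<and> ((\<lambda>m. (S m, W m)) \<circ> r) \<longlonglongrightarrow> l"
    by (rule cKb[unfolded compact_def, THEN spec, THEN mp, OF inKb])
  then obtain l r where l: "l \<in> K \<times> cbox (0 :: real^'c) 1" and r: "strict_mono r"
    and lim: "((\<lambda>m. (S m, W m)) \<circ> r) \<longlonglongrightarrow> l" by blast
  obtain s w where sw: "l = (s, w)" by (cases l)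
  have S: "(\<lambda>m. S (r m)) \<longlonglongrightarrow> s" using tendsto_fst[OF lim] by (simp add: sw o_def)
  have Wl: "(\<lambda>m. W (r m)) \<longlonglongrightarrow> w" using tendsto_snd[OF lim] by (simp add: sw o_def)
  have W: "(\<lambda>m. W (r m) $ c) \<longlonglongrightarrow> w $ c" for c by (intro tendsto_intros Wl)
  show ?thesis
  proof (rule that[of s "\<lambda>c. w$c"])
    show s: "s \<in> K" using l sw by simp
    show "0 \<le> w$c" for c using l sw by (simp add: mem_box_cart)
    have "(\<lambda>m. \<Sum>c\<in>UNIV. W (r m) $ c) \<longlonglongrightarrow> (\<Sum>c\<in>UNIV. w$c)" by (intro tendsto_intros W)
    then show "(\<Sum>c\<in>UNIV. w$c) = 1" using SW(3) by (simp add: LIMSEQ_const_iff)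
    show "s \<in> X c" if "w$c > 0" for c
    proof -
      have ev: "\<forall>\<^sub>F m in sequentially. W (r m) $ c > 0" using W that by (rule order_tendstoD)
      then have ne: "X c \<noteq> {}" using SW(4) eventually_happens'[OF sequentially_bot] by blast
      have i1: "(\<lambda>m. infdist (S (r m)) (X c)) \<longlonglongrightarrow> infdist s (X c)" by (intro tendsto_intros S)
      have i2: "(\<lambda>m. inverse (real (Suc (r m)))) \<longlonglongrightarrow> 0"
        using LIMSEQ_subseq_LIMSEQ[OF LIMSEQ_inverse_real_of_nat r] by (simp add: o_def)
      have i3: "\<forall>\<^sub>F m in sequentially. infdist (S (r m)) (X c) \<le> inverse (real (Suc (r m)))"
        using ev by eventually_elim (use SW(4) in \<open>auto intro: less_imp_le\<close>)
      have "infdist s (X c) \<le> 0" by (rule tendsto_le[OF sequentially_bot i2 i1 i3])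
      then show ?thesis using ne closedX infdist_nonneg[of s "X c"] by (simp add: in_closed_iff_infdist_zero)
    qed
    have "(\<lambda>m. (S (r m), \<Sum>c\<in>UNIV. W (r m) $ c *\<^sub>R p c)) \<longlonglongrightarrow> (s, \<Sum>c\<in>UNIV. w$c *\<^sub>R p c)"
      by (intro tendsto_intros S W)
    then have "(\<lambda>m. \<Phi> (S (r m), \<Sum>c\<in>UNIV. W (r m) $ c *\<^sub>R p c)) \<longlonglongrightarrow> \<Phi> (s, \<Sum>c\<in>UNIV. w$c *\<^sub>R p c)"
      by (rule continuous_on_tendsto_compose[OF cont]) (use s SW(1) in auto)
    then have "(\<lambda>m. S (r m)) \<longlonglongrightarrow> \<Phi> (s, \<Sum>c\<in>UNIV. w$c *\<^sub>R p c)" by (simp only: SW(5))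
    then show "\<Phi> (s, \<Sum>c\<in>UNIV. w$c *\<^sub>R p c) = s" using S LIMSEQ_unique by blast
  qed
qed

section \<open>A continuous choice of flows with full support\<close>

lemma norm_le_sum_rows: "norm (x :: ('a::real_normed_vector)^'n::finite) \<le> (\<Sum>i\<in>UNIV. norm (x$i))"
  unfolding norm_vec_def by (rule L2_set_le_sum) simp

lemma continuous_marg: "continuous_on S marg"
  by (rule linear_continuous_on) (simp add: linear_conv_bounded_linear[symmetric] linear_marg)

text \<open>The square root is strictly concave with infinite slope at 0, so the maximizer of this function
  over the flows on a cell with given marginals is unique and has full support.\<close>

definition spread :: "real^'d::finite^'n::finite \<Rightarrow> real" where
  "spread g = (\<Sum>i\<in>UNIV. \<Sum>j\<in>UNIV. sqrt (g$i$j))"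

lemma sqrt_midpoint:
  assumes "0 \<le> a" "0 \<le> b"
  shows "(sqrt a + sqrt b) / 2 \<le> sqrt ((a + b) / 2)" "a \<noteq> b \<Longrightarrow> (sqrt a + sqrt b) / 2 < sqrt ((a + b) / 2)"
proof -
  have *: "((sqrt a + sqrt b) / 2)\<^sup>2 = (a + b) / 2 - ((sqrt a - sqrt b) / 2)\<^sup>2"
    using assms by (simp add: power2_eq_square field_simps)
  show "(sqrt a + sqrt b) / 2 \<le> sqrt ((a + b) / 2)"
    using zero_le_power2[of "(sqrt a - sqrt b) / 2"] * by (intro real_le_rsqrt) linarith
  assume "a \<noteq> b"
  then have "((sqrt a - sqrt b) / 2)\<^sup>2 > 0" by simp
  then show "(sqrt a + sqrt b) / 2 < sqrt ((a + b) / 2)"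
    using * by (intro real_less_rsqrt) linarith
qed

lemma spread_midpoint:
  assumes "g \<in> flows H" "g' \<in> flows H"
  shows "(spread g + spread g') / 2 \<le> spread ((1/2) *\<^sub>R (g + g'))"
    and "g \<noteq> g' \<Longrightarrow> (spread g + spread g') / 2 < spread ((1/2) *\<^sub>R (g + g'))"
proof -
  note nn = flowsD(1)[OF assms(1)] flowsD(1)[OF assms(2)]
  have eq: "(spread g + spread g') / 2 = (\<Sum>i\<in>UNIV. \<Sum>j\<in>UNIV. (sqrt (g$i$j) + sqrt (g'$i$j)) / 2)"
    by (simp add: spread_def sum.distrib flip: sum_divide_distrib)
  have le: "(sqrt (g$i$j) + sqrt (g'$i$j)) / 2 \<le> sqrt (((1/2) *\<^sub>R (g + g'))$i$j)" for i j
    using sqrt_midpoint(1)[OF nn(1)[of i j] nn(2)[of i j]] by simp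
  show "(spread g + spread g') / 2 \<le> spread ((1/2) *\<^sub>R (g + g'))"
    by (subst eq, subst spread_def) (intro sum_mono le)
  assume "g \<noteq> g'"
  then obtain i j where ij: "g$i$j \<noteq> g'$i$j" by (auto simp: vec_eq_iff)
  show "(spread g + spread g') / 2 < spread ((1/2) *\<^sub>R (g + g'))"
  proof (subst eq, subst spread_def, rule sum_strict_mono_ex1)
    show "\<exists>i\<in>UNIV. (\<Sum>j\<in>UNIV. (sqrt (g$i$j) + sqrt (g'$i$j)) / 2) < (\<Sum>j\<in>UNIV. sqrt (((1/2) *\<^sub>R (g + g'))$i$j))"
    proof (intro bexI[of _ i] sum_strict_mono_ex1)
      show "\<exists>j\<in>UNIV. (sqrt (g$i$j) + sqrt (g'$i$j)) / 2 < sqrt (((1/2) *\<^sub>R (g + g'))$i$j)"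
        using sqrt_midpoint(2)[OF nn(1)[of i j] nn(2)[of i j] ij] by (intro bexI[of _ j]) simp_all
    qed (use le in auto)
  qed (use le in \<open>auto intro!: sum_mono\<close>)
qed

lemma continuous_spread: "continuous_on S spread"
  unfolding spread_def[abs_def] by (intro continuous_intros)

section \<open>A canonical flow over each point, its support and its continuity\<close>

context section_cover
begin

text \<open>All cells through \<open>x\<close> carry the same flows over \<open>x\<close>, so the
  selection below is a function of \<open>x\<close> alone.\<close>

definition cell_flows :: "(real^'n) \<times> (real^'d) \<Rightarrow> (real^'d^'n) set" where
  "cell_flows x = {g. \<exists>C\<in>TT. g \<in> flows C \<and> marg g = x}"

lemma cell_flows_eq:
  assumes "C \<in> TT" "x \<in> mcone C" shows "cell_flows x = {g \<in> flows C. marg g = x}"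
proof -
  obtain f where f: "f \<in> flows C" "x = marg f" using assms(2) by (rule mconeE)
  have "g \<in> flows C" if "C' \<in> TT" "g \<in> flows C'" "marg g = x" for g C'
    using goodD(1)[OF good_cells[OF that(1) assms(1)] that(2) f(1)] that(3) f(2) by simp
  then show ?thesis using assms(1) by (auto simp: cell_flows_def)
qed

lemma compact_cell_flows:
  assumes "C \<in> TT" "x \<in> mcone C" shows "compact (cell_flows x)"
proof -
  have "closed (flows C \<inter> marg -` {x})"
    by (intro closed_Int closed_flows closed_vimage continuous_marg closed_singleton)
  moreover have "flows C \<inter> marg -` {x} = cell_flows x" using cell_flows_eq[OF assms] by auto
  moreover have "norm g \<le> (\<Sum>i\<in>UNIV. fst x $ i)" if "g \<in> cell_flows x" for g
  proof -
    have g: "0 \<le> g$i$j" "marg g = x" for i j using that by (auto simp: cell_flows_def flowsD)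
    have "norm g \<le> (\<Sum>i\<in>UNIV. norm (g$i))" by (rule norm_le_sum_rows)
    also have "\<dots> \<le> (\<Sum>i\<in>UNIV. \<Sum>j\<in>UNIV. \<bar>g$i$j\<bar>)" by (intro sum_mono norm_le_l1_cart)
    also have "\<dots> = (\<Sum>i\<in>UNIV. fst x $ i)" using g(1) by (simp add: g(2)[symmetric])
    finally show ?thesis .
  qed
  ultimately show ?thesis by (auto simp: compact_eq_bounded_closed bounded_iff)
qed

definition sel :: "(real^'n) \<times> (real^'d) \<Rightarrow> real^'d^'n" where
  "sel x = (SOME g. g \<in> cell_flows x \<and> (\<forall>g'\<in>cell_flows x. spread g' \<le> spread g))"

lemma sel:
  assumes "C \<in> TT" "x \<in> mcone C"
  shows "sel x \<in> cell_flows x" "g \<in> cell_flows x \<Longrightarrow> spread g \<le> spread (sel x)"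
proof -
  have "cell_flows x \<noteq> {}" using assms(2) by (auto simp: cell_flows_eq[OF assms] mcone_def)
  then have "\<exists>g. g \<in> cell_flows x \<and> (\<forall>g'\<in>cell_flows x. spread g' \<le> spread g)"
    using continuous_attains_sup[OF compact_cell_flows[OF assms] _ continuous_spread] by blast
  from someI_ex[OF this] show "sel x \<in> cell_flows x" "g \<in> cell_flows x \<Longrightarrow> spread g \<le> spread (sel x)"
    unfolding sel_def by blast+
qed

lemma cell_flows_convex:
  assumes "C \<in> TT" "x \<in> mcone C" "g \<in> cell_flows x" "g' \<in> cell_flows x" "0 \<le> u" "0 \<le> v" "u + v = 1"
  shows "u *\<^sub>R g + v *\<^sub>R g' \<in> cell_flows x"
  using assms(3-7) convexD[OF convex_flows[of C]] unfolding cell_flows_eq[OF assms(1,2)]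
  by (auto simp: marg_add marg_scaleR scaleR_left_distrib[symmetric])

lemma sel_unique:
  assumes C: "C \<in> TT" "x \<in> mcone C" and g: "g \<in> cell_flows x" "spread (sel x) \<le> spread g"
  shows "g = sel x"
proof (rule ccontr)
  assume ne: "g \<noteq> sel x"
  have fl: "g \<in> flows C" "sel x \<in> flows C" using g sel(1)[OF C] by (auto simp: cell_flows_eq[OF C])
  have "(1/2) *\<^sub>R g + (1/2) *\<^sub>R sel x \<in> cell_flows x"
    by (rule cell_flows_convex[OF C g(1) sel(1)[OF C]]) auto
  then have "spread ((1/2) *\<^sub>R (g + sel x)) \<le> spread (sel x)"
    using sel(2)[OF C] by (simp add: scaleR_add_right)
  then show False using spread_midpoint(2)[OF fl ne] g(2) by simp
qed

text \<open>Moving a fraction \<open>t\<close> of the way from \<open>sel x\<close> to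
  \<open>g\<close> gains an amount of order \<open>sqrt t\<close> at a zero entry and loses at most
  \<open>t\<close> times the old value, so a maximizer has no zero where \<open>g\<close> has
  none.\<close>

lemma supp_sel:
  assumes C: "C \<in> TT" "x \<in> mcone C" and g: "g \<in> cell_flows x"
  shows "supp g \<subseteq> supp (sel x)"
proof (rule ccontr)
  assume "\<not> ?thesis"
  then obtain k l where kl: "g$k$l \<noteq> 0" "sel x $k$l = 0" by (auto simp: supp_def)
  define f where "f = sel x"
  have nn: "0 \<le> g$i$j" "0 \<le> f$i$j" for i j
    using g sel(1)[OF C] by (auto simp: cell_flows_def flowsD f_def)
  have f0: "f$k$l = 0" using kl by (simp add: f_def)
  define c where "c = sqrt (g$k$l)"
  have c: "c > 0" using kl nn(1)[of k l] by (simp add: c_def less_le)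
  have sp: "0 \<le> spread f" unfolding spread_def by (intro sum_nonneg) (simp add: nn)
  \<comment> \<open>\<open>q\<close> is the square root of the fraction moved: at most 1/2, so that
    the fraction is below 1, and small enough for \<open>q * spread f < c\<close>.\<close>
  define q where "q = min (1/2) (c / (2 * (1 + spread f)))"
  have q: "0 < q" using c sp by (auto simp: q_def)
  have q2: "q \<le> 1/2" unfolding q_def by (rule min.cobounded1)
  define t where "t = q\<^sup>2"
  have t: "0 < t" "t \<le> 1" "sqrt t = q" using q q2 power_mono[of q 1 2] by (auto simp: t_def)
  have in_F: "(1 - t) *\<^sub>R f + t *\<^sub>R g \<in> cell_flows x"
    unfolding f_def using t by (intro cell_flows_convex[OF C sel(1)[OF C] g]) auto
  have "(1 - t) * spread f + q * c
      = (\<Sum>i\<in>UNIV. \<Sum>j\<in>UNIV. (1 - t) * sqrt (f$i$j) + (if i = k then if j = l then q * c else 0 else 0))"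
  proof -
    have "(\<Sum>i\<in>UNIV. \<Sum>j\<in>UNIV. (if i = k then if j = l then q * c else 0 else 0)) = (\<Sum>i\<in>UNIV. if i = k then q * c else 0)"
      by (intro sum.cong) auto
    then show ?thesis by (simp add: spread_def sum.distrib sum_distrib_left)
  qed
  also have "\<dots> \<le> spread ((1 - t) *\<^sub>R f + t *\<^sub>R g)"
    unfolding spread_def
  proof (intro sum_mono)
    fix i j
    show "(1 - t) * sqrt (f$i$j) + (if i = k then if j = l then q * c else 0 else 0) \<le> sqrt (((1 - t) *\<^sub>R f + t *\<^sub>R g)$i$j)"
    proof (cases "i = k \<and> j = l")
      case True
      then show ?thesis by (simp add: f0 real_sqrt_mult t(3) c_def)
    next
      case False
      have "(1 - t)\<^sup>2 \<le> 1 - t" using t mult_right_mono[of "1 - t" 1 "1 - t"] by (simp add: power2_eq_square)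
      then have "(1 - t)\<^sup>2 * f$i$j \<le> (1 - t) * f$i$j" using nn by (intro mult_right_mono) auto
      then have "((1 - t) * sqrt (f$i$j))\<^sup>2 \<le> (1 - t) * f$i$j + t * g$i$j"
        using nn[of i j] t mult_nonneg_nonneg[OF less_imp_le[OF t(1)] nn(1)[of i j]]
        by (simp add: power_mult_distrib del: mult_nonneg_nonneg)
      then show ?thesis using False by (auto intro: real_le_rsqrt)
    qed
  qed
  also have "\<dots> \<le> spread f" unfolding f_def by (rule sel(2)[OF C in_F[unfolded f_def]])
  finally have "q * c \<le> t * spread f" by (simp add: left_diff_distrib)
  then have "q * c \<le> q * (q * spread f)" by (simp add: t_def power2_eq_square mult.assoc)
  then have "c \<le> q * spread f" using q by simp
  also have "\<dots> \<le> c / (2 * (1 + spread f)) * spread f" using sp by (intro mult_right_mono) (auto simp: q_def)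
  also have "\<dots> = c * (spread f / (2 * (1 + spread f)))" by simp
  also have "\<dots> < c * 1" using c sp by (intro mult_strict_left_mono) (auto simp: divide_less_eq)
  finally show False by simp
qed

text \<open>The selections are bounded, so a closed graph suffices. A limit \<open>g\<close> of
  selections is compared with the maximizer \<open>f\<close> over the limit point by translating to
  the nearby fibres. Translating \<open>f\<close> itself may produce negative entries; the midpoint
  of \<open>f\<close> and \<open>g\<close> works, and concavity recovers the comparison with
  \<open>f\<close>.\<close>

lemma continuous_sel:
  fixes x :: "'e::euclidean_space \<Rightarrow> (real^'n) \<times> (real^'d)"
  assumes K: "compact K" and x: "continuous_on K x" and covered: "\<And>s. s \<in> K \<Longrightarrow> \<exists>C\<in>TT. x s \<in> mcone C"
  shows "continuous_on K (\<lambda>s. sel (x s))"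
proof -
  have "compact (x ` K)" using x K by (rule compact_continuous_image)
  then obtain M where M: "\<And>s. s \<in> K \<Longrightarrow> norm (x s) \<le> M"
    using compact_imp_bounded by (force simp: bounded_iff)
  have bnd: "norm (sel (x s)) \<le> real CARD('n) * M" if s: "s \<in> K" for s
  proof -
    obtain C where C: "C \<in> TT" "x s \<in> mcone C" using covered[OF s] by blast
    have g: "0 \<le> sel (x s) $i$j" "marg (sel (x s)) = x s" for i j
      using sel(1)[OF C] by (auto simp: cell_flows_def flowsD)
    have "norm (sel (x s)) \<le> (\<Sum>i\<in>UNIV. norm (sel (x s) $ i))" by (rule norm_le_sum_rows)
    also have "\<dots> \<le> (\<Sum>i\<in>UNIV. \<Sum>j\<in>UNIV. \<bar>sel (x s) $i$j\<bar>)" by (intro sum_mono norm_le_l1_cart)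
    also have "\<dots> = (\<Sum>i\<in>UNIV. fst (marg (sel (x s))) $ i)" using g(1) by simp
    also have "\<dots> \<le> (\<Sum>i\<in>(UNIV::'n set). M)"
    proof (rule sum_mono)
      fix i
      have "fst (x s) $ i \<le> norm (fst (x s))" using component_le_norm_cart[of "fst (x s)" i] by simp
      also have "\<dots> \<le> norm (x s)" by (metis norm_fst_le prod.collapse)
      also have "\<dots> \<le> M" by (rule M[OF s])
      finally show "fst (marg (sel (x s))) $ i \<le> M" by (simp only: g(2))
    qed
    finally show ?thesis by simp
  qed
  show ?thesis
  proof (rule continuous_from_closed_graph)
    show "compact (cball (0 :: real^'d^'n) (real CARD('n) * M))" by simp
    show "(\<lambda>s. sel (x s)) \<in> K \<rightarrow> cball 0 (real CARD('n) * M)" using bnd by auto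
    show "closed ((\<lambda>s. (s, sel (x s))) ` K)"
      unfolding closed_sequential_limits
    proof (intro allI impI)
      fix z l assume "(\<forall>n. z n \<in> (\<lambda>s. (s, sel (x s))) ` K) \<and> z \<longlonglongrightarrow> l"
      then have z: "\<And>n. z n \<in> (\<lambda>s. (s, sel (x s))) ` K" and lim: "z \<longlonglongrightarrow> l" by auto
      obtain \<sigma> where \<sigma>: "\<And>n. \<sigma> n \<in> K" "\<And>n. z n = (\<sigma> n, sel (x (\<sigma> n)))"
        using z by (auto simp: image_iff) metis
      obtain s g where l: "l = (s, g)" by (cases l)
      have \<sigma>s: "\<sigma> \<longlonglongrightarrow> s" using tendsto_fst[OF lim] \<sigma>(2) l by simp
      define h where "h = (\<lambda>n. sel (x (\<sigma> n)))"
      have hg: "h \<longlonglongrightarrow> g" using tendsto_snd[OF lim] \<sigma>(2) l by (simp add: h_def)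
      have hgc: "(\<lambda>n. h n $ i $ j) \<longlonglongrightarrow> g $ i $ j" for i j by (intro tendsto_intros hg)
      have sK: "s \<in> K" using closed_sequentially[OF compact_imp_closed[OF K] _ \<sigma>s] \<sigma>(1) by blast
      have xs: "(\<lambda>n. x (\<sigma> n)) \<longlonglongrightarrow> x s"
        using continuous_on_tendsto_compose[OF x \<sigma>s sK] \<sigma>(1) by simp
      have "\<forall>n. \<exists>C. C \<in> TT \<and> x (\<sigma> n) \<in> mcone C" using covered \<sigma>(1) by blast
      then obtain C where C: "\<And>n. C n \<in> TT" "\<And>n. x (\<sigma> n) \<in> mcone (C n)" by metis
      have hC: "h n \<in> flows (C n)" "marg (h n) = x (\<sigma> n)" for n
        using sel(1)[OF C] unfolding cell_flows_eq[OF C] h_def by auto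
      have h0: "0 \<le> h n $ i $ j" for n i j by (rule flowsD(1)[OF hC(1)])
      have g0: "0 \<le> g $ i $ j" for i j by (rule LIMSEQ_le_const[OF hgc]) (use h0 in auto)
      obtain \<epsilon> where \<epsilon>: "\<epsilon> > 0" "\<And>C y. C \<in> TT \<Longrightarrow> dist y (x s) < \<epsilon> \<Longrightarrow> y \<in> mcone C \<Longrightarrow> x s \<in> mcone C"
        using nearby_cells[of TT "x s"] by blast
      have ev1: "\<forall>\<^sub>F n in sequentially. x s \<in> mcone (C n)"
        using tendstoD[OF xs \<epsilon>(1)] by eventually_elim (use \<epsilon>(2) C in blast)
      have ev2: "\<forall>\<^sub>F n in sequentially. \<forall>p\<in>supp g. g $ fst p $ snd p / 2 < h n $ fst p $ snd p"
      proof (rule eventually_ball_finite)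
        show "\<forall>p\<in>supp g. \<forall>\<^sub>F n in sequentially. g $ fst p $ snd p / 2 < h n $ fst p $ snd p"
        proof
          fix p assume "p \<in> supp g"
          then have "g $ fst p $ snd p / 2 < g $ fst p $ snd p"
            using g0[of "fst p" "snd p"] by (auto simp: supp_def less_le)
          then show "\<forall>\<^sub>F n in sequentially. g $ fst p $ snd p / 2 < h n $ fst p $ snd p"
            by (rule order_tendstoD(1)[OF hgc])
        qed
      qed simp
      have ev2': "g $ i $ j / 2 \<le> h n $ i $ j" if "\<forall>p\<in>supp g. g $ fst p $ snd p / 2 < h n $ fst p $ snd p" for n i j
        using bspec[OF that, of "(i, j)"] h0[of n i j] by (cases "(i, j) \<in> supp g") (auto simp: supp_def)
      have gC: "g \<in> flows (C n)" if "\<forall>p\<in>supp g. g $ fst p $ snd p / 2 < h n $ fst p $ snd p" for n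
      proof -
        have "g$i$j = 0" if "(i, j) \<notin> C n" for i j
          using ev2'[OF \<open>\<forall>p\<in>supp g. _ p\<close>, of i j] flowsD(2)[OF hC(1) that] g0[of i j] by simp
        then show ?thesis using g0 by (simp add: flows_def)
      qed
      have mg: "marg g = x s"
      proof -
        have "(\<lambda>n. marg (h n)) \<longlonglongrightarrow> marg g" by (rule continuous_on_tendsto_compose[OF continuous_marg[of UNIV] hg]) auto
        then show ?thesis using xs LIMSEQ_unique by (simp add: hC(2)) blast
      qed
      obtain N where N: "x s \<in> mcone (C N)" "\<forall>p\<in>supp g. g $ fst p $ snd p / 2 < h N $ fst p $ snd p"
        using eventually_happens'[OF sequentially_bot eventually_conj[OF ev1 ev2]] by blast
      have gF: "g \<in> cell_flows (x s)" using gC[OF N(2)] mg C(1) by (auto simp: cell_flows_def)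
      define f where "f = sel (x s)"
      have fF: "f \<in> cell_flows (x s)" unfolding f_def by (rule sel(1)[OF C(1) N(1)])
      have "\<forall>\<^sub>F n in sequentially. spread ((1/2) *\<^sub>R (f + g) + (h n - g)) \<le> spread (h n)"
        using ev1 ev2
      proof eventually_elim
        case (elim n)
        have fC: "f \<in> flows (C n)" "marg f = x s" using fF cell_flows_eq[OF C(1) elim(1)] by auto
        have "(1/2) *\<^sub>R (f + g) + (h n - g) \<in> flows (C n)"
        proof -
          \<comment> \<open>The entry equals \<open>f / 2 + (h n - g / 2)\<close>, and
            \<open>h n\<close> eventually exceeds \<open>g / 2\<close> on the support of
            \<open>g\<close> because it tends to \<open>g\<close>.\<close>
          have "0 \<le> (f$i$j + g$i$j) / 2 + (h n $i$j - g$i$j)" for i j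
            using ev2'[OF elim(2), of i j] flowsD(1)[OF fC(1), of i j] by (simp add: add_divide_distrib)
          then show ?thesis using fC(1) gC[OF elim(2)] hC(1)[of n] by (auto simp: flows_def)
        qed
        moreover have "marg ((1/2) *\<^sub>R (f + g) + (h n - g)) = x (\<sigma> n)"
          by (simp add: marg_add marg_diff marg_scaleR fC(2) mg hC(2) flip: scaleR_2)
        ultimately have "(1/2) *\<^sub>R (f + g) + (h n - g) \<in> cell_flows (x (\<sigma> n))"
          using C(1) by (auto simp: cell_flows_def)
        then show ?case unfolding h_def by (rule sel(2)[OF C])
      qed
      moreover have sc: "(\<lambda>n. spread (u n)) \<longlonglongrightarrow> spread v" if "u \<longlonglongrightarrow> v" for u v
        by (rule continuous_on_tendsto_compose[OF continuous_spread[of UNIV] that]) auto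
      have "(\<lambda>n. spread ((1/2) *\<^sub>R (f + g) + (h n - g))) \<longlonglongrightarrow> spread ((1/2) *\<^sub>R (f + g) + (g - g))"
        by (intro sc tendsto_intros hg)
      ultimately have "spread ((1/2) *\<^sub>R (f + g)) \<le> spread g"
        using tendsto_le[OF sequentially_bot sc[OF hg]] by simp
      moreover have "(spread f + spread g) / 2 \<le> spread ((1/2) *\<^sub>R (f + g))"
        using fF gF by (intro spread_midpoint(1)[of _ "C N"]) (auto simp: cell_flows_eq[OF C(1) N(1)])
      ultimately have "g = f"
        unfolding f_def using gF by (intro sel_unique[OF C(1) N(1)]) (auto simp: f_def)
      then show "l \<in> (\<lambda>s. (s, sel (x s))) ` K" using sK l by (auto simp: f_def)
    qed
  qed
qed

end

section \<open>Elimination\<close>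

text \<open>An edge of \<open>C - A\<close> lies in every cell of positive weight, so the gap 1/2
  survives because the weights sum to 1. An edge of \<open>A - C\<close> may be missing only from a
  cell of small weight, so merely a strict inequality remains.\<close>

lemma average_adapted:
  fixes w :: "'c::finite \<Rightarrow> real" and Cs :: "'c \<Rightarrow> ('n \<times> 'd) set"
  assumes w: "\<And>c. 0 \<le> w c" "sum w UNIV = 1" and ad: "\<And>c. w c > 0 \<Longrightarrow> adapted A (Cs c) (\<phi> c) (\<kappa> c)"
  defines "\<phi>' \<equiv> \<lambda>j. \<Sum>c\<in>UNIV. w c * \<phi> c j" and "\<kappa>' \<equiv> \<lambda>k. \<Sum>c\<in>UNIV. w c * \<kappa> c k"
    and "C \<equiv> \<Inter>c\<in>{c. w c > 0}. Cs c"
  shows "(k, j) \<in> A \<Longrightarrow> (k, j) \<in> C \<Longrightarrow> \<phi>' j = \<kappa>' k"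
    and "(k, j) \<in> C \<Longrightarrow> (k, j) \<notin> A \<Longrightarrow> \<kappa>' k + 1/2 \<le> \<phi>' j"
    and "(k, j) \<in> A \<Longrightarrow> (k, j) \<notin> C \<Longrightarrow> \<phi>' j < \<kappa>' k"
proof -
  have diff: "\<phi>' j - \<kappa>' k = (\<Sum>c\<in>UNIV. w c * (\<phi> c j - \<kappa> c k))"
    by (simp add: \<phi>'_def \<kappa>'_def right_diff_distrib sum_subtractf)
  have pos: "w c = 0 \<or> w c > 0" for c using w(1)[of c] by auto
  show "\<phi>' j = \<kappa>' k" if "(k, j) \<in> A" "(k, j) \<in> C"
  proof -
    have "w c * (\<phi> c j - \<kappa> c k) = 0" for c
      using pos[of c] adaptedD(1)[OF ad, of c k j] that by (auto simp: C_def)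
    then have "(\<Sum>c\<in>UNIV. w c * (\<phi> c j - \<kappa> c k)) = 0" by (intro sum.neutral) blast
    then show ?thesis using diff by simp
  qed
  show "\<kappa>' k + 1/2 \<le> \<phi>' j" if "(k, j) \<in> C" "(k, j) \<notin> A"
  proof -
    have "w c * (1/2) \<le> w c * (\<phi> c j - \<kappa> c k)" for c
      using pos[of c] adaptedD(2)[OF ad, of c k j] that by (auto simp: C_def intro!: mult_left_mono)
    then have "(\<Sum>c\<in>UNIV. w c * (1/2)) \<le> \<phi>' j - \<kappa>' k" unfolding diff by (intro sum_mono)
    then show ?thesis using w(2) by (simp flip: sum_divide_distrib)
  qed
  show "\<phi>' j < \<kappa>' k" if "(k, j) \<in> A" "(k, j) \<notin> C"
  proof -
    obtain c where c: "w c > 0" "(k, j) \<notin> Cs c" using \<open>(k, j) \<notin> C\<close> by (auto simp: C_def)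
    have le: "0 \<le> w c * (\<kappa> c k - \<phi> c j)" for c
      using pos[of c] adaptedD(1,3)[OF ad, of c k j] that(1) by (cases "(k, j) \<in> Cs c") auto
    have "0 < w c * (\<kappa> c k - \<phi> c j)" using c adaptedD(3)[OF ad[OF c(1)] that(1) c(2)] by simp
    then have "0 < (\<Sum>c\<in>UNIV. w c * (\<kappa> c k - \<phi> c j))"
      by (intro sum_pos2[of _ c]) (auto simp: le)
    then show ?thesis using diff by (simp add: right_diff_distrib sum_subtractf)
  qed
qed

text \<open>One row of the proof of elimination: \<open>A\<close>, \<open>B\<close>, \<open>C\<close> are the neighbours in the two types and in the
  cells at the fixed point, \<open>h\<close> is the mixed flow, \<open>g\<close> the flow on \<open>C\<close> with the same marginals, and
  \<open>\<alpha>\<close>, \<open>\<beta>\<close> are the dual potentials of \<open>A\<close>, \<open>B\<close>.  The energies of all rows sum to 0 because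
  \<open>h - g\<close> has zero marginals.\<close>

locale row_energy =
  fixes A B C :: "'d::finite set" and h g \<alpha> \<beta> :: "'d \<Rightarrow> real" and a b l :: real
  assumes g: "\<And>j. 0 \<le> g j" "\<And>j. j \<notin> C \<Longrightarrow> g j = 0"
    and h: "\<And>j. 0 \<le> h j" "\<And>j. j \<notin> A \<union> B \<Longrightarrow> h j = 0"
    and \<alpha>: "\<And>j. j \<in> A \<Longrightarrow> j \<in> C \<Longrightarrow> \<alpha> j = a" "\<And>j. j \<in> C \<Longrightarrow> j \<notin> A \<Longrightarrow> a + 1/2 \<le> \<alpha> j"
      "\<And>j. j \<in> A \<Longrightarrow> j \<notin> C \<Longrightarrow> \<alpha> j < a"
    and \<beta>: "\<And>j. j \<in> B \<Longrightarrow> j \<in> C \<Longrightarrow> \<beta> j = b" "\<And>j. j \<in> C \<Longrightarrow> j \<notin> B \<Longrightarrow> b + 1/2 \<le> \<beta> j"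
      "\<And>j. j \<in> B \<Longrightarrow> j \<notin> C \<Longrightarrow> \<beta> j < b"
    and t: "a \<le> b - l"
begin

text \<open>\<open>l\<close> aligns the two column potentials, and \<open>a\<close> is the smaller
  of the two row levels after this shift. The minimum of the aligned potentials serves as one column
  potential for all rows.\<close>

definition energy :: "'d \<Rightarrow> real" where
  "energy j = (h j - g j) * (min (\<alpha> j) (\<beta> j - l) - a)"

lemma outside: "j \<notin> A \<Longrightarrow> j \<notin> B \<Longrightarrow> j \<notin> C \<Longrightarrow> energy j = 0"
  by (simp add: energy_def g h)

lemma in_A: "j \<in> A \<Longrightarrow> energy j \<le> 0 \<and> (energy j = 0 \<longrightarrow> j \<notin> C \<longrightarrow> h j = 0)"
proof (cases "j \<in> C")
  case True
  assume "j \<in> A"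
  have "b \<le> \<beta> j" using \<beta>(1,2)[of j] True by (cases "j \<in> B") auto
  then show ?thesis using \<alpha>(1)[OF \<open>j \<in> A\<close> True] t True by (simp add: energy_def)
next
  case False
  assume "j \<in> A"
  then have "min (\<alpha> j) (\<beta> j - l) - a < 0" using \<alpha>(3)[of j] False by simp
  then show ?thesis using g(2)[OF False] h(1)[of j] by (auto simp: energy_def mult_le_0_iff)
qed

lemma other: "j \<in> C \<Longrightarrow> j \<notin> A \<Longrightarrow> j \<notin> B \<Longrightarrow> energy j \<le> 0 \<and> (energy j = 0 \<longrightarrow> g j = 0)"
  using \<alpha>(2)[of j] \<beta>(2)[of j] h(2)[of j] g(1)[of j] t by (auto simp: energy_def zero_le_mult_iff)

lemma in_B: assumes "j \<in> B" "j \<notin> A"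
  shows "h j = 0 \<or> a = b - l \<Longrightarrow> energy j \<le> 0"
    and "energy j = 0 \<Longrightarrow> a = b - l \<Longrightarrow> j \<notin> C \<Longrightarrow> h j = 0"
    and "energy j = 0 \<Longrightarrow> a < b - l \<Longrightarrow> h j = 0 \<Longrightarrow> g j = 0"
    and "b - l - a \<le> 1/2 \<Longrightarrow> energy j \<le> (h j - g j) * (b - l - a)"
proof -
  consider "j \<in> C" "min (\<alpha> j) (\<beta> j - l) - a = min (\<alpha> j - a) (b - l - a)" "\<alpha> j - a \<ge> 1/2"
    | "j \<notin> C" "g j = 0" "min (\<alpha> j) (\<beta> j - l) - a < b - l - a"
    using \<alpha>(2)[of j] \<beta>(1,3)[of j] g(2)[of j] assms by fastforce
  note cs = this
  show "energy j \<le> 0" if "h j = 0 \<or> a = b - l"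
    using cs that t g(1)[of j] h(1)[of j] by cases (auto simp: energy_def mult_le_0_iff zero_le_mult_iff)
  show "h j = 0" if "energy j = 0" "a = b - l" "j \<notin> C"
    using cs that unfolding energy_def by cases auto
  show "g j = 0" if "energy j = 0" "a < b - l" "h j = 0"
    using cs that unfolding energy_def by cases auto
  show "energy j \<le> (h j - g j) * (b - l - a)" if "b - l - a \<le> 1/2"
    using cs
  proof cases
    case 1 then show ?thesis using that by (simp add: energy_def)
  next
    case 2 then show ?thesis using h(1)[of j] unfolding energy_def by (intro mult_left_mono) auto
  qed
qed

text \<open>When the levels differ by at most the gap 1/2, the aligned minimum on
  \<open>C \<inter> B - A\<close> is the level of \<open>B\<close>. So the energy on
  \<open>B - A\<close> is at most the level difference times \<open>h - g\<close>, and all other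
  terms are at most 0.\<close>

lemma energy_sum_neg:
  assumes "a < b - l" "b - l - a \<le> 1/2" "(\<Sum>j\<in>B - A. h j - g j) < 0"
  shows "(\<Sum>j\<in>UNIV. energy j) < 0"
proof -
  have "(\<Sum>j\<in>UNIV. energy j) \<le> (\<Sum>j\<in>UNIV. if j \<in> B - A then (h j - g j) * (b - l - a) else 0)"
  proof (rule sum_mono)
    fix j show "energy j \<le> (if j \<in> B - A then (h j - g j) * (b - l - a) else 0)"
      using in_A[of j] in_B(4)[of j] other[of j] outside[of j] assms(2)
      by (cases "j \<in> A"; cases "j \<in> B"; cases "j \<in> C") auto
  qed
  also have "\<dots> = (\<Sum>j\<in>B - A. (h j - g j) * (b - l - a))"
    using sum.inter_restrict[of UNIV "\<lambda>j. (h j - g j) * (b - l - a)" "B - A"] by simp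
  also have "\<dots> = (\<Sum>j\<in>B - A. h j - g j) * (b - l - a)" by (simp add: sum_distrib_right)
  also have "\<dots> < 0" using assms by (simp add: mult_neg_pos)
  finally show ?thesis .
qed

lemma nonpos:
  assumes "a = b - l \<or> (\<forall>j\<in>B - A. h j = 0)"
  shows "energy j \<le> 0"
  using in_A[of j] in_B(1)[of j] other[of j] outside[of j] assms
  by (cases "j \<in> A"; cases "j \<in> B"; cases "j \<in> C") auto

text \<open>Terms that are at most 0 and sum to 0 all vanish, which locates the supports; when the
  level of \<open>A\<close> is strictly lower, \<open>g\<close> cannot use an edge of
  \<open>B - A\<close>.\<close>

lemma energy_sum_zero:
  assumes "a = b - l \<or> (\<forall>j\<in>B - A. h j = 0)" and 0: "(\<Sum>j\<in>UNIV. energy j) = 0"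
  shows "h j \<noteq> 0 \<Longrightarrow> j \<in> C" "g j \<noteq> 0 \<Longrightarrow> j \<in> A \<union> B" "a < b - l \<Longrightarrow> g j \<noteq> 0 \<Longrightarrow> j \<in> A"
proof -
  have "(\<Sum>j\<in>UNIV. - energy j) = 0" using 0 by (simp add: sum_negf)
  then have "\<forall>j\<in>UNIV. - energy j = 0" by (subst (asm) sum_nonneg_eq_0_iff) (auto simp: nonpos[OF assms(1)])
  then have e: "energy j = 0" for j by auto
  show "j \<in> C" if "h j \<noteq> 0"
    using that in_A[of j] in_B(2)[of j] h(2)[of j] e assms(1) by (cases "j \<in> A"; cases "j \<in> B"; auto)
  show AB: "j \<in> A \<union> B" if "g j \<noteq> 0" using that other[of j] g(2)[of j] e by auto
  show "j \<in> A" if "a < b - l" "g j \<noteq> 0"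
    using that AB in_B(3)[of j] e assms(1) by fastforce
qed

end

section \<open>Elimination by a fixed point of the mixing weights\<close>

context section_cover
begin

text \<open>At the fixed point the sign of the level difference \<open>t k\<close> decides whether
  row \<open>k\<close> follows \<open>A\<close> (weight 0) or \<open>B\<close> (weight 1), and the
  row energies are at most 0 with sum 0. This confines the selected flow \<open>g s\<close> to edges
  of the two types; its support is the face sought.\<close>

theorem eliminate:
  assumes A: "A \<subseteq> G" "no_isolated_left A" "\<And>C. C \<in> TT \<Longrightarrow> good A C"
    and B: "B \<subseteq> G" "no_isolated_left B" "\<And>C. C \<in> TT \<Longrightarrow> good B C"
  obtains C \<phi> where "C \<in> TT" "nbrs (ref \<phi> C) i = nbrs A i \<union> nbrs B i"
    "\<And>k. nbrs (ref \<phi> C) k \<in> {nbrs A k, nbrs B k, nbrs A k \<union> nbrs B k}"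
proof -
  define a b where "a = uniform A" and "b = uniform B"
  have a0: "0 \<le> a$k$j" "a$k$j \<noteq> 0 \<longleftrightarrow> j \<in> nbrs A k" "(\<Sum>j\<in>UNIV. a$k$j) = 1" for k j
    using uniform_rows[OF A(2)] uniform_pos[of k j A] uniform_flows[of A] by (auto simp: a_def flowsD nbrs_def uniform_nth)
  have b0: "0 \<le> b$k$j" "b$k$j \<noteq> 0 \<longleftrightarrow> j \<in> nbrs B k" "(\<Sum>j\<in>UNIV. b$k$j) = 1" for k j
    using uniform_rows[OF B(2)] uniform_pos[of k j B] uniform_flows[of B] by (auto simp: b_def flowsD nbrs_def uniform_nth)
  define h :: "real^'n \<Rightarrow> real^'d^'n" where "h = (\<lambda>s. \<chi> k j. (1 - s$k) * a$k$j + s$k * b$k$j)"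
  \<comment> \<open>Coordinate \<open>i\<close> is pinned to 1/2, so both types contribute to row
    \<open>i\<close>; the other weights range over [0, 1].\<close>
  define lo hi :: "real^'n" where "lo = (\<chi> k. if k = i then 1/2 else 0)" and "hi = (\<chi> k. if k = i then 1/2 else 1)"
  define K where "K = cbox lo hi"
  have *: "lo$k \<le> s$k \<and> s$k \<le> hi$k" if "s \<in> K" for s k using that by (simp add: K_def mem_box_cart)
  have Kc: "0 \<le> s$k" "s$k \<le> 1" if "s \<in> K" for s k
    using *[OF that, of k] by (auto simp: lo_def hi_def split: if_splits)
  have Ki: "s$i = 1/2" if "s \<in> K" for s
    using *[OF that, of i] by (simp add: lo_def hi_def)
  have hK: "h s \<in> flows G" "\<And>k. (\<Sum>j\<in>UNIV. h s$k$j) = 1" "\<And>k j. 0 \<le> h s$k$j" if s: "s \<in> K" for s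
  proof -
    show h0: "0 \<le> h s$k$j" for k j using Kc[OF s, of k] a0 b0 by (simp add: h_def)
    have "h s$k$j = 0" if "(k, j) \<notin> G" for k j
      using that a0(2)[of k j] b0(2)[of k j] A(1) B(1) by (auto simp: h_def nbrs_def)
    then show "h s \<in> flows G" using h0 by (simp add: flows_def)
    show "(\<Sum>j\<in>UNIV. h s$k$j) = 1" for k
      using a0(3)[of k] b0(3)[of k] by (simp add: h_def sum.distrib flip: sum_distrib_left)
  qed
  have h_iff: "h s$k$j \<noteq> 0 \<longleftrightarrow> (s$k < 1 \<and> j \<in> nbrs A k) \<or> (s$k > 0 \<and> j \<in> nbrs B k)" if s: "s \<in> K" for s k j
  proof -
    have "0 \<le> (1 - s$k) * a$k$j" "0 \<le> s$k * b$k$j" using Kc[OF s, of k] a0 b0 by auto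
    from add_nonneg_eq_0_iff[OF this]
    have "h s$k$j \<noteq> 0 \<longleftrightarrow> (1 - s$k) * a$k$j \<noteq> 0 \<or> s$k * b$k$j \<noteq> 0" by (simp only: h_def vec_lambda_beta de_Morgan_conj)
    then show ?thesis using Kc[OF s, of k] a0(2)[of k j] b0(2)[of k j] by auto
  qed
  have conth: "continuous_on S (\<lambda>s. marg (h s))" for S
    by (rule continuous_on_compose2[OF continuous_marg[of UNIV]])
       (auto simp: h_def intro!: continuous_intros continuous_on_vec_lambda)
  have covered: "\<exists>C\<in>TT. marg (h s) \<in> mcone C" if "s \<in> K" for s using cover1 hK[OF that] by blast
  define g where "g = (\<lambda>s. sel (marg (h s)))"
  have contg: "continuous_on K g"
    unfolding g_def by (rule continuous_sel) (auto simp: K_def conth intro!: covered[unfolded K_def])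
  have contg': "continuous_on K (\<lambda>s. g s $ k $ j)" for k j by (intro continuous_intros contg)
  have conth': "continuous_on K (\<lambda>s. h s $ k $ j)" for k j by (simp add: h_def) (intro continuous_intros)
  \<comment> \<open>Net excess of the mixture over the selected flow on the edges that belong to one
    type only.\<close>
  define TA where "TA = (\<lambda>s k. \<Sum>j\<in>nbrs A k - nbrs B k. h s$k$j - g s$k$j)"
  define TB where "TB = (\<lambda>s k. \<Sum>j\<in>nbrs B k - nbrs A k. h s$k$j - g s$k$j)"
  have contT: "continuous_on K (\<lambda>s. TA s k)" "continuous_on K (\<lambda>s. TB s k)" for k
    unfolding TA_def TB_def by (intro continuous_intros contg' conth')+
  \<comment> \<open>A correction for ties: at weight 0 with \<open>t k = 0\<close> the fixed point
    condition becomes \<open>TB s k \<ge> 0\<close>, which forbids \<open>g s\<close> to use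
    \<open>B k - A k\<close>; symmetrically at weight 1.\<close>
  define \<psi> where "\<psi> = (\<lambda>s k. (1 - s$k) * min (TB s k) 0 - s$k * min (TA s k) 0)"
  have cont\<psi>: "continuous_on K (\<lambda>s. \<psi> s k)" for k
    unfolding \<psi>_def by (intro continuous_intros contT)
  \<comment> \<open>A step against the level difference, clipped to the box. The factor 1/4 ensures
    that wherever \<psi> has to balance the level difference, this difference is at most 1/4 in
    absolute value and thus within the gap 1/2.\<close>
  define \<Phi> :: "(real^'n) \<times> (real^'n) \<Rightarrow> real^'n" where
    "\<Phi> = (\<lambda>z. \<chi> k. max (lo$k) (min (hi$k) (fst z$k - (snd z$k - snd z$i + \<psi> (fst z) k / 4))))"
  have cont\<Phi>: "continuous_on (K \<times> UNIV) \<Phi>"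
  proof -
    have "continuous_on (K \<times> UNIV) (\<lambda>z. \<psi> (fst z) k)" for k
      by (rule continuous_on_compose2[OF cont\<psi>]) (auto intro: continuous_on_fst continuous_on_id)
    then show ?thesis unfolding \<Phi>_def by (intro continuous_on_vec_lambda continuous_intros) auto
  qed
  have \<Phi>K: "\<Phi> (s, t) \<in> K" for s t by (auto simp: \<Phi>_def K_def mem_box_cart lo_def hi_def)
  have "\<exists>\<phi> \<kappa>. C \<in> TT \<longrightarrow> adapted A C \<phi> \<kappa>" for C
    using compatible_adapted[OF good_imp_compatible[OF A(3)] ne] by metis
  then obtain \<phi>A \<kappa>A where adA: "\<And>C. C \<in> TT \<Longrightarrow> adapted A C (\<phi>A C) (\<kappa>A C)" by metis
  have "\<exists>\<phi> \<kappa>. C \<in> TT \<longrightarrow> adapted B C \<phi> \<kappa>" for C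
    using compatible_adapted[OF good_imp_compatible[OF B(3)] ne] by metis
  then obtain \<phi>B \<kappa>B where adB: "\<And>C. C \<in> TT \<Longrightarrow> adapted B C (\<phi>B C) (\<kappa>B C)" by metis
  define p :: "('n \<times> 'd) set \<Rightarrow> real^'n" where "p = (\<lambda>C. \<chi> k. \<kappa>B C k - \<kappa>A C k)"
  \<comment> \<open>All subgraphs serve as indices; those that are not cells get the empty set and
    hence no weight.\<close>
  define X where "X = (\<lambda>C. if C \<in> TT then (\<lambda>s. marg (h s)) -` mcone C else {})"
  have "lo \<in> K" by (simp add: K_def mem_box_cart lo_def hi_def)
  then have K: "compact K" "convex K" "K \<noteq> {}" by (auto simp: K_def)
  have closedX: "closed (X C)" for C
    unfolding X_def by (auto intro!: closed_vimage closed_mcone conth)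
  have covX: "K \<subseteq> (\<Union>C. X C)" using covered by (fastforce simp: X_def)
  obtain s w where s: "s \<in> K" and w0: "\<And>C. 0 \<le> w C" and w1: "sum w UNIV = (1::real)"
    and wX: "\<And>C. w C > 0 \<Longrightarrow> s \<in> X C" and fp: "\<Phi> (s, \<Sum>C\<in>UNIV. w C *\<^sub>R p C) = s"
    by (rule fixed_point_cover[OF K closedX covX cont\<Phi> \<Phi>K, of p]) (rule that)
  have wT: "C \<in> TT" "marg (h s) \<in> mcone C" if "w C > 0" for C
    using wX[OF that] by (auto simp: X_def split: if_splits)
  define \<alpha> \<beta> where "\<alpha> = (\<lambda>j. \<Sum>C\<in>UNIV. w C * \<phi>A C j)" and "\<beta> = (\<lambda>j. \<Sum>C\<in>UNIV. w C * \<phi>B C j)"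
  define lA lB where "lA = (\<lambda>k. \<Sum>C\<in>UNIV. w C * \<kappa>A C k)" and "lB = (\<lambda>k. \<Sum>C\<in>UNIV. w C * \<kappa>B C k)"
  define \<C> where "\<C> = \<Inter>{C. w C > 0}"
  have \<C>: "\<C> = (\<Inter>C\<in>{C. w C > 0}. C)" by (simp add: \<C>_def)
  have avA: "(k, j) \<in> A \<Longrightarrow> (k, j) \<in> \<C> \<Longrightarrow> \<alpha> j = lA k"
    "(k, j) \<in> \<C> \<Longrightarrow> (k, j) \<notin> A \<Longrightarrow> lA k + 1/2 \<le> \<alpha> j"
    "(k, j) \<in> A \<Longrightarrow> (k, j) \<notin> \<C> \<Longrightarrow> \<alpha> j < lA k" for k j
    unfolding \<alpha>_def lA_def \<C>
    using average_adapted[of w A "\<lambda>C. C" \<phi>A \<kappa>A k j, OF w0 w1 adA[OF wT(1)]] by blast+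
  have avB: "(k, j) \<in> B \<Longrightarrow> (k, j) \<in> \<C> \<Longrightarrow> \<beta> j = lB k"
    "(k, j) \<in> \<C> \<Longrightarrow> (k, j) \<notin> B \<Longrightarrow> lB k + 1/2 \<le> \<beta> j"
    "(k, j) \<in> B \<Longrightarrow> (k, j) \<notin> \<C> \<Longrightarrow> \<beta> j < lB k" for k j
    unfolding \<beta>_def lB_def \<C>
    using average_adapted[of w B "\<lambda>C. C" \<phi>B \<kappa>B k j, OF w0 w1 adB[OF wT(1)]] by blast+
  \<comment> \<open>The shift makes the levels agree in row \<open>i\<close>, whose weight is not
    free to react.\<close>
  define \<rho> where "\<rho> = lB i - lA i"
  define t where "t = (\<lambda>k. lB k - \<rho> - lA k)"
  have ti: "t i = 0" by (simp add: t_def \<rho>_def)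
  obtain C\<^sub>0 where C\<^sub>0: "w C\<^sub>0 > 0"
    using w0 w1 by (metis less_eq_real_def sum.neutral zero_neq_one)
  have gF: "g s \<in> cell_flows (marg (h s))" unfolding g_def by (rule sel(1)[OF wT[OF C\<^sub>0]])
  have gC: "g s \<in> flows C" if "w C > 0" for C using gF cell_flows_eq[OF wT[OF that]] by simp
  have mg: "marg (h s) = marg (g s)" using gF by (auto simp: cell_flows_def)
  have g0: "0 \<le> g s$k$j" for k j by (rule flowsD(1)[OF gC[OF C\<^sub>0]])
  have g\<C>: "g s$k$j = 0" if "(k, j) \<notin> \<C>" for k j
    using that flowsD(2)[OF gC] by (auto simp: \<C>_def)
  have grow: "(\<Sum>j\<in>UNIV. g s$k$j) = 1" for k using marg_eqD(1)[OF mg, of k] hK(2)[OF s] by simp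
  have q: "s$k = max (lo$k) (min (hi$k) (s$k - (t k + \<psi> s k / 4)))" for k
  proof -
    have "(\<Sum>C\<in>UNIV. w C *\<^sub>R p C) $ k - (\<Sum>C\<in>UNIV. w C *\<^sub>R p C) $ i = t k"
      by (simp add: p_def t_def \<rho>_def lA_def lB_def right_diff_distrib sum_subtractf)
    then show ?thesis using arg_cong[OF fp, of "\<lambda>z. z $ k"] by (simp add: \<Phi>_def)
  qed
  \<comment> \<open>Clipping can hide a positive value of \<open>t k + \<psi> s k / 4\<close> only
    at the lower end of the interval and a negative one only at the upper end.\<close>
  have eq0: "t k + \<psi> s k / 4 \<le> 0" if "s$k > 0" "k \<noteq> i" for k
    using q[of k] that Kc(2)[OF s, of k] by (auto simp: lo_def hi_def max_def min_def split: if_splits)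
  have eq1: "t k + \<psi> s k / 4 \<ge> 0" if "s$k < 1" "k \<noteq> i" for k
    using q[of k] that Kc(1)[OF s, of k] by (auto simp: lo_def hi_def max_def min_def split: if_splits)
  have Tbound: "- 1 \<le> TA s k" "- 1 \<le> TB s k" for k
  proof -
    have *: "- 1 \<le> (\<Sum>j\<in>S. h s$k$j - g s$k$j)" for S
    proof -
      have "(\<Sum>j\<in>S. g s$k$j) \<le> (\<Sum>j\<in>UNIV. g s$k$j)" by (intro sum_mono2) (auto simp: g0)
      moreover have "0 \<le> (\<Sum>j\<in>S. h s$k$j)" by (intro sum_nonneg hK(3)[OF s])
      ultimately show ?thesis by (simp add: sum_subtractf grow)
    qed
    show "- 1 \<le> TA s k" "- 1 \<le> TB s k" unfolding TA_def TB_def by (rule *)+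
  qed
  have posB: "TB s k < 0 \<and> t k \<le> 1/2 \<and> s$k < 1" if "t k > 0" "s$k > 0" for k
  proof -
    have ki: "k \<noteq> i" using that ti by auto
    have \<psi>: "\<psi> s k \<le> - 4 * t k" using eq0[OF that(2) ki] by simp
    have "0 \<le> - (s$k * min (TA s k) 0)" using Kc(1)[OF s, of k] by (simp add: mult_nonneg_nonpos)
    then have m: "(1 - s$k) * min (TB s k) 0 < 0" "(1 - s$k) * min (TB s k) 0 \<le> - 4 * t k"
      using \<psi> that(1) by (auto simp: \<psi>_def)
    then have "min (TB s k) 0 < 0" "s$k < 1" using Kc(2)[OF s, of k] by (auto simp: mult_less_0_iff)
    moreover have "- 1 \<le> (1 - s$k) * min (TB s k) 0"
    proof -
      have "(1 - s$k) * (- 1) \<le> (1 - s$k) * min (TB s k) 0"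
        using Tbound(2)[of k] Kc(2)[OF s, of k] by (intro mult_left_mono) auto
      then show ?thesis using Kc(1)[OF s, of k] by simp
    qed
    ultimately show ?thesis using m by auto
  qed
  have posA: "TA s k < 0 \<and> - t k \<le> 1/2 \<and> s$k > 0" if "t k < 0" "s$k < 1" for k
  proof -
    have ki: "k \<noteq> i" using that ti by auto
    have \<psi>: "- 4 * t k \<le> \<psi> s k" using eq1[OF that(2) ki] by simp
    have "(1 - s$k) * min (TB s k) 0 \<le> 0" using Kc(2)[OF s, of k] by (simp add: mult_nonneg_nonpos)
    then have m: "s$k * min (TA s k) 0 < 0" "s$k * min (TA s k) 0 \<le> 4 * t k"
      using \<psi> that(1) by (auto simp: \<psi>_def)
    then have "min (TA s k) 0 < 0" "s$k > 0" using Kc(1)[OF s, of k] by (auto simp: mult_less_0_iff)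
    moreover have "- 1 \<le> s$k * min (TA s k) 0"
    proof -
      have "s$k * (- 1) \<le> s$k * min (TA s k) 0"
        using Tbound(1)[of k] Kc(1)[OF s, of k] by (intro mult_left_mono) auto
      then show ?thesis using Kc(2)[OF s, of k] by simp
    qed
    ultimately show ?thesis using m by auto
  qed
  let ?A = "nbrs A" and ?B = "nbrs B" and ?C = "nbrs \<C>"
  have memn: "(k, j) \<in> E \<longleftrightarrow> j \<in> nbrs E k" for k j and E :: "('n \<times> 'd) set" by (simp add: nbrs_def)
  have rowA: "row_energy (?A k) (?B k) (?C k) (\<lambda>j. h s$k$j) (\<lambda>j. g s$k$j) \<alpha> \<beta> (lA k) (lB k) \<rho>" if "t k \<ge> 0" for k
    using that hK(3)[OF s] h_iff[OF s, of k] g0 g\<C> avA[of k] avB[of k]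
    by unfold_locales (auto simp: t_def memn)
  \<comment> \<open>For a nonpositive level difference the roles of \<open>A\<close> and
    \<open>B\<close> are exchanged and the shift changes sign.\<close>
  have rowB: "row_energy (?B k) (?A k) (?C k) (\<lambda>j. h s$k$j) (\<lambda>j. g s$k$j) \<beta> \<alpha> (lB k) (lA k) (- \<rho>)" if "t k \<le> 0" for k
    using that hK(3)[OF s] h_iff[OF s, of k] g0 g\<C> avA[of k] avB[of k]
    by unfold_locales (auto simp: t_def memn)
  define m where "m = (\<lambda>k. min (lA k) (lB k - \<rho>))"
  define R where "R = (\<lambda>k. \<Sum>j\<in>UNIV. (h s$k$j - g s$k$j) * (min (\<alpha> j) (\<beta> j - \<rho>) - m k))"
  have RA: "R k = (\<Sum>j\<in>UNIV. row_energy.energy (\<lambda>j. h s$k$j) (\<lambda>j. g s$k$j) \<alpha> \<beta> (lA k) \<rho> j)" if "t k \<ge> 0" for k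
  proof -
    have "m k = lA k" using that by (simp add: m_def t_def)
    then show ?thesis by (simp add: R_def row_energy.energy_def[OF rowA[OF that]])
  qed
  have RB: "R k = (\<Sum>j\<in>UNIV. row_energy.energy (\<lambda>j. h s$k$j) (\<lambda>j. g s$k$j) \<beta> \<alpha> (lB k) (- \<rho>) j)" if "t k \<le> 0" for k
  proof -
    have "m k = lB k - \<rho>" using that by (simp add: m_def t_def)
    then have "min (\<alpha> j) (\<beta> j - \<rho>) - m k = min (\<beta> j) (\<alpha> j - - \<rho>) - lB k" for j by auto
    then show ?thesis by (simp add: R_def row_energy.energy_def[OF rowB[OF that]])
  qed
  have h0B: "h s$k$j = 0" if "s$k = 0" "j \<in> ?B k - ?A k" for k j using h_iff[OF s, of k j] that by auto
  have h0A: "h s$k$j = 0" if "s$k = 1" "j \<in> ?A k - ?B k" for k j using h_iff[OF s, of k j] that by auto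
  have Rneg: "R k \<le> 0 \<and> (R k = 0 \<longrightarrow> (t k > 0 \<longrightarrow> s$k = 0) \<and> (t k < 0 \<longrightarrow> s$k = 1))" for k
  proof (cases "t k \<ge> 0")
    case True
    show ?thesis
    proof (cases "t k > 0 \<and> s$k > 0")
      case True
      have "R k < 0"
        unfolding RA[OF \<open>t k \<ge> 0\<close>] using posB[of k] True
        by (intro row_energy.energy_sum_neg[OF rowA[OF \<open>t k \<ge> 0\<close>]]) (auto simp: t_def TB_def)
      then show ?thesis by simp
    next
      case False
      then have c: "lA k = lB k - \<rho> \<or> (\<forall>j\<in>?B k - ?A k. h s$k$j = 0)"
        using True Kc(1)[OF s, of k] h0B[of k] by (auto simp: t_def)
      have "R k \<le> 0"
        unfolding RA[OF \<open>t k \<ge> 0\<close>] by (intro sum_nonpos row_energy.nonpos[OF rowA[OF \<open>t k \<ge> 0\<close>] c])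
      then show ?thesis using False True Kc(1)[OF s, of k] by auto
    qed
  next
    case f: False
    then have tk: "t k \<le> 0" by simp
    show ?thesis
    proof (cases "s$k < 1")
      case True
      have "R k < 0"
        unfolding RB[OF tk] using posA[of k] True f
        by (intro row_energy.energy_sum_neg[OF rowB[OF tk]]) (auto simp: t_def TA_def)
      then show ?thesis by simp
    next
      case False
      then have s1: "s$k = 1" using Kc(2)[OF s, of k] by simp
      have "R k \<le> 0"
        unfolding RB[OF tk] using h0A[OF s1] by (intro sum_nonpos row_energy.nonpos[OF rowB[OF tk]]) auto
      then show ?thesis using s1 f by auto
    qed
  qed
  \<comment> \<open>The column potential \<open>min (\<alpha> j) (\<beta> j - \<rho>)\<close> is the
    same in all rows and \<open>m k\<close> depends on the row only.\<close>
  have "(\<Sum>k\<in>UNIV. R k) = 0"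
    unfolding R_def by (rule marg_eq_potential[OF mg])
  then have "(\<Sum>k\<in>UNIV. - R k) = 0" by (simp add: sum_negf)
  then have "\<forall>k\<in>UNIV. - R k = 0" by (subst (asm) sum_nonneg_eq_0_iff) (use Rneg in auto)
  then have R0: "R k = 0" for k by auto
  then have tpos: "t k > 0 \<Longrightarrow> s$k = 0" and tneg: "t k < 0 \<Longrightarrow> s$k = 1" for k using Rneg by blast+
  have fact: "(h s$k$j \<noteq> 0 \<longrightarrow> j \<in> ?C k) \<and> (g s$k$j \<noteq> 0 \<longrightarrow> j \<in> ?A k \<union> ?B k) \<and>
      (t k > 0 \<longrightarrow> g s$k$j \<noteq> 0 \<longrightarrow> j \<in> ?A k) \<and> (t k < 0 \<longrightarrow> g s$k$j \<noteq> 0 \<longrightarrow> j \<in> ?B k)" for k j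
  proof (cases "t k \<ge> 0")
    case True
    have c: "lA k = lB k - \<rho> \<or> (\<forall>j\<in>?B k - ?A k. h s$k$j = 0)"
      using True tpos[of k] h0B[of k] by (auto simp: t_def)
    note * = row_energy.energy_sum_zero[OF rowA[OF True] c, folded RA[OF True], OF R0]
    show ?thesis using *[of j] True by (auto simp: t_def)
  next
    case False
    then have tk: "t k \<le> 0" by simp
    have c: "lB k = lA k - (- \<rho>) \<or> (\<forall>j\<in>?A k - ?B k. h s$k$j = 0)"
      using False tneg[of k] h0A[of k] by (auto simp: t_def)
    note * = row_energy.energy_sum_zero[OF rowB[OF tk] c, folded RB[OF tk], OF R0]
    show ?thesis using *[of j] False by (auto simp: t_def)
  qed
  have factH: "j \<in> ?C k" if "h s$k$j \<noteq> 0" for k j using that fact[of k j] by blast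
  have factG: "j \<in> ?A k \<or> j \<in> ?B k" if "g s$k$j \<noteq> 0" for k j using that fact[of k j] by blast
  have factA: "j \<in> ?A k" if "t k > 0" "g s$k$j \<noteq> 0" for k j using that fact[of k j] by blast
  have factB: "j \<in> ?B k" if "t k < 0" "g s$k$j \<noteq> 0" for k j using that fact[of k j] by blast
  define E where "E = supp (g s)"
  have hE: "j \<in> nbrs E k" if "h s$k$j \<noteq> 0" for k j
  proof -
    have "h s \<in> flows C\<^sub>0"
      using hK(3)[OF s] factH C\<^sub>0 by (force simp: flows_def nbrs_def \<C>_def)
    then have "h s \<in> cell_flows (marg (h s))" using wT(1)[OF C\<^sub>0] by (auto simp: cell_flows_def)
    then have "supp (h s) \<subseteq> E" unfolding E_def g_def by (rule supp_sel[OF wT[OF C\<^sub>0]])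
    then show ?thesis using that by (auto simp: supp_def nbrs_def)
  qed
  have gE: "j \<in> nbrs E k \<longleftrightarrow> g s$k$j \<noteq> 0" for k j by (simp add: E_def supp_def nbrs_def)
  have Ei: "nbrs E i = ?A i \<union> ?B i"
  proof
    show "nbrs E i \<subseteq> ?A i \<union> ?B i" using factG gE by blast
    show "?A i \<union> ?B i \<subseteq> nbrs E i" using hE[of i] h_iff[OF s, of i] Ki[OF s] by auto
  qed
  have Ek: "nbrs E k = ?A k \<or> nbrs E k = ?B k \<or> nbrs E k = ?A k \<union> ?B k" for k
  proof -
    consider "0 < s$k" "s$k < 1" | "s$k = 0" | "s$k = 1"
      using Kc(1,2)[OF s, of k] by force
    then show ?thesis
    proof cases
      case 1
      then have "?A k \<union> ?B k \<subseteq> nbrs E k" using hE[of k] h_iff[OF s, of k] by auto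
      moreover have "nbrs E k \<subseteq> ?A k \<union> ?B k" using factG gE by blast
      ultimately show ?thesis by blast
    next
      case 2
      have ki: "k \<noteq> i" using 2 Ki[OF s] by auto
      have "?A k \<subseteq> nbrs E k" using 2 hE[of k] h_iff[OF s, of k] by auto
      moreover have "nbrs E k \<subseteq> ?A k"
      proof (cases "t k > 0")
        case True then show ?thesis using factA gE by blast
      next
        case False
        have "t k = 0" using False tneg[of k] 2 by (cases "t k" "0 :: real" rule: linorder_cases) auto
        then have "TB s k \<ge> 0" using eq1[OF _ ki] 2 by (simp add: \<psi>_def min_def split: if_splits)
        moreover have "TB s k = - (\<Sum>j\<in>?B k - ?A k. g s$k$j)"
          using sum.neutral[of "?B k - ?A k" "\<lambda>j. h s$k$j"] h0B[OF 2] by (simp add: TB_def sum_subtractf)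
        ultimately have "(\<Sum>j\<in>?B k - ?A k. g s$k$j) = 0" using sum_nonneg[of "?B k - ?A k" "\<lambda>j. g s$k$j"] g0 by simp
        then have "\<forall>j\<in>?B k - ?A k. g s$k$j = 0" by (subst (asm) sum_nonneg_eq_0_iff) (auto simp: g0)
        then show ?thesis using factG gE by blast
      qed
      ultimately show ?thesis by blast
    next
      case 3
      have ki: "k \<noteq> i" using 3 Ki[OF s] by auto
      have "?B k \<subseteq> nbrs E k" using 3 hE[of k] h_iff[OF s, of k] by auto
      moreover have "nbrs E k \<subseteq> ?B k"
      proof (cases "t k < 0")
        case True then show ?thesis using factB gE by blast
      next
        case False
        have "t k = 0" using False tpos[of k] 3 by (cases "t k" "0 :: real" rule: linorder_cases) auto
        then have "TA s k \<ge> 0" using eq0[OF _ ki] 3 by (simp add: \<psi>_def min_def split: if_splits)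
        moreover have "TA s k = - (\<Sum>j\<in>?A k - ?B k. g s$k$j)"
          using sum.neutral[of "?A k - ?B k" "\<lambda>j. h s$k$j"] h0A[OF 3] by (simp add: TA_def sum_subtractf)
        ultimately have "(\<Sum>j\<in>?A k - ?B k. g s$k$j) = 0" using sum_nonneg[of "?A k - ?B k" "\<lambda>j. g s$k$j"] g0 by simp
        then have "\<forall>j\<in>?A k - ?B k. g s$k$j = 0" by (subst (asm) sum_nonneg_eq_0_iff) (auto simp: g0)
        then show ?thesis using factG gE by blast
      qed
      ultimately show ?thesis by blast
    qed
  qed
  have "\<exists>\<phi>. E = ref \<phi> C\<^sub>0"
  proof -
    have "supp k \<subseteq> supp (g s)" if "k \<in> flows C\<^sub>0" "marg k = marg (g s)" for k
      unfolding g_def using that wT[OF C\<^sub>0] mg by (intro supp_sel[OF wT[OF C\<^sub>0]]) (auto simp: cell_flows_def)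
    moreover have "no_isolated_left (supp (g s))" by (rule no_isolated_left_supp) (simp add: grow)
    ultimately show ?thesis unfolding E_def using carrier_face[OF gC[OF C\<^sub>0]] by metis
  qed
  then show ?thesis using that[of C\<^sub>0] wT(1)[OF C\<^sub>0] Ei Ek by auto
qed

end

section \<open>Combinatorial subdivisions and tropical oriented matroids\<close>

text \<open>The coefficients \<open>c\<close> may be negative: the linear span of the edges of
  \<open>H\<close> contains that of \<open>G\<close>. For \<open>H \<subseteq> G\<close> this
  encodes full dimension, of the cell of the root polytope and of the cell of the permutohedron
  alike.\<close>

definition spans :: "('n::finite \<times> 'd::finite) set \<Rightarrow> ('n \<times> 'd) set \<Rightarrow> bool" where
  "spans H G \<longleftrightarrow> (\<forall>(k, j)\<in>G. \<exists>c. supp c \<subseteq> H \<and> marg c = marg (unit_flow k j))"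

definition subdiv :: "('n::finite \<times> 'd::finite) set \<Rightarrow> ('n \<times> 'd) set set \<Rightarrow> bool" where
  "subdiv G TT \<longleftrightarrow> (\<forall>H\<in>TT. H \<subseteq> G \<and> no_isolated_left H \<and> spans H G) \<and>
     (\<forall>f\<in>flows G. \<exists>C\<in>TT. marg f \<in> mcone C) \<and> (\<forall>C\<in>TT. \<forall>C'\<in>TT. good C C')"

definition faces :: "('n \<times> 'd) set set \<Rightarrow> ('n \<times> 'd) set set" where
  "faces TT = {ref \<phi> H |\<phi> H. H \<in> TT}"

definition maximal_types :: "('n \<times> 'd) set set \<Rightarrow> ('n \<times> 'd) set set" where
  "maximal_types \<O> = {T \<in> \<O>. \<forall>A\<in>\<O>. T \<subseteq> A \<longrightarrow> A = T}"

lemma spansE: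
  assumes "spans H G" "(k, j) \<in> G"
  obtains c where "supp c \<subseteq> H" "marg c = marg (unit_flow k j)"
  using assms unfolding spans_def by blast

lemma subdivD:
  assumes "subdiv G TT"
  shows "H \<in> TT \<Longrightarrow> H \<subseteq> G" "H \<in> TT \<Longrightarrow> no_isolated_left H" "H \<in> TT \<Longrightarrow> spans H G"
    "f \<in> flows G \<Longrightarrow> \<exists>C\<in>TT. marg f \<in> mcone C" "H \<in> TT \<Longrightarrow> H' \<in> TT \<Longrightarrow> good H H'"
  using assms unfolding subdiv_def by blast+

lemma subdiv_section_cover:
  assumes "no_isolated_left G" "subdiv G TT" shows "section_cover G TT"
proof
  show "f \<in> flows C'" if "C \<in> TT" "C' \<in> TT" "f \<in> flows C" "g \<in> flows C'" "marg f = marg g" for C C' f g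
    using goodD(1)[OF subdivD(5)[OF assms(2) that(1,2)] that(3-5)] .
  show "C \<subseteq> G" "no_isolated_left C" if "C \<in> TT" for C using subdivD(1,2)[OF assms(2) that] .
  show "no_isolated_left G" by (rule assms(1))
  show "\<exists>C\<in>TT. marg f \<in> mcone C" if "f \<in> flows G" for f using subdivD(4)[OF assms(2) that] .
qed

lemma (in section_cover) subdivI:
  assumes "\<And>H. H \<in> TT \<Longrightarrow> spans H G" shows "subdiv G TT"
  unfolding subdiv_def
proof (intro conjI ballI)
  fix H assume H: "H \<in> TT"
  show "H \<subseteq> G" "no_isolated_left H" "spans H G" using sub[OF H] ne[OF H] assms[OF H] .
  show "good H H'" if "H' \<in> TT" for H' using good_cells[OF H that] .
next
  fix f assume "f \<in> flows G"
  then show "\<exists>C\<in>TT. marg f \<in> mcone C" by (rule cover)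
qed

section \<open>The faces of a subdivision satisfy the axioms\<close>

lemma ref_const: "ref (\<lambda>_. c) H = H"
  by (auto simp: ref_def)

lemma faces_self: "H \<in> TT \<Longrightarrow> H \<in> faces TT"
  unfolding faces_def using ref_const[of 0 H] by (metis (mono_tags, lifting) mem_Collect_eq)

lemma facesE: assumes "A \<in> faces TT" obtains \<phi> H where "H \<in> TT" "A = ref \<phi> H"
  using assms by (auto simp: faces_def)

text \<open>A cell containing the marginals of the uniform flow on \<open>ref \<phi> G\<close> has
  an edge of this face in every row, hence the same row maxima of \<phi> as
  \<open>G\<close>.\<close>

lemma subdiv_boundary:
  assumes neG: "no_isolated_left G" and sd: "subdiv G TT"
  obtains C where "C \<in> TT" "ref \<phi> C \<subseteq> ref \<phi> G"
proof -
  define e where "e = uniform (ref \<phi> G)"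
  have e: "e \<in> flows (ref \<phi> G)" by (simp add: e_def uniform_flows)
  then have eG: "e \<in> flows G" by (rule flows_mono) (rule ref_subset)
  obtain C where C: "C \<in> TT" "marg e \<in> mcone C" using subdivD(4)[OF sd eG] by blast
  obtain g where g: "g \<in> flows C" "marg e = marg g" using C(2) by (rule mconeE)
  have "g \<in> flows (ref \<phi> G)"
    using ref_flow[OF neG flows_mono[OF g(1) subdivD(1)[OF sd C(1)]] e] g(2) by simp
  moreover have "no_isolated_left (supp g)"
    using marg_eqD(1)[OF g(2)] uniform_rows[OF no_isolated_left_ref[OF neG, of \<phi>]]
    by (intro no_isolated_left_supp) (simp add: e_def)
  ultimately have *: "\<exists>j. (i, j) \<in> C \<and> (i, j) \<in> ref \<phi> G" for i
    using no_isolated_leftD[of "supp g" i] flows_supp g(1) by blast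
  have "ref \<phi> C \<subseteq> ref \<phi> G"
  proof clarify
    fix i j assume ij: "(i, j) \<in> ref \<phi> C"
    obtain j' where "(i, j') \<in> C" "(i, j') \<in> ref \<phi> G" using * by blast
    then show "(i, j) \<in> ref \<phi> G" using ij subdivD(1)[OF sd C(1)] by (force simp: ref_def)
  qed
  then show ?thesis using that C(1) by blast
qed

lemma subdiv_faces_weak_tom:
  assumes neG: "no_isolated_left G" and sd: "subdiv G TT"
  shows "weak_tom G (faces TT)"
proof -
  interpret section_cover G TT using subdiv_section_cover[OF assms] .
  have sub': "A \<subseteq> G" and ne': "no_isolated_left A" if A: "A \<in> faces TT" for A
  proof -
    obtain \<phi> H where H: "H \<in> TT" "A = ref \<phi> H" using A by (rule facesE)
    show "A \<subseteq> G" using sub[OF H(1)] ref_subset[of \<phi> H] H(2) by simp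
    show "no_isolated_left A" using no_isolated_left_ref[OF ne[OF H(1)]] H(2) by simp
  qed
  have gd: "good A B" if "A \<in> faces TT" "B \<in> faces TT" for A B
  proof -
    obtain \<phi> H where H: "H \<in> TT" "A = ref \<phi> H" by (rule facesE[OF \<open>A \<in> faces TT\<close>])
    obtain \<psi> K where K: "K \<in> TT" "B = ref \<psi> K" by (rule facesE[OF \<open>B \<in> faces TT\<close>])
    show ?thesis unfolding H(2) K(2) by (rule good_ref[OF good_cells[OF H(1) K(1)] ne[OF H(1)] ne[OF K(1)]])
  qed
  show ?thesis
    unfolding weak_tom_def
  proof (intro conjI ballI allI)
    fix A assume A: "A \<in> faces TT"
    show "A \<subseteq> G" "no_isolated_left A" using sub'[OF A] ne'[OF A] .
    show "ref \<phi> A \<in> faces TT" for \<phi>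
    proof -
      obtain \<psi> H where H: "H \<in> TT" "A = ref \<psi> H" using A by (rule facesE)
      obtain \<omega> where "ref \<phi> (ref \<psi> H) = ref \<omega> H" using ref_refE[of \<phi> \<psi>] by metis
      then show ?thesis using H by (auto simp: faces_def)
    qed
    fix B assume B: "B \<in> faces TT"
    show "good A B" by (rule gd[OF A B])
    fix i
    obtain C \<phi> where "C \<in> TT" "nbrs (ref \<phi> C) i = nbrs A i \<union> nbrs B i"
      "\<And>k. nbrs (ref \<phi> C) k \<in> {nbrs A k, nbrs B k, nbrs A k \<union> nbrs B k}"
      using eliminate[OF sub'[OF A] ne'[OF A] gd[OF A faces_self] sub'[OF B] ne'[OF B] gd[OF B faces_self]] by metis
    then show "\<exists>C\<in>faces TT. nbrs C i = nbrs A i \<union> nbrs B i \<and>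
        (\<forall>k. nbrs C k \<in> {nbrs A k, nbrs B k, nbrs A k \<union> nbrs B k})"
      by (intro bexI[of _ "ref \<phi> C"]) (auto simp: faces_def)
  next
    fix \<phi>
    obtain C where "C \<in> TT" "ref \<phi> C \<subseteq> ref \<phi> G" using subdiv_boundary[OF assms] by blast
    then show "\<exists>C\<in>faces TT. C \<subseteq> ref \<phi> G" by (auto simp: faces_def)
  qed
qed

text \<open>An injective potential leaves a single edge in each row, so the inclusion of the two
  refinements is an equality.\<close>

lemma subdiv_boundary_inj:
  fixes G :: "('n::finite \<times> 'd::finite) set"
  assumes neG: "no_isolated_left G" and sd: "subdiv G TT" and inj: "inj \<phi>"
  shows "ref \<phi> G \<in> faces TT"
proof -
  obtain C where C: "C \<in> TT" "ref \<phi> C \<subseteq> ref \<phi> G" using subdiv_boundary[OF assms(1,2)] by blast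
  have "ref \<phi> G \<subseteq> ref \<phi> C"
  proof clarify
    fix i j assume ij: "(i, j) \<in> ref \<phi> G"
    obtain j' where j': "(i, j') \<in> ref \<phi> C"
      using no_isolated_leftD[OF no_isolated_left_ref[OF subdivD(2)[OF sd C(1)]]] by blast
    then have "(i, j') \<in> ref \<phi> G" using C(2) by blast
    then have "\<phi> j = \<phi> j'" using ij by (intro antisym) (simp_all add: ref_def)
    then show "(i, j) \<in> ref \<phi> C" using inj j' by (simp add: inj_eq)
  qed
  then have "ref \<phi> G = ref \<phi> C" using C(2) by blast
  then show ?thesis using C(1) by (auto simp: faces_def)
qed

section \<open>The maximal types form a subdivision\<close>

lemma ex_maximal_type:
  fixes \<O> :: "('n::finite \<times> 'd::finite) set set"
  assumes "A \<in> \<O>" obtains T where "T \<in> maximal_types \<O>" "A \<subseteq> T"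
proof -
  obtain T where T: "T \<in> \<O>" "A \<subseteq> T" "\<forall>B\<in>\<O>. T \<subseteq> B \<longrightarrow> T = B"
    using finite_has_maximal2[OF finite assms] by blast
  then have "T \<in> maximal_types \<O>" by (auto simp: maximal_types_def)
  then show ?thesis using T(2) by (rule that)
qed

text \<open>A cell met on leaving an interior point of a maximal type \<open>T\<close> towards an
  edge of \<open>G\<close> contains \<open>T\<close>, hence equals it, and the exchange of flows
  expresses the edge by edges of \<open>T\<close>. Every type is a face of a maximal one because a
  compatible subgraph is a refinement.\<close>

lemma weak_tom_subdiv:
  assumes tom: "weak_tom G \<O>"
  shows "subdiv G (maximal_types \<O>)" "faces (maximal_types \<O>) = \<O>"
proof -
  let ?M = "maximal_types \<O>"
  have MO: "T \<in> \<O>" if "T \<in> ?M" for T using that by (simp add: maximal_types_def)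
  interpret section_cover G ?M
  proof
    show "C \<subseteq> G" "no_isolated_left C" if "C \<in> ?M" for C using weak_tomD(1,2)[OF tom MO[OF that]] .
    show "no_isolated_left G" by (rule weak_tom_no_isolated[OF tom])
    show "\<exists>C\<in>?M. marg f \<in> mcone C" if f: "f \<in> flows G" "\<And>i. (\<Sum>j\<in>UNIV. f$i$j) = 1" for f
    proof -
      obtain C where C: "C \<in> \<O>" "marg f \<in> mcone C" using weak_tom_cover[OF tom f] by blast
      obtain T where "T \<in> ?M" "C \<subseteq> T" using ex_maximal_type[OF C(1)] .
      then show ?thesis using mcone_mono C(2) by blast
    qed
    show "f \<in> flows C'" if "C \<in> ?M" "C' \<in> ?M" "f \<in> flows C" "g \<in> flows C'" "marg f = marg g" for C C' f g
      using goodD(1)[OF weak_tomD(5)[OF tom MO MO], of C C' f g] that by blast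
  qed
  show "subdiv G ?M"
  proof (rule subdivI)
    fix T assume T: "T \<in> ?M"
    show "spans T G"
      unfolding spans_def
    proof clarify
      fix k j assume kj: "(k, j) \<in> G"
      define u where "u = uniform T"
      have uT: "u \<in> flows T" by (simp add: u_def uniform_flows)
      have "\<exists>C\<in>?M. marg u + \<eta> *\<^sub>R marg (unit_flow k j) \<in> mcone C" if "0 < \<eta>" for \<eta>
      proof -
        have "u + \<eta> *\<^sub>R unit_flow k j \<in> flows G"
          using flows_mono[OF uT sub[OF T]] unit_flow_flows[OF kj] that by (intro flows_add flows_scaleR) auto
        from cover[OF this] show ?thesis by (simp add: marg_add marg_scaleR)
      qed
      then obtain C \<eta> where C: "C \<in> ?M" "marg u \<in> mcone C" "0 < \<eta>" "marg u + \<eta> *\<^sub>R marg (unit_flow k j) \<in> mcone C"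
        using approach[of 1 ?M "marg u" "marg (unit_flow k j)"] by (metis zero_less_one)
      obtain v where v: "v \<in> flows C" "marg u = marg v" using C(2) by (rule mconeE)
      obtain g where g: "g \<in> flows C" "marg u + \<eta> *\<^sub>R marg (unit_flow k j) = marg g" using C(4) by (rule mconeE)
      have "u \<in> flows C" using goodD(1)[OF good_cells[OF T C(1)] uT v] .
      then have "T \<subseteq> C" using flows_supp supp_uniform[of T] by (auto simp: u_def)
      then have "C = T" using T MO[OF C(1)] by (simp add: maximal_types_def)
      then have gT: "g \<in> flows T" using g by simp
      have "supp ((1 / \<eta>) *\<^sub>R (g - u)) \<subseteq> T"
        using flowsD(2)[OF gT] flowsD(2)[OF uT] by (force simp: supp_def)
      moreover have "marg ((1 / \<eta>) *\<^sub>R (g - u)) = marg (unit_flow k j)"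
      proof -
        have "marg g - marg u = \<eta> *\<^sub>R marg (unit_flow k j)" using g(2) by (metis add_diff_cancel_left')
        then show ?thesis using C(3) by (simp add: marg_scaleR marg_diff)
      qed
      ultimately show "\<exists>c. supp c \<subseteq> T \<and> marg c = marg (unit_flow k j)" by blast
    qed
  qed
  show "faces ?M = \<O>"
  proof
    show "faces ?M \<subseteq> \<O>" using weak_tomD(4)[OF tom] MO by (auto elim!: facesE)
    show "\<O> \<subseteq> faces ?M"
    proof
      fix A assume A: "A \<in> \<O>"
      obtain T where T: "T \<in> ?M" "A \<subseteq> T" using ex_maximal_type[OF A] .
      have "compatible A T" by (rule good_imp_compatible[OF weak_tomD(5)[OF tom A MO[OF T(1)]]])
      then obtain \<phi> where "A = ref \<phi> T" using compatible_face[OF _ T(2) weak_tomD(2)[OF tom A]] by metis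
      then show "A \<in> faces ?M" using T(1) by (auto simp: faces_def)
    qed
  qed
qed

text \<open>An edge missing in \<open>H\<close> is a signed combination \<open>c\<close> of edges of
  \<open>H\<close>. Exchanging a little of \<open>c\<close> for this edge turns an interior flow of
  \<open>H\<close> into a flow on \<open>H'\<close> with the same marginals that leaves
  \<open>H\<close>, contrary to \<open>good\<close>.\<close>

lemma subdiv_subset_eq:
  assumes sd: "subdiv G TT" and H: "H \<in> TT" "H' \<in> TT" "H \<subseteq> H'"
  shows "H = H'"
proof (rule ccontr)
  assume "H \<noteq> H'"
  then obtain k j where kj: "(k, j) \<in> H'" "(k, j) \<notin> H" using H(3) by auto
  have "(k, j) \<in> G" using kj(1) subdivD(1)[OF sd H(2)] by blast
  then obtain c where c: "supp c \<subseteq> H" "marg c = marg (unit_flow k j)"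
    using spansE[OF subdivD(3)[OF sd H(1)]] by blast
  define u where "u = uniform H"
  have u: "u \<in> flows H" "supp u = H" by (simp_all add: u_def uniform_flows supp_uniform)
  obtain \<epsilon> where \<epsilon>: "\<epsilon> > 0" "\<And>i j. \<epsilon> * \<bar>c$i$j\<bar> \<le> u$i$j"
    using scale_below[OF u(1), of c] c(1) u(2) by blast
  define f where "f = u + \<epsilon> *\<^sub>R (unit_flow k j - c)"
  have c0: "c$a$b = 0" if "(a, b) \<notin> H" for a b using that c(1) by (auto simp: supp_def)
  have "f \<in> flows H'"
  proof -
    have "0 \<le> f$a$b" for a b
    proof -
      have "\<epsilon> * c$a$b \<le> \<epsilon> * \<bar>c$a$b\<bar>" using \<epsilon>(1) by (intro mult_left_mono) auto
      then have "0 \<le> u$a$b - \<epsilon> * c$a$b" using \<epsilon>(2)[of a b] by linarith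
      then have "0 \<le> u$a$b - \<epsilon> * c$a$b + \<epsilon> * unit_flow k j $a$b" using \<epsilon>(1) by simp
      also have "\<dots> = f$a$b" by (simp add: f_def right_diff_distrib)
      finally show ?thesis .
    qed
    moreover have "f$a$b = 0" if "(a, b) \<notin> H'" for a b
    proof -
      have "(a, b) \<notin> H" using that H(3) by blast
      then show ?thesis using that kj(1) flowsD(2)[OF u(1)] c0 by (auto simp: f_def)
    qed
    ultimately show ?thesis by (auto simp: flows_def)
  qed
  moreover have "marg u = marg f" by (simp add: f_def marg_add marg_scaleR marg_diff c(2))
  ultimately have "f \<in> flows H" using goodD(2)[OF subdivD(5)[OF sd H(1,2)] u(1)] by blast
  then have "f$k$j = 0" using kj(2) by (simp add: flowsD)
  then show False using kj(2) flowsD(2)[OF u(1) kj(2)] c0[OF kj(2)] \<epsilon>(1) by (simp add: f_def)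
qed

lemma subdiv_maximal_faces:
  assumes sd: "subdiv G TT"
  shows "maximal_types (faces TT) = TT"
proof
  show "maximal_types (faces TT) \<subseteq> TT"
  proof
    fix A assume A: "A \<in> maximal_types (faces TT)"
    then obtain \<phi> H where H: "H \<in> TT" "A = ref \<phi> H" by (auto simp: maximal_types_def elim: facesE)
    then show "A \<in> TT" using A faces_self[OF H(1)] ref_subset[of \<phi> H] by (auto simp: maximal_types_def)
  qed
  show "TT \<subseteq> maximal_types (faces TT)"
  proof
    fix H assume H: "H \<in> TT"
    have "A = H" if A: "A \<in> faces TT" "H \<subseteq> A" for A
    proof -
      obtain \<phi> H' where H': "H' \<in> TT" "A = ref \<phi> H'" using A(1) by (rule facesE)
      then have "A \<subseteq> H'" by (simp add: ref_subset)
      then have "H = H'" using subdiv_subset_eq[OF sd H H'(1)] A(2) by blast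
      then show ?thesis using \<open>A \<subseteq> H'\<close> A(2) by blast
    qed
    then show "H \<in> maximal_types (faces TT)" using faces_self[OF H] by (auto simp: maximal_types_def)
  qed
qed

section \<open>Ordered partitions and potentials\<close>

lemma nbrs_edges [simp]: "nbrs (edges A) = A"
  by (auto simp: nbrs_def edges_def fun_eq_iff)

lemma edges_nbrs [simp]: "edges (nbrs H) = H"
  by (auto simp: nbrs_def edges_def)

lemma is_type_iff: "is_type A \<longleftrightarrow> no_isolated_left (edges A)"
  by (simp add: is_type_def no_isolated_left_def)

lemma ref_cong:
  assumes "\<And>j j'. \<phi> j \<le> \<phi> j' \<longleftrightarrow> \<psi> j \<le> \<psi> j'" shows "ref \<phi> H = ref \<psi> H"
  by (auto simp: ref_def assms)

text \<open>\<open>idx j\<close> is the position of the block containing \<open>j\<close>.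
  Refinement keeps the block of smallest index whereas \<open>ref\<close> maximizes, hence the
  sign.\<close>

lemma ordered_partition_index:
  fixes P :: "'d::finite set list"
  assumes P: "ordered_partition P"
  obtains idx where "\<And>j m. m < length P \<and> j \<in> P ! m \<longleftrightarrow> m = idx j"
    "\<And>A :: 'n \<Rightarrow> 'd set. is_type A \<Longrightarrow> refinement A P = nbrs (ref (\<lambda>j. - real (idx j)) (edges A))"
proof -
  have part: "partition_on UNIV (set P)" "distinct P" using P by (auto simp: ordered_partition_def)
  have "\<forall>j. \<exists>m. m < length P \<and> j \<in> P ! m"
  proof
    fix j
    have "j \<in> \<Union>(set P)" using part(1) by (auto simp: partition_on_def)
    then show "\<exists>m. m < length P \<and> j \<in> P ! m" by (auto simp: in_set_conv_nth)
  qed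
  then obtain idx where idx: "\<And>j. idx j < length P \<and> j \<in> P ! idx j" by metis
  have uniq: "m = idx j" if "m < length P" "j \<in> P ! m" for j m
  proof -
    have "P ! m \<in> set P" "P ! idx j \<in> set P" using that idx[of j] by auto
    moreover have "P ! m \<inter> P ! idx j \<noteq> {}" using that idx[of j] by blast
    ultimately have "P ! m = P ! idx j" using part(1) unfolding partition_on_def disjoint_def by blast
    then show ?thesis using part(2) that idx[of j] by (simp add: nth_eq_iff_index_eq)
  qed
  have iff: "m < length P \<and> j \<in> P ! m \<longleftrightarrow> m = idx j" for j m using idx uniq by blast
  have "refinement A P = nbrs (ref (\<lambda>j. - real (idx j)) (edges A))" if A: "is_type A" for A :: "'n \<Rightarrow> 'd set"
  proof
    fix i
    let ?Q = "\<lambda>m. m < length P \<and> A i \<inter> P ! m \<noteq> {}"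
    obtain a where "a \<in> A i" using A by (auto simp: is_type_def)
    then have "?Q (idx a)" using idx[of a] by blast
    then have L: "?Q (LEAST m. ?Q m)" by (rule LeastI)
    define m\<^sub>0 where "m\<^sub>0 = (LEAST m. ?Q m)"
    have least: "m\<^sub>0 \<le> idx j" if "j \<in> A i" for j
      unfolding m\<^sub>0_def using that idx[of j] by (intro Least_le) blast
    obtain b where b: "b \<in> A i" "b \<in> P ! m\<^sub>0" "m\<^sub>0 < length P" using L unfolding m\<^sub>0_def by blast
    then have ib: "idx b = m\<^sub>0" using uniq[of m\<^sub>0 b] by simp
    have "j \<in> A i \<inter> P ! m\<^sub>0 \<longleftrightarrow> j \<in> A i \<and> (\<forall>j'\<in>A i. idx j \<le> idx j')" for j
    proof
      assume j: "j \<in> A i \<inter> P ! m\<^sub>0"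
      then have "idx j = m\<^sub>0" using uniq[of m\<^sub>0 j] b(3) by simp
      then show "j \<in> A i \<and> (\<forall>j'\<in>A i. idx j \<le> idx j')" using j least by simp
    next
      assume j: "j \<in> A i \<and> (\<forall>j'\<in>A i. idx j \<le> idx j')"
      then have "idx j = m\<^sub>0" using b(1) ib least[of j] by force
      then show "j \<in> A i \<inter> P ! m\<^sub>0" using j idx[of j] by simp
    qed
    then show "refinement A P i = nbrs (ref (\<lambda>j. - real (idx j)) (edges A)) i"
      by (auto simp: refinement_def m\<^sub>0_def[symmetric] nbrs_def ref_def edges_def)
  qed
  then show ?thesis using that iff by blast
qed

lemma potential_of_partition:
  fixes P :: "'d::finite set list"
  assumes P: "ordered_partition P"
  obtains \<phi> where "\<And>A :: 'n \<Rightarrow> 'd set. is_type A \<Longrightarrow> refinement A P = nbrs (ref \<phi> (edges A))"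
    "total_partition P \<Longrightarrow> inj \<phi>"
proof -
  obtain idx where idx: "\<And>j m. m < length P \<and> j \<in> P ! m \<longleftrightarrow> m = idx j"
    and r: "\<And>A :: 'n \<Rightarrow> 'd set. is_type A \<Longrightarrow> refinement A P = nbrs (ref (\<lambda>j. - real (idx j)) (edges A))"
    using ordered_partition_index[OF P] by blast
  have "inj (\<lambda>j. - real (idx j))" if tot: "total_partition P"
  proof -
    have "{..<length P} \<subseteq> range idx"
    proof
      fix m assume m: "m \<in> {..<length P}"
      then have "P ! m \<noteq> {}"
        using P by (auto simp: ordered_partition_def partition_on_def) (metis nth_mem)
      then show "m \<in> range idx" using idx[of m] m by blast
    qed
    then have "CARD('d) \<le> card (range idx)"
      using card_mono[of "range idx" "{..<length P}"] tot by (simp add: total_partition_def)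
    then have "card (range idx) = CARD('d)" using card_image_le[of "UNIV :: 'd set" idx] by simp
    then have "inj idx" by (rule eq_card_imp_inj_on[OF finite_class.finite_UNIV])
    then show ?thesis by (simp add: inj_on_def)
  qed
  then show ?thesis using that r by blast
qed

lemma partition_of_potential:
  fixes \<phi> :: "'d::finite \<Rightarrow> real"
  obtains P where "ordered_partition P" "inj \<phi> \<Longrightarrow> total_partition P"
    "\<And>A :: 'n \<Rightarrow> 'd set. is_type A \<Longrightarrow> refinement A P = nbrs (ref \<phi> (edges A))"
proof -
  \<comment> \<open>Largest value first, because refinement prefers the earliest block.\<close>
  define vs where "vs = rev (sorted_list_of_set (range \<phi>))"
  define P where "P = map (\<lambda>v. \<phi> -` {v}) vs"
  have vs: "set vs = range \<phi>" "distinct vs" "length vs = card (range \<phi>)"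
    by (simp_all add: vs_def)
  have desc: "vs ! m' < vs ! m" if "m < m'" "m' < length vs" for m m'
  proof -
    have "sorted_wrt (\<lambda>x y. y < x) vs"
      unfolding vs_def sorted_wrt_rev using strict_sorted_list_of_set[of "range \<phi>"] by simp
    then show ?thesis using that by (auto simp: sorted_wrt_iff_nth_less)
  qed
  have op: "ordered_partition P"
    unfolding ordered_partition_def
  proof
    show "distinct P"
      unfolding P_def distinct_map using vs by (auto simp: inj_on_def)
    show "partition_on UNIV (set P)"
      by (rule partition_onI) (auto simp: P_def vs disjnt_def)
  qed
  have tot: "total_partition P" if "inj \<phi>"
    using that op vs(3) by (simp add: total_partition_def P_def card_image)
  obtain idx where idx: "\<And>j m. m < length P \<and> j \<in> P ! m \<longleftrightarrow> m = idx j"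
    and r: "\<And>A :: 'n \<Rightarrow> 'd set. is_type A \<Longrightarrow> refinement A P = nbrs (ref (\<lambda>j. - real (idx j)) (edges A))"
    using ordered_partition_index[OF op] by blast
  have i: "idx j < length vs" "\<phi> j = vs ! idx j" for j
    using idx[of "idx j" j] by (auto simp: P_def)
  have "- real (idx j) \<le> - real (idx j') \<longleftrightarrow> \<phi> j \<le> \<phi> j'" for j j'
    using i[of j] i[of j'] desc[of "idx j" "idx j'"] desc[of "idx j'" "idx j"]
    by (cases "idx j" "idx j'" rule: linorder_cases) auto
  then have "ref (\<lambda>j. - real (idx j)) H = ref \<phi> H" for H :: "('n \<times> 'd) set" by (rule ref_cong)
  then show ?thesis using that op tot r by auto
qed

lemma tom_imp_weak:
  fixes G :: "('n::finite \<times> 'd::finite) set"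
  assumes neG: "no_isolated_left G" and tom: "tropical_oriented_matroid G \<O>"
  shows "weak_tom G (edges ` \<O>)"
proof -
  have typs: "is_type A" "edges A \<subseteq> G" if "A \<in> \<O>" for A using tom that by (auto simp: tropical_oriented_matroid_def)
  have bnd: "refinement (nbrs G) P \<in> \<O>" if "total_partition P" for P
    using tom that by (simp add: tropical_oriented_matroid_def)
  have sur: "refinement A P \<in> \<O>" if "A \<in> \<O>" "ordered_partition P" for A P
    using tom that by (simp add: tropical_oriented_matroid_def)
  have cmp: "compatible (edges A) (edges B)" if "A \<in> \<O>" "B \<in> \<O>" for A B
    using tom that by (simp add: tropical_oriented_matroid_def)
  have eli: "\<exists>C\<in>\<O>. C i = A i \<union> B i \<and> (\<forall>i'. C i' \<in> {A i', B i', A i' \<union> B i'})" if "A \<in> \<O>" "B \<in> \<O>" for A B i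
    using tom that unfolding tropical_oriented_matroid_def by blast
  show ?thesis
    unfolding weak_tom_def
  proof (intro conjI ballI allI)
    fix E assume "E \<in> edges ` \<O>"
    then obtain A where A: "A \<in> \<O>" "E = edges A" by blast
    show "E \<subseteq> G" "no_isolated_left E" using typs[OF A(1)] A(2) by (simp_all add: is_type_iff)
    show "ref \<phi> E \<in> edges ` \<O>" for \<phi>
    proof -
      obtain P where P: "ordered_partition P" "\<And>A :: 'n \<Rightarrow> 'd set. is_type A \<Longrightarrow> refinement A P = nbrs (ref \<phi> (edges A))"
        using partition_of_potential[of \<phi>] by metis
      have "nbrs (ref \<phi> E) \<in> \<O>" using sur[OF A(1) P(1)] P(2)[OF typs(1)[OF A(1)]] A(2) by simp
      then have "edges (nbrs (ref \<phi> E)) \<in> edges ` \<O>" by (rule imageI)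
      then show ?thesis by simp
    qed
    fix F assume "F \<in> edges ` \<O>"
    then obtain B where B: "B \<in> \<O>" "F = edges B" by blast
    show "good E F" using compatible_imp_good[OF cmp[OF A(1) B(1)]] typs(1)[OF B(1)] A(2) B(2) by (simp add: is_type_iff)
    show "\<exists>C\<in>edges ` \<O>. nbrs C i = nbrs E i \<union> nbrs F i \<and> (\<forall>k. nbrs C k \<in> {nbrs E k, nbrs F k, nbrs E k \<union> nbrs F k})" for i
    proof -
      obtain C where "C \<in> \<O>" "C i = A i \<union> B i" "\<forall>k. C k \<in> {A k, B k, A k \<union> B k}"
        using eli[OF A(1) B(1), of i] by blast
      then show ?thesis using A(2) B(2) by (intro bexI[of _ "edges C"]) simp_all
    qed
  next
    fix \<phi> :: "'d \<Rightarrow> real"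
    \<comment> \<open>Boundary is known for total refinements only, so ties of \<phi> are broken by
      an arbitrary numbering; the result lies inside \<open>ref \<phi> G\<close>.\<close>
    obtain \<iota> :: "'d \<Rightarrow> nat" where "inj \<iota>" using finite_imp_inj_to_nat_seg[of "UNIV :: 'd set"] by auto
    obtain M where M: "M > 0" "\<And>j j'. \<phi> j < \<phi> j' \<Longrightarrow> M * \<phi> j + real (\<iota> j) < M * \<phi> j' + real (\<iota> j')"
      using combine_potentials[of \<phi> "\<lambda>j. real (\<iota> j)"] by blast
    define \<omega> where "\<omega> = (\<lambda>j. M * \<phi> j + real (\<iota> j))"
    have "inj \<omega>"
    proof (rule injI)
      fix x y assume xy: "\<omega> x = \<omega> y"
      then have "\<phi> x = \<phi> y" using M(2)[of x y] M(2)[of y x] by (cases "\<phi> x" "\<phi> y" rule: linorder_cases) (auto simp: \<omega>_def)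
      then show "x = y" using xy \<open>inj \<iota>\<close> by (simp add: \<omega>_def inj_eq)
    qed
    obtain P where P: "inj \<omega> \<Longrightarrow> total_partition P" "\<And>A :: 'n \<Rightarrow> 'd set. is_type A \<Longrightarrow> refinement A P = nbrs (ref \<omega> (edges A))"
      using partition_of_potential[of \<omega>] by metis
    have "is_type (nbrs G)" using neG by (simp add: is_type_iff)
    then have "nbrs (ref \<omega> G) \<in> \<O>" using bnd[OF P(1)[OF \<open>inj \<omega>\<close>]] P(2)[of "nbrs G"] by simp
    then have "edges (nbrs (ref \<omega> G)) \<in> edges ` \<O>" by (rule imageI)
    moreover have "ref \<omega> G \<subseteq> ref \<phi> G"
      using ref_subset[of "\<lambda>j. real (\<iota> j)" "ref \<phi> G"] by (simp add: ref_ref[OF M] \<omega>_def)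
    ultimately show "\<exists>C\<in>edges ` \<O>. C \<subseteq> ref \<phi> G" by (intro bexI[of _ "ref \<omega> G"]) simp_all
  qed
qed

lemma subdiv_imp_tom:
  fixes G :: "('n::finite \<times> 'd::finite) set"
  assumes neG: "no_isolated_left G" and sd: "subdiv G TT"
  shows "tropical_oriented_matroid G (nbrs ` faces TT)"
proof -
  note tom = subdiv_faces_weak_tom[OF assms]
  show ?thesis
    unfolding tropical_oriented_matroid_def
  proof (intro conjI ballI allI impI)
    fix A assume "A \<in> nbrs ` faces TT"
    then obtain E where E: "E \<in> faces TT" "A = nbrs E" by blast
    show typs: "is_type A" using weak_tomD(2)[OF tom E(1)] E(2) by (simp add: is_type_iff)
    show "edges A \<subseteq> G" using weak_tomD(1)[OF tom E(1)] E(2) by simp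
    show "refinement A P \<in> nbrs ` faces TT" if "ordered_partition P" for P
    proof -
      obtain \<phi> where "refinement A P = nbrs (ref \<phi> (edges A))"
        using potential_of_partition[OF \<open>ordered_partition P\<close>] typs by metis
      then show ?thesis using weak_tomD(4)[OF tom E(1)] E(2) by simp
    qed
    fix B assume "B \<in> nbrs ` faces TT"
    then obtain F where F: "F \<in> faces TT" "B = nbrs F" by blast
    show "compatible (edges A) (edges B)"
      using good_imp_compatible[OF weak_tomD(5)[OF tom E(1) F(1)]] E(2) F(2) by simp
    fix i
    obtain C where "C \<in> faces TT" "nbrs C i = nbrs E i \<union> nbrs F i"
      "\<And>k. nbrs C k = nbrs E k \<or> nbrs C k = nbrs F k \<or> nbrs C k = nbrs E k \<union> nbrs F k"
      using weak_tom_elim[OF tom E(1) F(1), of i] by blast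
    then show "\<exists>C\<in>nbrs ` faces TT. C i = A i \<union> B i \<and> (\<forall>i'. C i' \<in> {A i', B i', A i' \<union> B i'})"
      using E(2) F(2) by auto
  next
    fix P :: "'d set list" assume P: "total_partition P"
    then have "ordered_partition P" by (simp add: total_partition_def)
    then obtain \<phi> where \<phi>: "\<And>A :: 'n \<Rightarrow> 'd set. is_type A \<Longrightarrow> refinement A P = nbrs (ref \<phi> (edges A))" "inj \<phi>"
      using potential_of_partition[of P] P by metis
    have "refinement (nbrs G) P = nbrs (ref \<phi> G)" using \<phi>(1)[of "nbrs G"] neG by (simp add: is_type_iff)
    then show "refinement (nbrs G) P \<in> nbrs ` faces TT" using subdiv_boundary_inj[OF assms \<phi>(2)] by simp
  qed
qed

text \<open>The inverse takes the maximal types, which recover a subdivision from its faces.\<close>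

lemma bij_subdiv_tom:
  fixes G :: "('n::finite \<times> 'd::finite) set"
  assumes neG: "no_isolated_left G"
  shows "bij_betw (\<lambda>TT. nbrs ` faces TT) {TT. subdiv G TT} {\<O>. tropical_oriented_matroid G \<O>}"
  unfolding bij_betw_def
proof
  have edges_image: "edges ` nbrs ` \<F> = \<F>" for \<F> :: "('n \<times> 'd) set set" by (simp add: image_image)
  show "inj_on (\<lambda>TT. nbrs ` faces TT) {TT. subdiv G TT}"
  proof (rule inj_onI)
    fix T1 T2 :: "('n \<times> 'd) set set"
    assume *: "T1 \<in> {TT. subdiv G TT}" "T2 \<in> {TT. subdiv G TT}" "nbrs ` faces T1 = nbrs ` faces T2"
    have "faces T1 = faces T2"
      using arg_cong[OF *(3), of "image edges"] unfolding edges_image .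
    then have "maximal_types (faces T1) = maximal_types (faces T2)" by simp
    then show "T1 = T2" using * subdiv_maximal_faces by (metis mem_Collect_eq)
  qed
  show "(\<lambda>TT. nbrs ` faces TT) ` {TT. subdiv G TT} = {\<O>. tropical_oriented_matroid G \<O>}"
  proof
    show "(\<lambda>TT. nbrs ` faces TT) ` {TT. subdiv G TT} \<subseteq> {\<O>. tropical_oriented_matroid G \<O>}"
      using subdiv_imp_tom[OF neG] by auto
    show "{\<O>. tropical_oriented_matroid G \<O>} \<subseteq> (\<lambda>TT. nbrs ` faces TT) ` {TT. subdiv G TT}"
    proof
      fix \<O> assume "\<O> \<in> {\<O>. tropical_oriented_matroid G \<O>}"
      then have "weak_tom G (edges ` \<O>)" using tom_imp_weak[OF neG] by simp
      from weak_tom_subdiv[OF this] have "subdiv G (maximal_types (edges ` \<O>))"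
        "nbrs ` faces (maximal_types (edges ` \<O>)) = \<O>" by (simp_all add: image_image)
      then show "\<O> \<in> (\<lambda>TT. nbrs ` faces TT) ` {TT. subdiv G TT}" by blast
    qed
  qed
qed

section \<open>Polytopes as sections of marginal cones\<close>

definition ones :: "real ^ 'n" where
  "ones = (\<chi> i. 1)"

definition total_one :: "((real ^ 'n::finite) \<times> (real ^ 'd)) set" where
  "total_one = {x. (\<Sum>i\<in>UNIV. fst x $ i) = 1}"

abbreviation perm :: "('n::finite \<times> 'd::finite) set \<Rightarrow> (real ^ 'd) set" where
  "perm H \<equiv> minkowski (perm_summands H)"

lemma mem_simplex_on:
  "x \<in> simplex_on J \<longleftrightarrow> (\<forall>j. 0 \<le> x$j) \<and> (\<forall>j. j \<notin> J \<longrightarrow> x$j = 0) \<and> (\<Sum>j\<in>UNIV. x$j) = 1"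
  (is "_ \<longleftrightarrow> ?P x")
proof
  have "simplex_on J \<subseteq> {x. ?P x}"
    unfolding simplex_on_def
  proof (rule hull_minimal)
    show "(\<lambda>j. axis j 1) ` J \<subseteq> {x. ?P x}" by (auto simp: axis_def)
    show "convex {x. ?P x}"
      by (rule convexI) (auto simp: sum.distrib simp flip: sum_distrib_left)
  qed
  then show "x \<in> simplex_on J \<Longrightarrow> ?P x" by blast
next
  assume x: "?P x"
  have "x = (\<Sum>j\<in>UNIV. x$j *\<^sub>R axis j 1)"
    by (simp add: vec_eq_iff axis_def if_distrib sum.delta cong: if_cong)
  also have "\<dots> = (\<Sum>j\<in>J. x$j *\<^sub>R axis j 1)"
    using x by (intro sum.mono_neutral_right) auto
  also have "\<dots> \<in> simplex_on J"
    unfolding simplex_on_def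
  proof (rule convex_sum)
    have "(\<Sum>j\<in>J. x$j) = (\<Sum>j\<in>UNIV. x$j)" using x by (intro sum.mono_neutral_left) auto
    then show "(\<Sum>j\<in>J. x$j) = 1" using x by simp
  qed (use x in \<open>auto intro: hull_inc\<close>)
  finally show "x \<in> simplex_on J" .
qed

lemma marg_ones_iff: "marg f = (ones, y) \<longleftrightarrow> (\<forall>i. (\<Sum>j\<in>UNIV. f$i$j) = 1) \<and> (\<Sum>i\<in>UNIV. f$i) = y"
  by (auto simp: marg_def ones_def vec_eq_iff)

text \<open>Row \<open>i\<close> of the flow is the point chosen in the \<open>i\<close>-th
  simplex.\<close>

lemma mem_perm: "y \<in> perm H \<longleftrightarrow> (ones, y) \<in> mcone H"
proof
  assume "y \<in> perm H"
  then obtain s where s: "y = sum s UNIV" "\<And>i. s i \<in> simplex_on (nbrs H i)"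
    by (auto simp: minkowski_def perm_summands_def set_sum_alt)
  define f where "f = (\<chi> i. s i)"
  have "f \<in> flows H" using s(2) by (auto simp: f_def flows_def mem_simplex_on nbrs_def)
  moreover have "marg f = (ones, y)" using s by (simp add: marg_ones_iff f_def mem_simplex_on)
  ultimately show "(ones, y) \<in> mcone H" by (metis mconeI)
next
  assume "(ones, y) \<in> mcone H"
  then obtain f where f: "f \<in> flows H" "(ones, y) = marg f" by (rule mconeE)
  then have "\<forall>i. (\<Sum>j\<in>UNIV. f$i$j) = 1" "y = (\<Sum>i\<in>UNIV. f$i)" by (simp_all add: marg_ones_iff eq_commute[of "(ones, y)"])
  then show "y \<in> perm H" using f(1)
    by (auto simp: minkowski_def perm_summands_def set_sum_alt mem_simplex_on nbrs_def flowsD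
        intro!: exI[of _ "\<lambda>i. f$i"])
qed

lemma times_perm: "{ones} \<times> perm H = mcone H \<inter> {ones} \<times> UNIV"
  by (auto simp: mem_perm)

text \<open>The generators have total row sum 1, so a multiple of a point of their convex hull has
  this sum only if the factor is 1.\<close>

lemma root_polytope_eq: "root_polytope H = mcone H \<inter> total_one"
proof
  let ?S = "(\<lambda>(i, j). (axis i (1::real), axis j (1::real))) ` H"
  have cvx: "convex total_one"
    by (rule convexI) (auto simp: total_one_def sum.distrib simp flip: sum_distrib_left)
  have t: "?S \<subseteq> total_one" by (auto simp: total_one_def axis_def)
  have hull: "root_polytope H \<subseteq> total_one"
    unfolding root_polytope_def by (rule hull_minimal) (fact t, rule cvx)
  then show "root_polytope H \<subseteq> mcone H \<inter> total_one"
    using convex_hull_subset_convex_cone_hull[of ?S] by (auto simp: root_polytope_def mcone_eq_hull)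
  show "mcone H \<inter> total_one \<subseteq> root_polytope H"
  proof
    fix x assume x: "x \<in> mcone H \<inter> total_one"
    then have "x \<noteq> 0" by (auto simp: total_one_def)
    then obtain y c where y: "y \<in> root_polytope H" "x = c *\<^sub>R y"
      using x unfolding mcone_eq_hull convex_cone_hull_convex_hull root_polytope_def by blast
    then have "(\<Sum>i\<in>UNIV. fst x $ i) = c * (\<Sum>i\<in>UNIV. fst y $ i)" by (simp add: sum_distrib_left)
    then have "c = 1" using x hull y(1) by (auto simp: total_one_def)
    then show "x \<in> root_polytope H" using y by simp
  qed
qed

section \<open>Linear spans, affine hulls and full-dimensional cells\<close>

definition flow_span :: "('n::finite \<times> 'd::finite) set \<Rightarrow> ((real ^ 'n) \<times> (real ^ 'd)) set" where
  "flow_span H = marg ` {c. supp c \<subseteq> H}"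

lemma supp_subset_iff: "supp c \<subseteq> H \<longleftrightarrow> (\<forall>i j. (i, j) \<notin> H \<longrightarrow> c$i$j = 0)"
  by (auto simp: supp_def)

lemma flow_spanI: "supp c \<subseteq> H \<Longrightarrow> marg c \<in> flow_span H"
  by (auto simp: flow_span_def)

lemma flow_spanE: assumes "x \<in> flow_span H" obtains c where "supp c \<subseteq> H" "x = marg c"
  using assms by (auto simp: flow_span_def)

lemma subspace_flow_span: "subspace (flow_span H)"
  unfolding flow_span_def
proof (rule linear_subspace_image[OF linear_marg])
  show "subspace {c. supp c \<subseteq> H}" by (rule subspaceI) (simp_all add: supp_subset_iff)
qed

lemma flow_span_mono: "H \<subseteq> K \<Longrightarrow> flow_span H \<subseteq> flow_span K"
  by (auto simp: flow_span_def)

lemma spans_iff: "spans H G \<longleftrightarrow> flow_span G \<subseteq> flow_span H"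
proof
  assume sp: "spans H G"
  have "marg c \<in> flow_span H" if c: "supp c \<subseteq> G" for c
    unfolding marg_decomp
  proof (intro subspace_sum[OF subspace_flow_span])
    fix i j
    show "c$i$j *\<^sub>R (axis i 1, axis j 1) \<in> flow_span H"
    proof (cases "(i, j) \<in> G")
      case True
      then obtain c' where "supp c' \<subseteq> H" "marg c' = marg (unit_flow i j)" using spansE[OF sp] by blast
      then have "(axis i 1, axis j 1) \<in> flow_span H" using flow_spanI[of c' H] by (simp add: marg_unit_flow)
      then show ?thesis by (rule subspace_scale[OF subspace_flow_span])
    next
      case False
      then have "c$i$j = 0" using c by (auto simp: supp_def)
      then show ?thesis using subspace_0[OF subspace_flow_span[of H]] by (simp add: zero_prod_def)
    qed
  qed
  then show "flow_span G \<subseteq> flow_span H" by (auto simp: flow_span_def)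
next
  assume le: "flow_span G \<subseteq> flow_span H"
  have "\<exists>c. supp c \<subseteq> H \<and> marg c = marg (unit_flow k j)" if "(k, j) \<in> G" for k j
  proof -
    have "marg (unit_flow k j) \<in> flow_span G"
      using flows_supp[OF unit_flow_flows[OF that]] by (auto simp: flow_span_def)
    then have "marg (unit_flow k j) \<in> flow_span H" using le by blast
    then show ?thesis by (metis flow_spanE)
  qed
  then show "spans H G" by (auto simp: spans_def)
qed

text \<open>From a flow \<open>u\<close> of full support every direction in the span can be followed
  a little inside the cone, so each point of \<open>flow_span H \<inter> L\<close> is an affine
  combination of two points of the section.\<close>

lemma affine_hull_section:
  assumes L: "affine L" and u: "u \<in> flows H" "supp u = H" "marg u \<in> L"
  shows "affine hull (mcone H \<inter> L) = flow_span H \<inter> L"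
proof
  have "mcone H \<subseteq> flow_span H" using flows_supp by (auto simp: mcone_def flow_span_def)
  then show "affine hull (mcone H \<inter> L) \<subseteq> flow_span H \<inter> L"
    by (intro hull_minimal affine_Int subspace_imp_affine subspace_flow_span L) auto
  show "flow_span H \<inter> L \<subseteq> affine hull (mcone H \<inter> L)"
  proof
    fix x assume x: "x \<in> flow_span H \<inter> L"
    then obtain c where c: "supp c \<subseteq> H" "x = marg c" by (auto simp: flow_span_def)
    have "supp (c - u) \<subseteq> supp u" using c(1) u(2) by (force simp: supp_def)
    then obtain \<epsilon> where \<epsilon>: "\<epsilon> > 0" "\<And>i j. \<epsilon> * \<bar>(c - u)$i$j\<bar> \<le> u$i$j"
      using scale_below[OF u(1)] by blast
    define p where "p = u + \<epsilon> *\<^sub>R (c - u)"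
    have pH: "p \<in> flows H"
      unfolding flows_def
    proof (intro CollectI allI conjI impI)
      fix i j
      have "- (\<epsilon> * \<bar>(c - u)$i$j\<bar>) \<le> \<epsilon> * (c - u)$i$j"
        using abs_ge_minus_self[of "(c - u)$i$j"] \<epsilon>(1) by (metis minus_le_iff mult_minus_right mult_left_mono less_imp_le)
      then show "0 \<le> p$i$j" using \<epsilon>(2)[of i j] by (simp add: p_def)
      assume "(i, j) \<notin> H"
      then show "p$i$j = 0" using c(1) flowsD(2)[OF u(1)] by (simp add: p_def supp_subset_iff)
    qed
    have mp: "marg p = (1 - \<epsilon>) *\<^sub>R marg u + \<epsilon> *\<^sub>R x"
      by (simp add: p_def c(2) marg_add marg_scaleR marg_diff algebra_simps)
    have "marg p \<in> L" unfolding mp using mem_affine[OF L u(3), of x "1 - \<epsilon>" \<epsilon>] x by simp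
    then have "marg p \<in> affine hull (mcone H \<inter> L)" using mconeI[OF pH] by (intro hull_inc) blast
    moreover have "marg u \<in> affine hull (mcone H \<inter> L)" using mconeI[OF u(1)] u(3) by (intro hull_inc) blast
    ultimately have "(1 - 1 / \<epsilon>) *\<^sub>R marg u + (1 / \<epsilon>) *\<^sub>R marg p \<in> affine hull (mcone H \<inter> L)"
      by (intro mem_affine affine_affine_hull) auto
    moreover have "(1 - 1 / \<epsilon>) *\<^sub>R marg u + (1 / \<epsilon>) *\<^sub>R marg p = x"
      using \<epsilon>(1) by (simp add: mp scaleR_add_right divide_simps algebra_simps flip: scaleR_add_left)
    ultimately show "x \<in> affine hull (mcone H \<inter> L)" by simp
  qed
qed

lemma aff_dim_eq_iff:
  fixes S T :: "'a::euclidean_space set"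
  assumes "S \<subseteq> T" "S \<noteq> {}"
  shows "aff_dim S = aff_dim T \<longleftrightarrow> affine hull S = affine hull T"
  using affine_dim_equal[of "affine hull S" "affine hull T"] assms hull_mono[of S T affine]
  by (metis aff_dim_affine_hull affine_affine_hull affine_hull_eq_empty)

lemma affine_total_one: "affine total_one"
  unfolding affine_def total_one_def by (auto simp: sum.distrib simp flip: sum_distrib_left)

lemma affine_ones: "affine ({ones :: real^'n} \<times> (UNIV :: 'b::real_vector set))"
  unfolding affine_def by (auto simp flip: scaleR_add_left)

lemma uniform_ones: "no_isolated_left H \<Longrightarrow> marg (uniform H) \<in> {ones} \<times> UNIV"
  by (auto simp: mem_Times_iff vec_eq_iff ones_def uniform_rows)

lemma unit_total_one: "marg (unit_flow k j) \<in> total_one"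
  by (simp add: marg_unit_flow total_one_def axis_def)

lemma root_polytope_mono: "H \<subseteq> K \<Longrightarrow> root_polytope H \<subseteq> root_polytope K"
  unfolding root_polytope_eq using mcone_mono by blast

lemma perm_mono: "H \<subseteq> K \<Longrightarrow> perm H \<subseteq> perm K"
  using mcone_mono[of H K] by (auto simp: mem_perm)

lemma affine_hull_root_polytope:
  assumes "H \<noteq> {}" shows "affine hull (root_polytope H) = flow_span H \<inter> total_one"
proof -
  define t where "t = (\<Sum>i\<in>UNIV. \<Sum>j\<in>UNIV. uniform H $ i $ j)"
  obtain k j where kj: "(k, j) \<in> H" using assms by auto
  have nonneg: "0 \<le> (\<Sum>j\<in>UNIV. uniform H $ i $ j)" for i by (intro sum_nonneg flowsD[OF uniform_flows])
  have "0 < (\<Sum>j\<in>UNIV. uniform H $ k $ j)" by (simp add: uniform_row[OF kj])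
  also have "\<dots> \<le> t" unfolding t_def by (intro member_le_sum nonneg) auto
  finally have t: "0 < t" .
  show ?thesis
    unfolding root_polytope_eq
  proof (rule affine_hull_section[OF affine_total_one])
    show "(1 / t) *\<^sub>R uniform H \<in> flows H" using t by (intro flows_scaleR uniform_flows) auto
    show "supp ((1 / t) *\<^sub>R uniform H) = H" using supp_uniform[of H] t by (simp add: supp_def)
    show "marg ((1 / t) *\<^sub>R uniform H) \<in> total_one"
      using t by (simp add: total_one_def t_def flip: sum_divide_distrib)
  qed
qed

lemma aff_dim_root_polytope:
  assumes "H \<subseteq> G" "G \<noteq> {}"
  shows "H \<noteq> {} \<and> aff_dim (root_polytope H) = aff_dim (root_polytope G) \<longleftrightarrow> spans H G"
proof
  assume sp: "spans H G"
  have "H \<noteq> {}"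
  proof
    assume "H = {}"
    obtain k j where "(k, j) \<in> G" using assms(2) by auto
    then obtain c where c: "supp c \<subseteq> H" "marg c = marg (unit_flow k j)" using spansE[OF sp] by blast
    then have "c = 0" using \<open>H = {}\<close> by (auto simp: supp_def vec_eq_iff)
    then show False using c(2) by (simp add: marg_0 marg_unit_flow zero_prod_def)
  qed
  moreover have "flow_span H = flow_span G" using sp flow_span_mono[OF assms(1)] by (auto simp: spans_iff)
  ultimately have "affine hull (root_polytope H) = affine hull (root_polytope G)"
    by (simp add: affine_hull_root_polytope assms(2))
  then show "H \<noteq> {} \<and> aff_dim (root_polytope H) = aff_dim (root_polytope G)"
    using \<open>H \<noteq> {}\<close> by (metis aff_dim_affine_hull)
next
  assume *: "H \<noteq> {} \<and> aff_dim (root_polytope H) = aff_dim (root_polytope G)"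
  then have "root_polytope H \<noteq> {}" by (simp add: root_polytope_def)
  then have "affine hull (root_polytope H) = affine hull (root_polytope G)"
    using * aff_dim_eq_iff[OF root_polytope_mono[OF assms(1)]] by simp
  then have "flow_span H \<inter> total_one = flow_span G \<inter> total_one"
    using * by (simp add: affine_hull_root_polytope assms(2))
  then have "marg (unit_flow k j) \<in> flow_span H" if "(k, j) \<in> G" for k j
    using unit_total_one[of k j] flows_supp[OF unit_flow_flows[OF that]] unfolding flow_span_def by blast
  then show "spans H G" unfolding spans_def flow_span_def by force
qed

lemma affine_hull_perm:
  assumes "no_isolated_left H" shows "affine hull (perm H) = {y. (ones, y) \<in> flow_span H}"
proof -
  have "perm H = snd ` ({ones} \<times> perm H)" by simp
  then have "affine hull (perm H) = snd ` (affine hull ({ones} \<times> perm H))"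
    using affine_hull_linear_image[OF bounded_linear_snd] by metis
  also have "affine hull ({ones} \<times> perm H) = flow_span H \<inter> {ones} \<times> UNIV"
    unfolding times_perm
    by (rule affine_hull_section[OF affine_ones uniform_flows supp_uniform uniform_ones[OF assms]])
  finally show ?thesis by force
qed

lemma perm_nonempty:
  assumes "no_isolated_left H" shows "perm H \<noteq> {}"
proof -
  have "marg (uniform H) \<in> {ones} \<times> perm H"
    unfolding times_perm by (intro IntI mconeI uniform_flows uniform_ones assms)
  then show ?thesis by blast
qed

lemma aff_dim_perm:
  assumes H: "no_isolated_left H" "H \<subseteq> G"
  shows "aff_dim (perm H) = aff_dim (perm G) \<longleftrightarrow> spans H G"
proof -
  have G: "no_isolated_left G" by (rule no_isolated_left_mono[OF H])
  have "aff_dim (perm H) = aff_dim (perm G) \<longleftrightarrow>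
      {y. (ones, y) \<in> flow_span H} = {y. (ones, y) \<in> flow_span G}"
    using aff_dim_eq_iff[OF perm_mono[OF H(2)] perm_nonempty[OF H(1)]] by (simp add: affine_hull_perm H G)
  also have "\<dots> \<longleftrightarrow> spans H G"
  proof
    assume "spans H G"
    then have "flow_span H = flow_span G" using flow_span_mono[OF H(2)] by (auto simp: spans_iff)
    then show "{y. (ones, y) \<in> flow_span H} = {y. (ones, y) \<in> flow_span G}" by simp
  next
    assume eq: "{y. (ones, y) \<in> flow_span H} = {y. (ones, y) \<in> flow_span G}"
    show "spans H G"
      unfolding spans_def
    proof clarify
      fix k j assume kj: "(k, j) \<in> G"
      define u where "u = uniform H"
      define u\<^sub>k where "u\<^sub>k = axis k (u $ k)"
      have u: "supp u = H" "\<And>i. (\<Sum>j\<in>UNIV. u$i$j) = 1"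
        by (simp_all add: u_def supp_uniform uniform_rows[OF H(1)])
      have uk: "supp u\<^sub>k \<subseteq> H" using u(1) by (auto simp: u\<^sub>k_def supp_def axis_def split: if_splits)
      have uk_row: "(\<Sum>j\<in>UNIV. u\<^sub>k$i$j) = (if i = k then 1 else 0)" for i
        by (simp add: u\<^sub>k_def axis_def u(2))
      \<comment> \<open>Replacing row \<open>k\<close> of an interior flow by the edge
        \<open>(k, j)\<close> keeps unit row sums, so the section alone decides whether this edge
        lies in the span.\<close>
      define g where "g = u - u\<^sub>k + unit_flow k j"
      have ones: "fst (marg g) = ones"
        by (simp add: vec_eq_iff ones_def g_def sum.distrib sum_subtractf u(2) uk_row)
      have "supp g \<subseteq> G"
        unfolding supp_subset_iff
      proof (intro allI impI)
        fix a b assume ab: "(a, b) \<notin> G"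
        then have "(a, b) \<notin> H" using H(2) by blast
        then have "u$a$b = 0" "u\<^sub>k$a$b = 0" using u(1) uk by (auto simp: supp_subset_iff supp_def)
        then show "g$a$b = 0" using ab kj by (auto simp: g_def)
      qed
      then have "(ones, snd (marg g)) \<in> flow_span G"
        unfolding ones[symmetric] using flow_spanI[of g G] by simp
      then have "(ones, snd (marg g)) \<in> flow_span H" using eq by blast
      then obtain c where c: "supp c \<subseteq> H" "marg c = marg g"
        unfolding ones[symmetric] by (metis flow_spanE prod.collapse)
      have "supp (c - u + u\<^sub>k) \<subseteq> H" using c(1) eq_refl[OF u(1)] uk by (simp add: supp_subset_iff)
      moreover have "marg (c - u + u\<^sub>k) = marg (unit_flow k j)"
        by (simp add: marg_add marg_diff c(2) g_def)
      ultimately show "\<exists>c. supp c \<subseteq> H \<and> marg c = marg (unit_flow k j)" by blast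
    qed
  qed
  finally show ?thesis .
qed

section \<open>Vertices\<close>

lemma axis_pair_root_polytope: "(axis i 1, axis j 1) \<in> root_polytope H \<longleftrightarrow> (i, j) \<in> H"
proof
  show "(i, j) \<in> H \<Longrightarrow> (axis i 1, axis j 1) \<in> root_polytope H"
    unfolding root_polytope_def by (rule hull_inc) force
  assume "(axis i 1, axis j 1) \<in> root_polytope H"
  then have "(axis i 1, axis j 1) \<in> mcone H" by (simp add: root_polytope_eq)
  then obtain f where f: "f \<in> flows H" "(axis i 1, axis j 1) = marg f" by (rule mconeE)
  then have m: "marg f = marg (unit_flow i j)" by (simp add: marg_unit_flow)
  have "f$i$b = 0" if "b \<noteq> j" for b
    using marg_eqD(2)[OF m, of b] that sum_nonneg_eq_0_iff[of UNIV "\<lambda>a. f$a$b"] flowsD(1)[OF f(1)] by simp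
  then have "(\<Sum>b\<in>UNIV. f$i$b) = f$i$j" using sum.remove[of UNIV j "\<lambda>b. f$i$b"] by simp
  then have "f$i$j = 1" using marg_eqD(1)[OF m, of i] by simp
  then show "(i, j) \<in> H" using flowsD(2)[OF f(1)] by fastforce
qed

lemma axis_simplex_on: "axis j 1 \<in> simplex_on J \<longleftrightarrow> j \<in> J"
  by (auto simp: mem_simplex_on axis_def)

lemma polytope_eq_hull_vertices: "polytope P \<Longrightarrow> P = convex hull (vertices P)"
  unfolding vertices_def using Krein_Milman_Minkowski polytope_imp_compact polytope_imp_convex by blast

lemma vertices_hull_independent:
  assumes "finite S" "\<And>x. x \<in> S \<Longrightarrow> x \<notin> convex hull (S - {x})"
  shows "vertices (convex hull S) = S"
  unfolding vertices_def
  using extreme_point_of_convex_hull_convex_independent[of S] assms finite_imp_compact by auto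

lemma vertices_simplex_on: "vertices (simplex_on J) = (\<lambda>j. axis j 1) ` J"
  unfolding simplex_on_def
proof (rule vertices_hull_independent)
  fix x assume "x \<in> (\<lambda>j. axis j (1::real)) ` J"
  then obtain j where j: "x = axis j 1" by blast
  have "(\<lambda>j. axis j (1::real)) ` J - {x} = (\<lambda>j. axis j 1) ` (J - {j})"
    by (auto simp: j axis_eq_axis)
  then show "x \<notin> convex hull ((\<lambda>j. axis j 1) ` J - {x})"
    using axis_simplex_on[of j "J - {j}"] by (simp add: j simplex_on_def)
qed auto

lemma vertices_root_polytope: "vertices (root_polytope H) = (\<lambda>(i, j). (axis i 1, axis j 1)) ` H"
  unfolding root_polytope_def
proof (rule vertices_hull_independent)
  let ?v = "\<lambda>(i, j). (axis i (1::real), axis j (1::real))"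
  fix x assume "x \<in> ?v ` H"
  then obtain i j where ij: "x = (axis i 1, axis j 1)" by auto
  have "?v ` H - {x} = ?v ` (H - {(i, j)})"
    by (auto simp: ij axis_eq_axis)
  then show "x \<notin> convex hull (?v ` H - {x})"
    using axis_pair_root_polytope[of i j "H - {(i, j)}"] by (simp add: ij root_polytope_def)
qed auto

lemma polytope_simplex_on: "polytope (simplex_on J)"
  by (simp add: simplex_on_def polytope_convex_hull)

lemma polytope_root_polytope: "polytope (root_polytope H)"
  by (simp add: root_polytope_def polytope_convex_hull)

lemma polytope_perm: "polytope (perm H)"
  by (simp add: minkowski_def perm_summands_def simplex_on_def polytope_convex_hull finite_set_sum
      flip: convex_hull_set_sum)

lemma inj_root_polytope: "inj (root_polytope :: ('n::finite \<times> 'd::finite) set \<Rightarrow> _)"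
proof (rule injI)
  fix H K :: "('n \<times> 'd) set" assume eq: "root_polytope H = root_polytope K"
  have "(i, j) \<in> H \<longleftrightarrow> (i, j) \<in> K" for i j
    using axis_pair_root_polytope[of i j H] axis_pair_root_polytope[of i j K] eq by simp
  then show "H = K" by auto
qed

lemma inj_perm_summands: "inj (perm_summands :: ('n::finite \<times> 'd::finite) set \<Rightarrow> _)"
proof (rule injI)
  fix H K :: "('n \<times> 'd) set" assume eq: "perm_summands H = perm_summands K"
  have "(i, j) \<in> H \<longleftrightarrow> (i, j) \<in> K" for i j
    using axis_simplex_on[of j "nbrs H i"] axis_simplex_on[of j "nbrs K i"] fun_cong[OF eq, of i]
    by (simp add: perm_summands_def nbrs_def)
  then show "H = K" by auto
qed

lemma polytope_in_simplexE:
  assumes "polytope P" "vertices P \<subseteq> vertices (simplex_on J)"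
  obtains I where "I \<subseteq> J" "P = simplex_on I"
proof -
  obtain I where "I \<subseteq> J" "vertices P = (\<lambda>j. axis j 1) ` I"
    using assms(2) unfolding vertices_simplex_on by (rule subset_imageE)
  then show ?thesis using that polytope_eq_hull_vertices[OF assms(1)] by (simp add: simplex_on_def)
qed

lemma polytope_in_root_polytopeE:
  assumes "polytope P" "vertices P \<subseteq> vertices (root_polytope G)"
  obtains H where "H \<subseteq> G" "P = root_polytope H"
proof -
  obtain H where "H \<subseteq> G" "vertices P = (\<lambda>(i, j). (axis i 1, axis j 1)) ` H"
    using assms(2) unfolding vertices_root_polytope by (rule subset_imageE)
  then show ?thesis using that polytope_eq_hull_vertices[OF assms(1)] by (simp add: root_polytope_def)
qed

lemma simplex_on_Int: "simplex_on I \<inter> simplex_on J = simplex_on (I \<inter> J)"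
  by (auto simp: mem_simplex_on)

lemma simplex_on_face:
  fixes J :: "'d::finite set"
  assumes "I \<subseteq> J" shows "simplex_on I face_of simplex_on J"
proof -
  have "(\<lambda>j. axis j (1::real)) ` J \<subseteq> (Basis :: (real^'d) set)" by (auto simp: axis_in_Basis_iff)
  then have "\<not> affine_dependent ((\<lambda>j. axis j (1::real)) ` J)"
    using affine_dependent_imp_dependent independent_mono[OF independent_Basis] by blast
  then show ?thesis
    unfolding simplex_on_def face_of_convex_hull_affine_independent[OF \<open>\<not> affine_dependent _\<close>]
    using image_mono[OF assms] by metis
qed

section \<open>Faces of sections\<close>

text \<open>If a proper convex combination of two flows on \<open>H\<close> is supported on
  \<open>K\<close>, so are both flows, as nonnegative entries cannot cancel.\<close>

lemma good_face:
  assumes "good H K" shows "mcone H \<inter> mcone K face_of mcone H"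
  unfolding face_of_def
proof (intro conjI ballI impI)
  show "convex (mcone H \<inter> mcone K)" by (intro convex_Int convex_mcone)
  fix a b x assume a: "a \<in> mcone H" and b: "b \<in> mcone H" and x: "x \<in> mcone H \<inter> mcone K" "x \<in> open_segment a b"
  obtain f where f: "f \<in> flows H" "a = marg f" using a by (rule mconeE)
  obtain g where g: "g \<in> flows H" "b = marg g" using b by (rule mconeE)
  obtain h where h: "h \<in> flows K" "x = marg h" using x(1) by (auto elim: mconeE)
  obtain u where u: "0 < u" "u < 1" "x = (1 - u) *\<^sub>R a + u *\<^sub>R b" using x(2) by (auto simp: in_segment)
  let ?w = "(1 - u) *\<^sub>R f + u *\<^sub>R g"
  have "?w \<in> flows H" using f g u by (intro flows_add flows_scaleR) auto
  moreover have "marg ?w = marg h" using u f g h by (simp add: marg_add marg_scaleR)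
  ultimately have w: "?w \<in> flows K" using goodD(1)[OF assms] h(1) by blast
  have "f$i$j = 0 \<and> g$i$j = 0" if "(i, j) \<notin> K" for i j
  proof -
    have "(1 - u) * f$i$j + u * g$i$j = 0" using flowsD(2)[OF w that] by simp
    moreover have "0 \<le> (1 - u) * f$i$j" "0 \<le> u * g$i$j"
      using u flowsD(1)[OF f(1)] flowsD(1)[OF g(1)] by simp_all
    ultimately show ?thesis using u by (simp add: add_nonneg_eq_0_iff)
  qed
  then have "f \<in> flows K" "g \<in> flows K" using f(1) g(1) by (auto simp: flows_def)
  then show "a \<in> mcone H \<inter> mcone K" "b \<in> mcone H \<inter> mcone K" using f g by (auto intro: mconeI)
qed auto

lemma root_polytope_common_face:
  assumes "good H K" shows "root_polytope H \<inter> root_polytope K face_of root_polytope H"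
  using face_of_slice[OF good_face[OF assms] affine_imp_convex[OF affine_total_one]]
  by (simp add: root_polytope_eq Int_ac)

lemma perm_common_face:
  fixes H K :: "('n::finite \<times> 'd::finite) set"
  assumes "good H K" shows "perm H \<inter> perm K face_of perm H"
proof -
  have "mcone H \<inter> mcone K \<inter> {ones} \<times> UNIV face_of mcone H \<inter> {ones} \<times> UNIV"
    by (rule face_of_slice[OF good_face[OF assms] affine_imp_convex[OF affine_ones]])
  moreover have "mcone H \<inter> mcone K \<inter> {ones} \<times> UNIV = {ones} \<times> (perm H \<inter> perm K)"
    by (auto simp: mem_perm)
  ultimately have "{ones :: real^'n} \<times> (perm H \<inter> perm K) face_of {ones} \<times> perm H"
    by (simp only: times_perm)
  then show ?thesis unfolding face_of_Times_eq by auto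
qed

section \<open>Faces of permutohedra are refinements\<close>

lemma good_ref_self:
  assumes "no_isolated_left H" shows "good H (ref \<phi> H)"
  unfolding good_def
proof (intro ballI impI conjI)
  fix f g assume *: "f \<in> flows H" "g \<in> flows (ref \<phi> H)" "marg f = marg g"
  show "f \<in> flows (ref \<phi> H)" by (rule ref_flow[OF assms *])
  show "g \<in> flows H" by (rule flows_mono[OF *(2) ref_subset])
qed

lemma perm_ref_face: "no_isolated_left H \<Longrightarrow> perm (ref \<phi> H) face_of perm H"
  using perm_common_face[OF good_ref_self] perm_mono[OF ref_subset] by (metis inf.absorb2)

text \<open>The difference of the two sides is a sum of nonnegative terms
  \<open>f$i$j * (?m i - a$j)\<close>, which vanishes exactly when the flow avoids all nonmaximal
  edges.\<close>

lemma flow_value: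
  assumes H: "no_isolated_left H" and f: "f \<in> flows H" "marg f = (ones, y)"
  shows "a \<bullet> y \<le> (\<Sum>i\<in>UNIV. row_max (($) a) H i)"
    "a \<bullet> y = (\<Sum>i\<in>UNIV. row_max (($) a) H i) \<longleftrightarrow> f \<in> flows (ref (($) a) H)"
proof -
  let ?m = "row_max (($) a) H"
  let ?D = "\<lambda>i j. f$i$j * (?m i - a$j)"
  have f1: "(\<Sum>j\<in>UNIV. f$i$j) = 1" and y: "y = (\<Sum>i\<in>UNIV. f$i)" for i using f(2) by (auto simp: marg_ones_iff)
  have D: "0 \<le> ?D i j \<and> (?D i j = 0 \<longleftrightarrow> ((i, j) \<notin> ref (($) a) H \<longrightarrow> f$i$j = 0))" for i j
  proof (cases "(i, j) \<in> H")
    case True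
    then show ?thesis using flowsD(1)[OF f(1), of i j] le_row_max[OF True, of "($) a"] ref_iff[OF H, of i j "($) a"] by auto
  next
    case False
    then show ?thesis using flowsD(2)[OF f(1)] by simp
  qed
  have "a \<bullet> y = (\<Sum>i\<in>UNIV. \<Sum>j\<in>UNIV. f$i$j * a$j)"
    unfolding y inner_sum_right by (simp add: inner_vec_def mult.commute)
  moreover have "?m i = (\<Sum>j\<in>UNIV. f$i$j * ?m i)" for i using f1[of i] by (simp flip: sum_distrib_right)
  then have "(\<Sum>i\<in>UNIV. ?m i) = (\<Sum>i\<in>UNIV. \<Sum>j\<in>UNIV. f$i$j * ?m i)" by simp
  ultimately have eq: "(\<Sum>i\<in>UNIV. ?m i) - a \<bullet> y = (\<Sum>i\<in>UNIV. \<Sum>j\<in>UNIV. ?D i j)"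
    by (simp add: sum_subtractf right_diff_distrib)
  have "0 \<le> (\<Sum>i\<in>UNIV. \<Sum>j\<in>UNIV. ?D i j)" using D by (intro sum_nonneg) auto
  then show "a \<bullet> y \<le> (\<Sum>i\<in>UNIV. ?m i)" using eq by simp
  have "(\<Sum>i\<in>UNIV. \<Sum>j\<in>UNIV. ?D i j) = 0 \<longleftrightarrow> (\<forall>i. (\<Sum>j\<in>UNIV. ?D i j) = 0)"
    using D by (subst sum_nonneg_eq_0_iff) (auto intro: sum_nonneg)
  also have "\<dots> \<longleftrightarrow> (\<forall>i j. ?D i j = 0)"
    using D by (subst sum_nonneg_eq_0_iff) auto
  also have "\<dots> \<longleftrightarrow> f \<in> flows (ref (($) a) H)" using D flowsD(1)[OF f(1)] by (auto simp: flows_def)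
  finally show "a \<bullet> y = (\<Sum>i\<in>UNIV. ?m i) \<longleftrightarrow> f \<in> flows (ref (($) a) H)" using eq by auto
qed

text \<open>Faces of a polytope are exposed, and the exposing functional serves as the potential. As
  \<open>F\<close> is nonempty, its supporting value must be the sum of the row maxima.\<close>

lemma perm_face_ref:
  assumes H: "no_isolated_left H" and F: "F face_of perm H" "F \<noteq> {}"
  obtains \<phi> where "F = perm (ref \<phi> H)"
proof -
  have "F exposed_face_of perm H"
    using F(1) exposed_face_of_polyhedron polytope_imp_polyhedron[OF polytope_perm] by blast
  then obtain a b where ab: "perm H \<subseteq> {x. a \<bullet> x \<le> b}" "F = perm H \<inter> {x. a \<bullet> x = b}"
    by (auto simp: exposed_face_of_def)
  let ?s = "\<Sum>i\<in>UNIV. row_max (($) a) H i"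
  have val: "a \<bullet> y \<le> ?s" "a \<bullet> y = ?s \<longleftrightarrow> y \<in> perm (ref (($) a) H)" if "y \<in> perm H" for y
  proof -
    have "(ones, y) \<in> mcone H" using that by (simp add: mem_perm)
    then obtain f where f: "f \<in> flows H" "(ones, y) = marg f" by (rule mconeE)
    show "a \<bullet> y \<le> ?s" by (rule flow_value(1)[OF H f(1) f(2)[symmetric]])
    show "a \<bullet> y = ?s \<longleftrightarrow> y \<in> perm (ref (($) a) H)"
    proof
      assume "a \<bullet> y = ?s"
      then have "f \<in> flows (ref (($) a) H)" using flow_value(2)[OF H f(1) f(2)[symmetric]] by simp
      then show "y \<in> perm (ref (($) a) H)" unfolding mem_perm f(2) by (rule mconeI)
    next
      assume "y \<in> perm (ref (($) a) H)"
      then have "(ones, y) \<in> mcone (ref (($) a) H)" by (simp add: mem_perm)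
      then obtain g where g: "g \<in> flows (ref (($) a) H)" "(ones, y) = marg g" by (rule mconeE)
      then show "a \<bullet> y = ?s" using flow_value(2)[OF H flows_mono[OF g(1) ref_subset] g(2)[symmetric]] by simp
    qed
  qed
  obtain z where z: "z \<in> perm (ref (($) a) H)" using perm_nonempty[OF no_isolated_left_ref[OF H]] by blast
  have zH: "z \<in> perm H" using z perm_mono[OF ref_subset] by blast
  obtain x where x: "x \<in> F" using F(2) by blast
  have "?s \<le> b" using val(2)[OF zH] z ab(1) zH by auto
  moreover have "b \<le> ?s" using val(1)[of x] x ab(2) by auto
  ultimately have b: "b = ?s" by simp
  have "F = perm (ref (($) a) H)"
  proof (intro set_eqI iffI)
    fix y assume "y \<in> F"
    then have "y \<in> perm H" "a \<bullet> y = ?s" using ab(2) b by simp_all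
    then show "y \<in> perm (ref (($) a) H)" using val(2)[of y] by blast
  next
    fix y assume y: "y \<in> perm (ref (($) a) H)"
    then have "y \<in> perm H" using perm_mono[OF ref_subset] by blast
    then show "y \<in> F" using val(2)[of y] y ab(2) b by simp
  qed
  then show ?thesis by (rule that)
qed

text \<open>Different subgraphs can have the same permutohedron, but nested ones cannot. If
  \<open>(k, j)\<close> is missing in \<open>K\<close>, a flow on the larger graph that uses column
  \<open>j\<close> in every row where it can has a larger \<open>j\<close>-th coordinate than any
  flow on \<open>K\<close> with unit rows.\<close>

lemma perm_eq_ref:
  assumes H: "no_isolated_left H" and K: "K \<subseteq> H" "no_isolated_left K" and eq: "perm K = perm (ref \<phi> H)"
  shows "K = ref \<phi> H"
proof
  define u where "u = uniform K"
  have u: "u \<in> flows K" "fst (marg u) = ones" using uniform_flows uniform_ones[OF K(2)] by (auto simp: u_def)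
  then have "snd (marg u) \<in> perm K" using mconeI[OF u(1)] by (simp add: mem_perm flip: u(2))
  then have "marg u \<in> mcone (ref \<phi> H)" unfolding eq mem_perm by (simp flip: u(2))
  then obtain g where g: "g \<in> flows (ref \<phi> H)" "marg u = marg g" by (rule mconeE)
  have "u \<in> flows (ref \<phi> H)" by (rule ref_flow[OF H flows_mono[OF u(1) K(1)] g])
  then show Kr: "K \<subseteq> ref \<phi> H" using flows_supp supp_uniform[of K] by (auto simp: u_def)
  show "ref \<phi> H \<subseteq> K"
  proof (rule ccontr)
    assume "\<not> ref \<phi> H \<subseteq> K"
    then obtain k j where kj: "(k, j) \<in> ref \<phi> H" "(k, j) \<notin> K" by auto
    obtain c where c: "\<And>i. (i, c i) \<in> ref \<phi> H" using no_isolated_leftD[OF no_isolated_left_ref[OF H, of \<phi>]] by metis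
    define f :: "real^'b^'a" where "f = (\<chi> i. axis (if (i, j) \<in> ref \<phi> H then j else c i) 1)"
    have f: "f \<in> flows (ref \<phi> H)" "\<And>i. (\<Sum>j\<in>UNIV. f$i$j) = 1"
      using c by (auto simp: f_def flows_def axis_def)
    have "marg f = (ones, \<Sum>i\<in>UNIV. f$i)" using f(2) by (simp add: marg_ones_iff)
    then have "(\<Sum>i\<in>UNIV. f$i) \<in> perm K" unfolding eq mem_perm using mconeI[OF f(1)] by simp
    then have "marg f \<in> mcone K" unfolding mem_perm \<open>marg f = _\<close> .
    then obtain g where g: "g \<in> flows K" "marg f = marg g" by (rule mconeE)
    have "(\<Sum>i\<in>UNIV. g$i$j) < (\<Sum>i\<in>UNIV. f$i$j)"
    proof (rule sum_strict_mono_ex1)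
      show "\<forall>i\<in>UNIV. g$i$j \<le> f$i$j"
      proof
        fix i
        show "g$i$j \<le> f$i$j"
        proof (cases "(i, j) \<in> ref \<phi> H")
          case True
          have "g$i$j \<le> (\<Sum>j\<in>UNIV. g$i$j)" by (intro member_le_sum flowsD[OF g(1)]) auto
          also have "\<dots> = 1" using marg_eqD(1)[OF g(2)] f(2) by simp
          finally show ?thesis using True by (simp add: f_def axis_def)
        next
          case False
          then have "(i, j) \<notin> K" using Kr by blast
          then show ?thesis using flowsD(1)[OF f(1)] flowsD(2)[OF g(1)] by simp
        qed
      qed
      show "\<exists>i\<in>UNIV. g$i$j < f$i$j"
        using kj flowsD(2)[OF g(1) kj(2)] by (intro bexI[of _ k]) (auto simp: f_def axis_def)
    qed simp
    then show False using marg_eqD(2)[OF g(2)] by simp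
  qed
qed

section \<open>Geometric subdivisions\<close>

lemma minkowski_cellE:
  assumes "is_minkowski_cell (perm_summands G) C"
  obtains H where "H \<subseteq> G" "no_isolated_left H" "C = perm_summands H"
proof -
  have "\<exists>I. I \<subseteq> nbrs G i \<and> C i = simplex_on I" for i
    using polytope_in_simplexE[of "C i" "nbrs G i"] assms
    by (metis is_minkowski_cell_def perm_summands_def)
  then obtain A where A: "\<And>i. A i \<subseteq> nbrs G i" "\<And>i. C i = simplex_on (A i)" by metis
  have "A i \<noteq> {}" for i
  proof
    assume "A i = {}"
    then have "vertices (C i) = {}" by (simp add: A(2) vertices_simplex_on)
    then show False using assms by (auto simp: is_minkowski_cell_def)
  qed
  then have "no_isolated_left (edges A)" by (simp add: no_isolated_left_def)
  moreover have "edges A \<subseteq> G" using A(1) by (auto simp: edges_def nbrs_def)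
  moreover have "C = perm_summands (edges A)" by (simp add: fun_eq_iff perm_summands_def A(2))
  ultimately show ?thesis using that by blast
qed

lemma is_minkowski_cell_iff:
  assumes "H \<subseteq> G" "no_isolated_left H"
  shows "is_minkowski_cell (perm_summands G) (perm_summands H) \<longleftrightarrow> spans H G"
proof -
  have "nbrs H i \<subseteq> nbrs G i" "nbrs H i \<noteq> {}" for i
    using assms by (auto simp: nbrs_def no_isolated_left_def)
  then show ?thesis
    unfolding is_minkowski_cell_def aff_dim_perm[OF assms(2,1)]
    by (auto simp: perm_summands_def polytope_simplex_on vertices_simplex_on)
qed

lemma perm_summands_Int: "(\<lambda>i. perm_summands H i \<inter> perm_summands K i) = perm_summands (H \<inter> K)"
  by (auto simp: fun_eq_iff perm_summands_def simplex_on_Int nbrs_def intro!: arg_cong[of _ _ simplex_on])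

lemma good_perm_Int:
  assumes "good H K" shows "perm H \<inter> perm K = perm (H \<inter> K)"
proof
  show "perm (H \<inter> K) \<subseteq> perm H \<inter> perm K" using perm_mono[of "H \<inter> K"] by auto
  show "perm H \<inter> perm K \<subseteq> perm (H \<inter> K)"
  proof
    fix y assume "y \<in> perm H \<inter> perm K"
    then have y: "(ones, y) \<in> mcone H" "(ones, y) \<in> mcone K" by (simp_all add: mem_perm)
    obtain f where f: "f \<in> flows H" "(ones, y) = marg f" using y(1) by (rule mconeE)
    obtain g where g: "g \<in> flows K" "(ones, y) = marg g" using y(2) by (rule mconeE)
    have "f \<in> flows K" using goodD(1)[OF assms f(1) g(1)] f(2) g(2) by simp
    then show "y \<in> perm (H \<inter> K)" unfolding mem_perm f(2) using f(1) by (intro mconeI flows_Int)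
  qed
qed

lemma subdiv_imp_mixed:
  assumes sd: "subdiv G TT"
  shows "mixed_subdivision (perm_summands G) (perm_summands ` TT)"
  unfolding mixed_subdivision_def
proof (intro conjI ballI allI)
  fix C assume "C \<in> perm_summands ` TT"
  then obtain H where H: "H \<in> TT" "C = perm_summands H" by blast
  show "is_minkowski_cell (perm_summands G) C"
    using is_minkowski_cell_iff[OF subdivD(1,2)[OF sd H(1)]] subdivD(3)[OF sd H(1)] H(2) by simp
  fix C' assume "C' \<in> perm_summands ` TT"
  then obtain K where K: "K \<in> TT" "C' = perm_summands K" by blast
  have gd: "good H K" by (rule subdivD(5)[OF sd H(1) K(1)])
  then have gd': "good K H" by (simp add: good_sym)
  show "common_face (minkowski C \<inter> minkowski C') (minkowski C) (minkowski C')"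
    unfolding common_face_def H(2) K(2)
    using perm_common_face[OF gd] perm_common_face[OF gd'] by (simp add: Int_commute)
  show "minkowski C \<inter> minkowski C' = minkowski (\<lambda>i. C i \<inter> C' i)"
    unfolding H(2) K(2) perm_summands_Int by (rule good_perm_Int[OF gd])
  show "common_face (C i \<inter> C' i) (C i) (C' i)" for i
    unfolding common_face_def H(2) K(2) perm_summands_def simplex_on_Int by (simp add: simplex_on_face)
next
  show "(\<Union>C\<in>perm_summands ` TT. minkowski C) = perm G"
  proof
    show "(\<Union>C\<in>perm_summands ` TT. minkowski C) \<subseteq> perm G"
      using perm_mono subdivD(1)[OF sd] by blast
    show "perm G \<subseteq> (\<Union>C\<in>perm_summands ` TT. minkowski C)"
    proof
      fix y assume "y \<in> perm G"
      then have "(ones, y) \<in> mcone G" by (simp add: mem_perm)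
      then obtain f where f: "f \<in> flows G" "(ones, y) = marg f" by (rule mconeE)
      then obtain H where "H \<in> TT" "(ones, y) \<in> mcone H" using subdivD(4)[OF sd f(1)] by auto
      then show "y \<in> (\<Union>C\<in>perm_summands ` TT. minkowski C)" by (auto simp: mem_perm)
    qed
  qed
qed

text \<open>The condition on the summands turns a common point of two cells into a point of
  \<open>perm (H \<inter> K)\<close>. This is a face of \<open>perm H\<close>, so
  \<open>H \<inter> K\<close> is a refinement of \<open>H\<close> and captures every flow on
  \<open>H\<close> with these marginals.\<close>

lemma mixed_imp_subdiv:
  fixes G :: "('n::finite \<times> 'd::finite) set"
  assumes neG: "no_isolated_left G" and mix: "mixed_subdivision (perm_summands G) \<C>"
  obtains TT where "subdiv G TT" "\<C> = perm_summands ` TT"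
proof -
  define TT :: "('n \<times> 'd) set set" where "TT = {H. perm_summands H \<in> \<C>}"
  have cell: "is_minkowski_cell (perm_summands G) C" if "C \<in> \<C>" for C
    using mix that by (simp add: mixed_subdivision_def)
  have union: "(\<Union>C\<in>\<C>. minkowski C) = perm G" using mix by (simp add: mixed_subdivision_def)
  have \<C>: "\<C> = perm_summands ` TT"
    unfolding TT_def using minkowski_cellE[OF cell] by blast
  have TT: "H \<subseteq> G" "no_isolated_left H" "spans H G" if "H \<in> TT" for H
  proof -
    have c: "is_minkowski_cell (perm_summands G) (perm_summands H)" using that cell by (simp add: TT_def)
    then obtain K where K: "K \<subseteq> G" "no_isolated_left K" "perm_summands H = perm_summands K"
      by (rule minkowski_cellE)
    have "H = K" using K(3) by (rule injD[OF inj_perm_summands])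
    then show "H \<subseteq> G" "no_isolated_left H" using K by simp_all
    then show "spans H G" using c is_minkowski_cell_iff by blast
  qed
  have inter: "perm H \<inter> perm K = perm (H \<inter> K)" "perm (H \<inter> K) face_of perm H" if "H \<in> TT" "K \<in> TT" for H K
  proof -
    have HK: "perm_summands H \<in> \<C>" "perm_summands K \<in> \<C>" using that by (simp_all add: TT_def)
    then have "common_face (perm H \<inter> perm K) (perm H) (perm K)"
      "perm H \<inter> perm K = minkowski (\<lambda>i. perm_summands H i \<inter> perm_summands K i)"
      using mix unfolding mixed_subdivision_def by blast+
    then show "perm H \<inter> perm K = perm (H \<inter> K)" "perm (H \<inter> K) face_of perm H"
      by (simp_all add: perm_summands_Int common_face_def)
  qed
  interpret section_cover G TT
  proof
    show "no_isolated_left G" by (rule neG)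
    show "C \<subseteq> G" "no_isolated_left C" if "C \<in> TT" for C using TT(1,2)[OF that] .
    show "\<exists>C\<in>TT. marg f \<in> mcone C" if f: "f \<in> flows G" "\<And>i. (\<Sum>j\<in>UNIV. f$i$j) = 1" for f
    proof -
      have m: "marg f = (ones, \<Sum>i\<in>UNIV. f$i)" by (simp add: marg_ones_iff f(2))
      have "(\<Sum>i\<in>UNIV. f$i) \<in> perm G" unfolding mem_perm using mconeI[OF f(1)] m by simp
      then obtain C where "C \<in> TT" "(\<Sum>i\<in>UNIV. f$i) \<in> perm C" unfolding union[symmetric] \<C> by blast
      then show ?thesis unfolding m by (auto simp: mem_perm)
    qed
    show "f \<in> flows K" if HK: "H \<in> TT" "K \<in> TT" and f: "f \<in> flows H" and g: "g \<in> flows K" "marg f = marg g"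
      and f1: "\<And>i. (\<Sum>j\<in>UNIV. f$i$j) = 1" for H K f g
    proof -
      define y where "y = (\<Sum>i\<in>UNIV. f$i)"
      have m: "marg f = (ones, y)" by (simp add: marg_ones_iff f1 y_def)
      have "y \<in> perm H \<inter> perm K" unfolding Int_iff mem_perm using mconeI[OF f] mconeI[OF g(1)] g(2) m by simp
      then have y: "y \<in> perm (H \<inter> K)" using inter(1)[OF HK] by simp
      then obtain \<phi> where \<phi>: "perm (H \<inter> K) = perm (ref \<phi> H)"
        using perm_face_ref[OF TT(2)[OF HK(1)] inter(2)[OF HK]] by blast
      have ne: "no_isolated_left (H \<inter> K)"
      proof (rule no_isolated_leftI)
        fix i
        have "(ones, y) \<in> mcone (H \<inter> K)" using y by (simp add: mem_perm)
        then obtain h where h: "h \<in> flows (H \<inter> K)" "(ones, y) = marg h" by (rule mconeE)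
        have "(\<Sum>j\<in>UNIV. h$i$j) = 1" using h(2) marg_ones_iff[of h y] by simp
        then show "\<exists>j. (i, j) \<in> H \<inter> K" using flowsD(2)[OF h(1)] by (metis sum.neutral zero_neq_one)
      qed
      have eq: "H \<inter> K = ref \<phi> H" by (rule perm_eq_ref[OF TT(2)[OF HK(1)] Int_lower1 ne \<phi>])
      have "marg f \<in> mcone (ref \<phi> H)" using y unfolding \<phi> mem_perm m .
      then obtain h where h: "h \<in> flows (ref \<phi> H)" "marg f = marg h" by (rule mconeE)
      have "f \<in> flows (ref \<phi> H)" by (rule ref_flow[OF TT(2)[OF HK(1)] f h])
      then show ?thesis unfolding eq[symmetric] by (rule flows_mono) simp
    qed
  qed
  have "subdiv G TT" by (rule subdivI) (rule TT(3))
  then show ?thesis using \<C> by (rule that)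
qed

section \<open>Subdivisions of the root polytope\<close>

lemma is_cell_iff:
  assumes "H \<subseteq> G" "H \<noteq> {}"
  shows "is_cell (root_polytope G) (root_polytope H) \<longleftrightarrow> spans H G"
proof -
  have "G \<noteq> {}" using assms by blast
  then show ?thesis
    unfolding is_cell_def using aff_dim_root_polytope[OF assms(1)] assms
    by (auto simp: polytope_root_polytope vertices_root_polytope)
qed

lemma spans_no_isolated:
  assumes "no_isolated_left G" "spans H G" shows "no_isolated_left H"
proof (rule no_isolated_leftI)
  fix i
  obtain j where "(i, j) \<in> G" using no_isolated_leftD[OF assms(1)] by blast
  then obtain c where c: "supp c \<subseteq> H" "marg c = marg (unit_flow i j)" using spansE[OF assms(2)] by blast
  have "(\<Sum>b\<in>UNIV. c$i$b) = 1" using marg_eqD(1)[OF c(2), of i] by simp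
  then obtain b where "c$i$b \<noteq> 0" by (metis sum.neutral zero_neq_one)
  then show "\<exists>j. (i, j) \<in> H" using c(1) by (auto simp: supp_def)
qed

lemma spans_nonempty:
  assumes "no_isolated_left G" "spans H G" shows "H \<noteq> {}"
  using no_isolated_leftD[OF spans_no_isolated[OF assms]] by blast

text \<open>A segment from \<open>v\<close> to \<open>y\<close> that can be prolonged beyond
  \<open>y\<close> inside \<open>S\<close> has \<open>y\<close> in its relative interior, so a face
  through \<open>y\<close> contains \<open>v\<close>.\<close>

lemma face_of_extend:
  fixes S :: "'a::real_vector set"
  assumes F: "F face_of S" "y \<in> F" and v: "v \<in> S" "y + \<epsilon> *\<^sub>R (y - v) \<in> S" and \<epsilon>: "\<epsilon> > 0"
  shows "v \<in> F"
proof (cases "v = y")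
  case False
  let ?w = "y + \<epsilon> *\<^sub>R (y - v)"
  have "y = (1 - 1 / (1 + \<epsilon>)) *\<^sub>R v + (1 / (1 + \<epsilon>)) *\<^sub>R ?w"
  proof -
    have "(1 + \<epsilon>) *\<^sub>R ((1 - 1 / (1 + \<epsilon>)) *\<^sub>R v + (1 / (1 + \<epsilon>)) *\<^sub>R ?w) = (1 + \<epsilon>) *\<^sub>R y"
      using \<epsilon> by (simp add: scaleR_add_right scaleR_add_left right_diff_distrib divide_simps scaleR_diff_right algebra_simps)
    then show ?thesis using \<epsilon> by (metis add_pos_pos scaleR_cancel_left zero_less_one less_irrefl)
  qed
  moreover have "v \<noteq> ?w"
  proof
    assume "v = ?w"
    moreover have "(1 + \<epsilon>) *\<^sub>R (y - v) = ?w - v" by (simp add: scaleR_add_left)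
    ultimately have "(1 + \<epsilon>) *\<^sub>R (y - v) = 0" by (metis diff_self)
    then show False using \<epsilon> False by simp
  qed
  ultimately have "y \<in> open_segment v ?w"
    unfolding in_segment using \<epsilon> by (intro conjI exI[of _ "1 / (1 + \<epsilon>)"]) (auto simp: divide_simps)
  then show ?thesis using face_ofD[OF F(1) _ v F(2)] by blast
qed (use F in simp)

lemma subdiv_imp_polyhedral:
  assumes neG: "no_isolated_left G" and sd: "subdiv G TT"
  shows "polyhedral_subdivision (root_polytope G) (root_polytope ` TT)"
  unfolding polyhedral_subdivision_def
proof (intro conjI ballI)
  fix C assume "C \<in> root_polytope ` TT"
  then obtain H where H: "H \<in> TT" "C = root_polytope H" by blast
  show "is_cell (root_polytope G) C"
    using is_cell_iff[OF subdivD(1)[OF sd H(1)] spans_nonempty[OF neG]] subdivD(3)[OF sd H(1)] H(2) by simp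
  fix C' assume "C' \<in> root_polytope ` TT"
  then obtain K where K: "K \<in> TT" "C' = root_polytope K" by blast
  have gd: "good H K" by (rule subdivD(5)[OF sd H(1) K(1)])
  then have gd': "good K H" by (simp add: good_sym)
  show "common_face (C \<inter> C') C C'"
    unfolding common_face_def H(2) K(2)
    using root_polytope_common_face[OF gd] root_polytope_common_face[OF gd'] by (simp add: Int_commute)
next
  show "\<Union>(root_polytope ` TT) = root_polytope G"
  proof
    show "\<Union>(root_polytope ` TT) \<subseteq> root_polytope G"
      using root_polytope_mono subdivD(1)[OF sd] by blast
    show "root_polytope G \<subseteq> \<Union>(root_polytope ` TT)"
    proof
      fix x assume x: "x \<in> root_polytope G"
      then have "x \<in> mcone G" by (simp add: root_polytope_eq)
      then obtain f where f: "f \<in> flows G" "x = marg f" by (rule mconeE)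
      then obtain H where "H \<in> TT" "x \<in> mcone H" using subdivD(4)[OF sd f(1)] by auto
      then show "x \<in> \<Union>(root_polytope ` TT)" using x by (auto simp: root_polytope_eq)
    qed
  qed
qed

lemma polyhedral_imp_subdiv:
  fixes G :: "('n::finite \<times> 'd::finite) set"
  assumes neG: "no_isolated_left G" and poly: "polyhedral_subdivision (root_polytope G) \<S>"
  obtains TT where "subdiv G TT" "\<S> = root_polytope ` TT"
proof -
  define TT :: "('n \<times> 'd) set set" where "TT = {H. root_polytope H \<in> \<S>}"
  have cell: "is_cell (root_polytope G) C" if "C \<in> \<S>" for C
    using poly that by (simp add: polyhedral_subdivision_def)
  have union: "\<Union>\<S> = root_polytope G" using poly by (simp add: polyhedral_subdivision_def)
  have cellE: "\<exists>H\<subseteq>G. C = root_polytope H" if "C \<in> \<S>" for C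
    using cell[OF that] polytope_in_root_polytopeE[of C G] by (auto simp: is_cell_def)
  have \<S>: "\<S> = root_polytope ` TT"
    unfolding TT_def using cellE by blast
  have "G \<noteq> {}" using no_isolated_leftD[OF neG] by blast
  have TT: "H \<subseteq> G" "spans H G" if "H \<in> TT" for H
  proof -
    have H: "root_polytope H \<in> \<S>" using that by (simp add: TT_def)
    obtain K where K: "K \<subseteq> G" "root_polytope H = root_polytope K" using cellE[OF H] by blast
    have "H = K" using K(2) by (rule injD[OF inj_root_polytope])
    then show sub: "H \<subseteq> G" using K by simp
    have "aff_dim (root_polytope H) = aff_dim (root_polytope G)" using cell[OF H] by (simp add: is_cell_def)
    moreover have "root_polytope G \<noteq> {}" using \<open>G \<noteq> {}\<close> by (simp add: root_polytope_def)
    ultimately have "root_polytope H \<noteq> {}" by (metis aff_dim_empty_eq aff_dim_empty)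
    then have "H \<noteq> {}" by (auto simp: root_polytope_def)
    then show "spans H G" using is_cell_iff[OF sub] cell[OF H] by simp
  qed
  interpret section_cover G TT
  proof
    show "no_isolated_left G" by (rule neG)
    show "C \<subseteq> G" "no_isolated_left C" if "C \<in> TT" for C
      using TT[OF that] spans_no_isolated[OF neG] by simp_all
    let ?n = "real CARD('n)"
    have total: "marg ((1 / ?n) *\<^sub>R f) \<in> total_one" if "\<And>i. (\<Sum>j\<in>UNIV. f$i$j) = 1" for f :: "real^'d^'n"
      using that by (simp add: total_one_def flip: sum_divide_distrib)
    show "\<exists>C\<in>TT. marg f \<in> mcone C" if f: "f \<in> flows G" "\<And>i. (\<Sum>j\<in>UNIV. f$i$j) = 1" for f
    proof -
      have "marg ((1 / ?n) *\<^sub>R f) \<in> root_polytope G"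
        unfolding root_polytope_eq by (intro IntI total f(2) mconeI flows_scaleR f(1)) auto
      then obtain C where C: "C \<in> TT" "marg ((1 / ?n) *\<^sub>R f) \<in> root_polytope C" unfolding union[symmetric] \<S> by blast
      then have "marg ((1 / ?n) *\<^sub>R f) \<in> mcone C" by (simp add: root_polytope_eq)
      then obtain g where g: "g \<in> flows C" "marg ((1 / ?n) *\<^sub>R f) = marg g" by (rule mconeE)
      have "?n *\<^sub>R g \<in> flows C" using g(1) by (intro flows_scaleR) auto
      moreover have "marg (?n *\<^sub>R g) = marg f" using g(2) by (simp add: marg_scaleR flip: g(2))
      ultimately show ?thesis using C(1) mconeI by metis
    qed
    show "f \<in> flows K" if HK: "H \<in> TT" "K \<in> TT" and f: "f \<in> flows H" and g: "g \<in> flows K" "marg f = marg g"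
      and f1: "\<And>i. (\<Sum>j\<in>UNIV. f$i$j) = 1" for H K f g
    proof -
      define e where "e = (1 / ?n) *\<^sub>R f"
      have e: "e \<in> flows H" "marg e \<in> total_one"
        using f total[OF f1] by (auto simp: e_def intro!: flows_scaleR)
      have "marg e = marg ((1 / ?n) *\<^sub>R g)" by (simp add: e_def marg_scaleR g(2))
      moreover have "(1 / ?n) *\<^sub>R g \<in> flows K" using g(1) by (intro flows_scaleR) auto
      ultimately have "marg e \<in> mcone K" by (simp only: mconeI)
      then have y: "marg e \<in> root_polytope H \<inter> root_polytope K"
        using e mconeI[OF e(1)] by (simp add: root_polytope_eq)
      have face: "root_polytope H \<inter> root_polytope K face_of root_polytope H"
        using poly HK unfolding polyhedral_subdivision_def common_face_def TT_def by blast
      have "(i, j) \<in> K" if ij: "f$i$j \<noteq> 0" for i j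
      proof -
        have iH: "(i, j) \<in> H" using flowsD(2)[OF f] ij by blast
        have pos: "0 < e$i$j" using ij flowsD(1)[OF f, of i j] by (simp add: e_def)
        \<comment> \<open>The line from the vertex through \<open>marg e\<close> is prolonged by the
          factor \<open>e$i$j\<close>; entry \<open>(i, j)\<close> becomes the square of
          \<open>e$i$j\<close>, so no entry turns negative.\<close>
        define w where "w = e + e$i$j *\<^sub>R (e - unit_flow i j)"
        have "w \<in> flows H"
          unfolding flows_def
        proof (intro CollectI allI conjI impI)
          fix a b
          have "0 \<le> e$a$b" "0 \<le> e$i$j * e$a$b" using flowsD(1)[OF e(1)] by simp_all
          then show "0 \<le> w$a$b" by (auto simp: w_def right_diff_distrib)
          assume "(a, b) \<notin> H"
          then show "w$a$b = 0" using flowsD(2)[OF e(1)] iH by (auto simp: w_def)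
        qed
        moreover have mw: "marg w = marg e + e$i$j *\<^sub>R (marg e - marg (unit_flow i j))"
          by (simp add: w_def marg_add marg_scaleR marg_diff)
        moreover have "marg w \<in> total_one"
          unfolding mw using mem_affine[OF affine_total_one e(2) unit_total_one, of "1 + e$i$j" "- e$i$j" i j]
          by (simp add: algebra_simps)
        ultimately have "marg e + e$i$j *\<^sub>R (marg e - marg (unit_flow i j)) \<in> root_polytope H"
          unfolding root_polytope_eq using mconeI by (metis IntI)
        moreover have "marg (unit_flow i j) \<in> root_polytope H"
          using iH by (simp add: marg_unit_flow axis_pair_root_polytope)
        ultimately have "marg (unit_flow i j) \<in> root_polytope H \<inter> root_polytope K"
          using face_of_extend[OF face y _ _ pos] by blast
        then show ?thesis by (simp add: marg_unit_flow axis_pair_root_polytope)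
      qed
      then show ?thesis using f by (auto simp: flows_def)
    qed
  qed
  have "subdiv G TT" by (rule subdivI) (rule TT(2))
  then show ?thesis using \<S> by (rule that)
qed

lemma bij_subdiv_mixed:
  assumes "no_isolated_left G"
  shows "bij_betw (image perm_summands) {TT. subdiv G TT} {\<C>. mixed_subdivision (perm_summands G) \<C>}"
  unfolding bij_betw_def
proof
  show "inj_on (image perm_summands) {TT. subdiv G TT}"
    by (rule inj_on_subset[OF _ subset_UNIV]) (simp add: inj_image_eq_iff[OF inj_perm_summands] inj_def)
  show "image perm_summands ` {TT. subdiv G TT} = {\<C>. mixed_subdivision (perm_summands G) \<C>}"
    using subdiv_imp_mixed mixed_imp_subdiv[OF assms] by blast
qed

lemma bij_subdiv_polyhedral:
  assumes "no_isolated_left G"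
  shows "bij_betw (image root_polytope) {TT. subdiv G TT} {\<S>. polyhedral_subdivision (root_polytope G) \<S>}"
  unfolding bij_betw_def
proof
  show "inj_on (image root_polytope) {TT. subdiv G TT}"
    by (rule inj_on_subset[OF _ subset_UNIV]) (simp add: inj_image_eq_iff[OF inj_root_polytope] inj_def)
  show "image root_polytope ` {TT. subdiv G TT} = {\<S>. polyhedral_subdivision (root_polytope G) \<S>}"
    using subdiv_imp_polyhedral[OF assms] polyhedral_imp_subdiv[OF assms] by blast
qed

lemma cayley_image: "cayley (root_polytope ` TT) = perm_summands ` TT"
  by (auto simp: cayley_def inj_image_mem_iff[OF inj_root_polytope])

section \<open>Types of faces\<close>

text \<open>The interior flow of one graph has its marginals in the cone of the other, and
  \<open>good\<close> makes the other graph carry it.\<close>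

lemma good_perm_eq:
  assumes gd: "good K K'" and K: "no_isolated_left K" and K': "no_isolated_left K'" and eq: "perm K = perm K'"
  shows "K = K'"
proof -
  have *: "A \<subseteq> B" if gd: "good A B" and A: "no_isolated_left A" and eq: "perm A = perm B" for A B :: "('a \<times> 'b) set"
  proof -
    have u: "fst (marg (uniform A)) = ones" using uniform_ones[OF A] by auto
    then have "snd (marg (uniform A)) \<in> perm B"
      unfolding eq[symmetric] mem_perm using mconeI[OF uniform_flows[of A]] by (simp flip: u)
    then have "marg (uniform A) \<in> mcone B" unfolding mem_perm by (simp flip: u)
    then obtain g where g: "g \<in> flows B" "marg (uniform A) = marg g" by (rule mconeE)
    have "uniform A \<in> flows B" by (rule goodD(1)[OF gd uniform_flows g])
    then show ?thesis using flows_supp supp_uniform by metis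
  qed
  have "good K' K" using gd by (simp add: good_sym)
  then show ?thesis using *[OF gd K eq] *[OF _ K' eq[symmetric]] by blast
qed

text \<open>Uniqueness ranges over all cells containing the face. A candidate from another cell is
  again a face of the subdivision, and two such faces with the same polytope coincide.\<close>

lemma face_type_perm:
  assumes neG: "no_isolated_left G" and sd: "subdiv G TT" and K: "K \<in> faces TT"
  shows "face_type (perm_summands ` TT) (perm K) = nbrs K"
  unfolding face_type_def
proof (rule the_equality)
  note tom = subdiv_faces_weak_tom[OF neG sd]
  obtain \<phi> H where H: "H \<in> TT" "K = ref \<phi> H" using K by (rule facesE)
  have neH: "no_isolated_left H" by (rule subdivD(2)[OF sd H(1)])
  have neK: "no_isolated_left K" by (rule weak_tomD(2)[OF tom K])
  have "nbrs K i \<subseteq> nbrs H i" for i using ref_subset[of \<phi> H] by (auto simp: H(2) nbrs_def)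
  then show "\<exists>C\<in>perm_summands ` TT. perm K face_of minkowski C \<and>
      perm K = minkowski (\<lambda>i. simplex_on (nbrs K i)) \<and>
      (\<forall>i. nbrs K i \<noteq> {} \<and> simplex_on (nbrs K i) face_of C i)"
    using H perm_ref_face[OF neH, of \<phi>] neK
    by (intro bexI[of _ "perm_summands H"] conjI allI)
      (auto simp: perm_summands_def[abs_def] no_isolated_left_def simplex_on_face)
  fix A assume "\<exists>C\<in>perm_summands ` TT. perm K face_of minkowski C \<and>
      perm K = minkowski (\<lambda>i. simplex_on (A i)) \<and> (\<forall>i. A i \<noteq> {} \<and> simplex_on (A i) face_of C i)"
  then obtain H' where H': "H' \<in> TT" "perm K face_of perm H'" "perm K = minkowski (\<lambda>i. simplex_on (A i))"
    "\<And>i. A i \<noteq> {}" "\<And>i. simplex_on (A i) face_of simplex_on (nbrs H' i)"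
    by (auto simp: perm_summands_def)
  define L where "L = edges A"
  have L: "nbrs L = A" "no_isolated_left L" "perm L = perm K"
    using H'(3,4) by (simp_all add: L_def no_isolated_left_def perm_summands_def[abs_def])
  have "L \<subseteq> H'"
  proof clarify
    fix i j assume "(i, j) \<in> L"
    then have "axis j 1 \<in> simplex_on (A i)" by (simp add: L_def edges_def axis_simplex_on)
    then have "axis j 1 \<in> simplex_on (nbrs H' i)" using face_of_imp_subset[OF H'(5)] by blast
    then show "(i, j) \<in> H'" by (simp add: axis_simplex_on nbrs_def)
  qed
  have neH': "no_isolated_left H'" by (rule subdivD(2)[OF sd H'(1)])
  obtain \<psi> where \<psi>: "perm K = perm (ref \<psi> H')" using perm_face_ref[OF neH' H'(2) perm_nonempty[OF neK]] .
  have "L = ref \<psi> H'" by (rule perm_eq_ref[OF neH' \<open>L \<subseteq> H'\<close> L(2)]) (simp add: L(3) \<psi>)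
  then have "L \<in> faces TT" using H'(1) by (auto simp: faces_def)
  then have "L = K" by (rule good_perm_eq[OF weak_tomD(5)[OF tom _ K] L(2) neK L(3)])
  then show "A = nbrs K" using L(1) by simp
qed

lemma mixed_faces_perm:
  assumes sd: "subdiv G TT"
  shows "mixed_faces (perm_summands ` TT) = perm ` faces TT"
proof
  show "mixed_faces (perm_summands ` TT) \<subseteq> perm ` faces TT"
  proof
    fix F assume "F \<in> mixed_faces (perm_summands ` TT)"
    then obtain H where H: "F \<noteq> {}" "H \<in> TT" "F face_of perm H" by (auto simp: mixed_faces_def)
    obtain \<phi> where "F = perm (ref \<phi> H)" using perm_face_ref[OF subdivD(2)[OF sd H(2)] H(3,1)] .
    then show "F \<in> perm ` faces TT" using H(2) by (auto simp: faces_def)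
  qed
  show "perm ` faces TT \<subseteq> mixed_faces (perm_summands ` TT)"
  proof
    fix F assume "F \<in> perm ` faces TT"
    then obtain \<phi> H where H: "H \<in> TT" "F = perm (ref \<phi> H)" by (auto simp: faces_def)
    have "no_isolated_left H" by (rule subdivD(2)[OF sd H(1)])
    then show "F \<in> mixed_faces (perm_summands ` TT)"
      using H perm_ref_face perm_nonempty[OF no_isolated_left_ref] by (auto simp: mixed_faces_def)
  qed
qed

lemma types_of_faces_perm:
  assumes "no_isolated_left G" "subdiv G TT"
  shows "types_of_faces (perm_summands ` TT) = nbrs ` faces TT"
  unfolding types_of_faces_def mixed_faces_perm[OF assms(2)] image_image
  by (rule image_cong[OF refl face_type_perm[OF assms]])

theorem theorem3p7:
  fixes G :: "('n::finite \<times> 'd::finite) set"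
  assumes "no_isolated_left G"
  shows "bij_betw types_of_faces
           {\<C>. mixed_subdivision (perm_summands G) \<C>}
           {\<O>. tropical_oriented_matroid G \<O>}
       \<and> bij_betw (types_of_faces \<circ> cayley)
           {\<S>. polyhedral_subdivision (root_polytope G) \<S>}
           {\<O>. tropical_oriented_matroid G \<O>}"
proof
  note tom = bij_subdiv_tom[OF assms]
  have "bij_betw (types_of_faces \<circ> image perm_summands) {TT. subdiv G TT} {\<O>. tropical_oriented_matroid G \<O>}"
    using tom by (subst bij_betw_cong[where g = "\<lambda>TT. nbrs ` faces TT"]) (simp_all add: types_of_faces_perm[OF assms])
  then show "bij_betw types_of_faces {\<C>. mixed_subdivision (perm_summands G) \<C>} {\<O>. tropical_oriented_matroid G \<O>}"
    by (simp only: bij_betw_comp_iff[OF bij_subdiv_mixed[OF assms]])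
  have "bij_betw ((types_of_faces \<circ> cayley) \<circ> image root_polytope) {TT. subdiv G TT} {\<O>. tropical_oriented_matroid G \<O>}"
    using tom by (subst bij_betw_cong[where g = "\<lambda>TT. nbrs ` faces TT"])
      (simp_all add: types_of_faces_perm[OF assms] cayley_image)
  then show "bij_betw (types_of_faces \<circ> cayley) {\<S>. polyhedral_subdivision (root_polytope G) \<S>}
      {\<O>. tropical_oriented_matroid G \<O>}"
    by (simp only: bij_betw_comp_iff[OF bij_subdiv_polyhedral[OF assms]])
qed

end
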